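(* Let $Q\ne0$ and let $V(z)$ belong to the class $\mathfrak N^Q$, i.e. $$V(z)=Q+\int_{\mathbb R}\left(\frac{1}{\lambda-z}-\frac{\lambda}{1+\lambda^2}\right)d\mu(\lambda),\qquad \int_{\mathbb R}\frac{d\mu(\lambda)}{1+\lambda^2}=a<\infty,$$ with $\mu$ an infinite Borel measure. Then $V(z)$ can be realized as the impedance function $V_\Theta(z)$ of a minimal L-system $\Theta$ (with one-dimensional input-output space $\mathbb C$ and $J=1$) with the main operator $T$ having von Neumann parameter $\kappa=\kappa(Q)$ and the quasi-kernel $\hat A$ of $\mathrm{Re}\,\mathbb A$ having von Neumann parameter $U=U(Q)$. Moreover, with $b=Q^2+a^2-1$, exactly one of the following takes place: (1) ($a=1$) $\displaystyle \kappa=\frac{|Q|}{\sqrt{Q^2+4}}$ and $\displaystyle U=\frac{Q}{|Q|}\cdot\frac{-Q+2i}{\sqrt{Q^2+4}}$; (2) ($0<a<1$) $\displaystyle \kappa=\frac{\left(b-2Q^2-\sqrt{b^2+4Q^2}\right)^2-a\left(b-\sqrt{b^2+4Q^2}\right)^2+4Q^2a(a-1)}{\left(b-2Q^2-\sqrt{b^2+4Q^2}\right)^2+a\left(b-\sqrt{b^2+4Q^2}\right)^2+4Q^2a(a+1)}$ and $\displaystyle U=\frac{(a+Qi)(1-\kappa^2)-1-\kappa^2}{2\kappa}$; (3) ($a>1$) $\displaystyle \kappa=\frac{a\left(b+\sqrt{b^2+4Q^2}\right)^2-\left(b-2Q^2+\sqrt{b^2+4Q^2}\right)^2-4Q^2a(a-1)}{\left(b-2Q^2+\sqrt{b^2+4Q^2}\right)^2+a\left(b+\sqrt{b^2+4Q^2}\right)^2+4Q^2a(a+1)}$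 and $\displaystyle U=\frac{(a+Qi)(1-\kappa^2)-1-\kappa^2}{2\kappa}$.
   Context: Rigged space: for a closed densely defined symmetric operator $\dot A$ with deficiency indices $(1,1)$ in a complex Hilbert space $\mathcal H$, let $\mathcal H_+=\mathrm{Dom}(\dot A^* )$ with $(f,g)_+=(f,g)+(\dot A^*f,\dot A^*g)$, and let $\mathcal H_+\subset\mathcal H\subset\mathcal H_-$ be the associated rigged Hilbert space. $[X,Y]$ denotes bounded linear operators. If $\mathbb A\in[\mathcal H_+,\mathcal H_-]$ then $\mathbb A^*\in[\mathcal H_+,\mathcal H_-]$; $\mathrm{Re}\,\mathbb A=(\mathbb A+\mathbb A^* )/2$, $\mathrm{Im}\,\mathbb A=(\mathbb A-\mathbb A^* )/2i$. The quasi-kernel $\hat A$ of $\mathrm{Re}\,\mathbb A$ is its restriction to $\{f\in\mathcal H_+:\mathrm{Re}\,\mathbb A f\in\mathcal H\}$. L-system: let $T$ be a non-symmetric operator with $\dot A\subset T\subset\dot A^*$, $\rho(T)\ne\emptyset$, $\mathrm{Dom}(\dot A)=\mathrm{Dom}(T)\cap\mathrm{Dom}(T^* )$. A $( * )$-extension of $T$ is $\mathbb A\in[\mathcal H_+,\mathcal H_-]$ with $\dot A\subset T\subset\mathbb A$, $\dot A\subset T^*\subset\mathbb A^*$ such that the quasi-kernel $\hat A$ of $\mathrm{Re}\,\mathbb A$ is self-adjoint in $\mathcal H$. An L-system is $\Theta=\begin{pmatrix}\mathbb A&K&1\\ \mathcal H_+\subset\mathcal H\subset\mathcal H_-&&\mathbb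 C\end{pmatrix}$ where $\mathbb A$ is a $( * )$-extension of such a $T$ (main operator), $K\in[\mathbb C,\mathcal H_-]$, $\mathrm{Im}\,\mathbb A=KK^*$, $\mathrm{Ran}(K)=\mathrm{Ran}(\mathrm{Im}\,\mathbb A)$. It is minimal if $\dot A$ is prime (no nontrivial reducing subspace on which $\dot A$ induces a self-adjoint operator). Impedance function: $V_\Theta(z)=K^*(\mathrm{Re}\,\mathbb A-zI)^{-1}K$, $z\in\rho(\hat A)$. "Realized" means $V=V_\Theta$ on $\mathbb C_\pm$ ($V$ extended by $V(\bar z)=\overline{V(z)}$). Parameters: for normalized $g_\pm\in\mathrm{Ker}(\dot A^*\mp iI)$, the von Neumann parameter $\kappa$ of $T$ is defined by $g_+-\kappa g_-\in\mathrm{Dom}(T)$, $|\kappa|<1$; $g_\pm$ are chosen (changing the phase of $g_-$) so that $0\le\kappa<1$. The parameter $U$ ($|U|=1$) of $\hat A$ is defined, with respect to the same pair, by $g_++Ug_-\in\mathrm{Dom}(\hat A)$. *)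

theory Defs
  imports "HOL-Analysis.Analysis" "HOL-Algebra.Algebraic_Closure_Type"
begin

section \<open>Complex Hilbert spaces\<close>

text \<open>The space is a record with an explicit carrier, so that a Hilbert space can be
  quantified over existentially and restricted to a subspace. The ring operations
  \<open>mult\<close> and \<open>one\<close>, inherited from the module record, play no role.
  The inner product is linear in its first argument.\<close>

record 'a inner_module = "(complex, 'a) module" +
  ip :: "'a \<Rightarrow> 'a \<Rightarrow> complex"

definition hnorm :: "('a, 'm) inner_module_scheme \<Rightarrow> 'a \<Rightarrow> real" where
  "hnorm H x = sqrt (Re (ip H x x))"

text \<open>Set to 0 off the carrier because \<open>Metric_space\<close> asks for nonnegativity and
  symmetry on the whole type.\<close>

definition hdist :: "('a, 'm) inner_module_scheme \<Rightarrow> 'a \<Rightarrow> 'a \<Rightarrow> real" where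
  "hdist H x y = (if x \<in> carrier H \<and> y \<in> carrier H then hnorm H (x \<ominus>\<^bsub>H\<^esub> y) else 0)"

definition htopology :: "('a, 'm) inner_module_scheme \<Rightarrow> 'a topology" where
  "htopology H = Metric_space.mtopology (carrier H) (hdist H)"

locale chilbert_space = Module.module "ring_of_type_algebra :: complex ring" H
  for H :: "('a, 'm) inner_module_scheme" (structure) +
  assumes ip_add: "\<lbrakk>x \<in> carrier H; y \<in> carrier H; z \<in> carrier H\<rbrakk>
      \<Longrightarrow> ip H (x \<oplus> y) z = ip H x z + ip H y z"
    and ip_smult: "\<lbrakk>x \<in> carrier H; y \<in> carrier H\<rbrakk> \<Longrightarrow> ip H (c \<odot> x) y = c * ip H x y"
    and ip_cnj: "\<lbrakk>x \<in> carrier H; y \<in> carrier H\<rbrakk> \<Longrightarrow> ip H y x = cnj (ip H x y)"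
    and ip_pos: "\<lbrakk>x \<in> carrier H; x \<noteq> \<zero>\<rbrakk> \<Longrightarrow> 0 < Re (ip H x x)"
    and complete: "Metric_space.mcomplete (carrier H) (hdist H)"


section \<open>Unbounded operators, represented by their graphs\<close>

definition linear_operator :: "('a, 'm) inner_module_scheme \<Rightarrow> ('a \<times> 'a) set \<Rightarrow> bool" where
  "linear_operator H A \<longleftrightarrow> A \<subseteq> carrier H \<times> carrier H \<and> single_valued A \<and>
     (\<zero>\<^bsub>H\<^esub>, \<zero>\<^bsub>H\<^esub>) \<in> A \<and>
     (\<forall>(f, f') \<in> A. \<forall>(g, g') \<in> A. (f \<oplus>\<^bsub>H\<^esub> g, f' \<oplus>\<^bsub>H\<^esub> g') \<in> A) \<and>
     (\<forall>c. \<forall>(f, f') \<in> A. (c \<odot>\<^bsub>H\<^esub> f, c \<odot>\<^bsub>H\<^esub> f') \<in> A)"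

definition op_apply :: "('a \<times> 'a) set \<Rightarrow> 'a \<Rightarrow> 'a" where
  "op_apply A f = (THE g. (f, g) \<in> A)"

definition densely_defined :: "('a, 'm) inner_module_scheme \<Rightarrow> ('a \<times> 'a) set \<Rightarrow> bool" where
  "densely_defined H A \<longleftrightarrow> htopology H closure_of Domain A = carrier H"

definition closed_operator :: "('a, 'm) inner_module_scheme \<Rightarrow> ('a \<times> 'a) set \<Rightarrow> bool" where
  "closed_operator H A \<longleftrightarrow> closedin (prod_topology (htopology H) (htopology H)) A"

definition hadjoint :: "('a, 'm) inner_module_scheme \<Rightarrow> ('a \<times> 'a) set \<Rightarrow> ('a \<times> 'a) set" where
  "hadjoint H A = {(g, g'). g \<in> carrier H \<and> g' \<in> carrier H \<and>
     (\<forall>(f, f') \<in> A. ip H f' g = ip H f g')}"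

definition symmetric_operator :: "('a, 'm) inner_module_scheme \<Rightarrow> ('a \<times> 'a) set \<Rightarrow> bool" where
  "symmetric_operator H A \<longleftrightarrow> A \<subseteq> hadjoint H A"

definition selfadjoint_operator :: "('a, 'm) inner_module_scheme \<Rightarrow> ('a \<times> 'a) set \<Rightarrow> bool" where
  "selfadjoint_operator H A \<longleftrightarrow> linear_operator H A \<and> densely_defined H A \<and> hadjoint H A = A"

definition eigenspace :: "('a, 'm) inner_module_scheme \<Rightarrow> ('a \<times> 'a) set \<Rightarrow> complex \<Rightarrow> 'a set" where
  "eigenspace H A z = {f. (f, z \<odot>\<^bsub>H\<^esub> f) \<in> A}"

definition one_dimensional :: "('a, 'm) inner_module_scheme \<Rightarrow> 'a set \<Rightarrow> bool" where
  "one_dimensional H N \<longleftrightarrow>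
     (\<exists>g \<in> carrier H. g \<noteq> \<zero>\<^bsub>H\<^esub> \<and> N = range (\<lambda>c. c \<odot>\<^bsub>H\<^esub> g))"

definition deficiency_indices_1_1 ::
    "('a, 'm) inner_module_scheme \<Rightarrow> ('a \<times> 'a) set \<Rightarrow> bool" where
  "deficiency_indices_1_1 H A \<longleftrightarrow> one_dimensional H (eigenspace H (hadjoint H A) \<i>) \<and>
     one_dimensional H (eigenspace H (hadjoint H A) (- \<i>))"

definition resolvent_set :: "('a, 'm) inner_module_scheme \<Rightarrow> ('a \<times> 'a) set \<Rightarrow> complex set" where
  "resolvent_set H A = {z.
     (\<forall>h \<in> carrier H. \<exists>!f. (f, h \<oplus>\<^bsub>H\<^esub> z \<odot>\<^bsub>H\<^esub> f) \<in> A) \<and>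
     (\<exists>C. \<forall>(f, g) \<in> A. hnorm H f \<le> C * hnorm H (g \<ominus>\<^bsub>H\<^esub> z \<odot>\<^bsub>H\<^esub> f))}"

definition closed_subspace :: "('a, 'm) inner_module_scheme \<Rightarrow> 'a set \<Rightarrow> bool" where
  "closed_subspace H M \<longleftrightarrow>
     submodule M (ring_of_type_algebra :: complex ring) H \<and> closedin (htopology H) M"

definition orth_complement :: "('a, 'm) inner_module_scheme \<Rightarrow> 'a set \<Rightarrow> 'a set" where
  "orth_complement H M = {x \<in> carrier H. \<forall>y \<in> M. ip H x y = 0}"

text \<open>That is, with \<open>P\<close> the orthogonal projection onto \<open>M\<close>, \<open>P\<close> maps the domain of \<open>A\<close>
  into itself and commutes with \<open>A\<close> there.\<close>

definition reduces :: "('a, 'm) inner_module_scheme \<Rightarrow> 'a set \<Rightarrow> ('a \<times> 'a) set \<Rightarrow> bool" where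
  "reduces H M A \<longleftrightarrow> closed_subspace H M \<and>
     (\<forall>(f, g) \<in> A. \<exists>f1 \<in> M. \<exists>f2 \<in> orth_complement H M. \<exists>g1 \<in> M. \<exists>g2 \<in> orth_complement H M.
        f = f1 \<oplus>\<^bsub>H\<^esub> f2 \<and> g = g1 \<oplus>\<^bsub>H\<^esub> g2 \<and> (f1, g1) \<in> A)"

definition prime_operator :: "('a, 'm) inner_module_scheme \<Rightarrow> ('a \<times> 'a) set \<Rightarrow> bool" where
  "prime_operator H A \<longleftrightarrow> \<not> (\<exists>M. M \<noteq> {\<zero>\<^bsub>H\<^esub>} \<and> reduces H M A \<and>
     selfadjoint_operator (H\<lparr>carrier := M\<rparr>) (A \<inter> M \<times> M))"


section \<open>The rigged Hilbert space of a symmetric operator\<close>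

text \<open>Throughout, \<open>A\<close> is the symmetric operator generating the rigging.\<close>

definition plus_space ::
    "('a, 'm) inner_module_scheme \<Rightarrow> ('a \<times> 'a) set \<Rightarrow> ('a, 'm) inner_module_scheme" where
  "plus_space H A = H\<lparr>carrier := Domain (hadjoint H A),
     ip := (\<lambda>f g. ip H f g + ip H (op_apply (hadjoint H A) f) (op_apply (hadjoint H A) g))\<rparr>"

text \<open>\<open>H\<^sub>-\<close> is realized as the space of bounded antilinear functionals on \<open>H\<^sub>+\<close>; the value
  \<open>F f\<close> is the pairing \<open>(F, f)\<close>. Functionals vanish off \<open>H\<^sub>+\<close>, so that equal elements
  of \<open>H\<^sub>-\<close> are equal as HOL functions.\<close>

definition minus_space ::
    "('a, 'm) inner_module_scheme \<Rightarrow> ('a \<times> 'a) set \<Rightarrow> ('a \<Rightarrow> complex) set" where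
  "minus_space H A = (let P = plus_space H A in {F.
     (\<forall>f \<in> carrier P. \<forall>g \<in> carrier P. F (f \<oplus>\<^bsub>H\<^esub> g) = F f + F g) \<and>
     (\<forall>c. \<forall>f \<in> carrier P. F (c \<odot>\<^bsub>H\<^esub> f) = cnj c * F f) \<and>
     (\<exists>C. \<forall>f \<in> carrier P. cmod (F f) \<le> C * hnorm P f) \<and>
     (\<forall>f. f \<notin> carrier P \<longrightarrow> F f = 0)})"

definition minus_norm ::
    "('a, 'm) inner_module_scheme \<Rightarrow> ('a \<times> 'a) set \<Rightarrow> ('a \<Rightarrow> complex) \<Rightarrow> real" where
  "minus_norm H A F = (let P = plus_space H A in
     (SUP f \<in> {f \<in> carrier P. hnorm P f \<le> 1}. cmod (F f)))"

definition embed :: "('a, 'm) inner_module_scheme \<Rightarrow> ('a \<times> 'a) set \<Rightarrow> 'a \<Rightarrow> ('a \<Rightarrow> complex)" where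
  "embed H A h = (\<lambda>f. if f \<in> carrier (plus_space H A) then ip H h f else 0)"

definition bounded_plus_minus ::
    "('a, 'm) inner_module_scheme \<Rightarrow> ('a \<times> 'a) set \<Rightarrow> ('a \<Rightarrow> 'a \<Rightarrow> complex) \<Rightarrow> bool" where
  "bounded_plus_minus H A B \<longleftrightarrow> (let P = plus_space H A in
     (\<forall>f \<in> carrier P. B f \<in> minus_space H A) \<and>
     (\<forall>f \<in> carrier P. \<forall>g \<in> carrier P. B (f \<oplus>\<^bsub>H\<^esub> g) = (\<lambda>x. B f x + B g x)) \<and>
     (\<forall>c. \<forall>f \<in> carrier P. B (c \<odot>\<^bsub>H\<^esub> f) = (\<lambda>x. c * B f x)) \<and>
     (\<exists>C. \<forall>f \<in> carrier P. minus_norm H A (B f) \<le> C * hnorm P f))"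

text \<open>The adjoint with respect to the pairing: \<open>(B f, g) = (f, B\<^sup>* g)\<close> for \<open>f, g\<close> in \<open>H\<^sub>+\<close>,
  where \<open>(f, F)\<close> is the conjugate of \<open>(F, f)\<close>.\<close>

definition adj_pm :: "('a, 'm) inner_module_scheme \<Rightarrow> ('a \<times> 'a) set \<Rightarrow>
    ('a \<Rightarrow> 'a \<Rightarrow> complex) \<Rightarrow> ('a \<Rightarrow> 'a \<Rightarrow> complex)" where
  "adj_pm H A B = (\<lambda>g f. if f \<in> carrier (plus_space H A) then cnj (B f g) else 0)"

definition Re_pm :: "('a, 'm) inner_module_scheme \<Rightarrow> ('a \<times> 'a) set \<Rightarrow>
    ('a \<Rightarrow> 'a \<Rightarrow> complex) \<Rightarrow> ('a \<Rightarrow> 'a \<Rightarrow> complex)" where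
  "Re_pm H A B = (\<lambda>f g. (B f g + adj_pm H A B f g) / 2)"

definition Im_pm :: "('a, 'm) inner_module_scheme \<Rightarrow> ('a \<times> 'a) set \<Rightarrow>
    ('a \<Rightarrow> 'a \<Rightarrow> complex) \<Rightarrow> ('a \<Rightarrow> 'a \<Rightarrow> complex)" where
  "Im_pm H A B = (\<lambda>f g. (B f g - adj_pm H A B f g) / (2 * \<i>))"

definition quasi_kernel :: "('a, 'm) inner_module_scheme \<Rightarrow> ('a \<times> 'a) set \<Rightarrow>
    ('a \<Rightarrow> 'a \<Rightarrow> complex) \<Rightarrow> ('a \<times> 'a) set" where
  "quasi_kernel H A B = {(f, h). f \<in> carrier (plus_space H A) \<and> h \<in> carrier H \<and>
     Re_pm H A B f = embed H A h}"

definition extended_by :: "('a, 'm) inner_module_scheme \<Rightarrow> ('a \<times> 'a) set \<Rightarrow> ('a \<times> 'a) set \<Rightarrow>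
    ('a \<Rightarrow> 'a \<Rightarrow> complex) \<Rightarrow> bool" where
  "extended_by H A T B \<longleftrightarrow>
     (\<forall>(f, h) \<in> T. f \<in> carrier (plus_space H A) \<and> B f = embed H A h)"


section \<open>L-systems\<close>

record 'a l_system =
  state_space :: "'a inner_module"
  sym_op :: "('a \<times> 'a) set"
  main_op :: "('a \<times> 'a) set"
  state_op :: "'a \<Rightarrow> 'a \<Rightarrow> complex"
  channel_op :: "complex \<Rightarrow> 'a \<Rightarrow> complex"

definition admissible_main_operator ::
    "('a, 'm) inner_module_scheme \<Rightarrow> ('a \<times> 'a) set \<Rightarrow> ('a \<times> 'a) set \<Rightarrow> bool" where
  "admissible_main_operator H A T \<longleftrightarrow> linear_operator H T \<and> \<not> symmetric_operator H T \<and>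
     A \<subseteq> T \<and> T \<subseteq> hadjoint H A \<and> resolvent_set H T \<noteq> {} \<and>
     Domain A = Domain T \<inter> Domain (hadjoint H T)"

definition star_extension :: "('a, 'm) inner_module_scheme \<Rightarrow> ('a \<times> 'a) set \<Rightarrow> ('a \<times> 'a) set \<Rightarrow>
    ('a \<Rightarrow> 'a \<Rightarrow> complex) \<Rightarrow> bool" where
  "star_extension H A T B \<longleftrightarrow> bounded_plus_minus H A B \<and>
     A \<subseteq> T \<and> extended_by H A T B \<and>
     A \<subseteq> hadjoint H T \<and> extended_by H A (hadjoint H T) (adj_pm H A B) \<and>
     selfadjoint_operator H (quasi_kernel H A B)"

definition bounded_channel ::
    "('a, 'm) inner_module_scheme \<Rightarrow> ('a \<times> 'a) set \<Rightarrow> (complex \<Rightarrow> 'a \<Rightarrow> complex) \<Rightarrow> bool" where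
  "bounded_channel H A K \<longleftrightarrow> (\<forall>c. K c \<in> minus_space H A) \<and>
     (\<forall>c d. K (c + d) = (\<lambda>f. K c f + K d f)) \<and>
     (\<forall>c d. K (c * d) = (\<lambda>f. c * K d f)) \<and>
     (\<exists>C. \<forall>c. minus_norm H A (K c) \<le> C * cmod c)"

text \<open>The adjoint from \<open>H\<^sub>+\<close> to the complex numbers: \<open>(K c, f) = c * cnj (K\<^sup>* f)\<close>, evaluated
  at \<open>c = 1\<close>.\<close>

definition channel_adj :: "(complex \<Rightarrow> 'a \<Rightarrow> complex) \<Rightarrow> 'a \<Rightarrow> complex" where
  "channel_adj K f = cnj (K 1 f)"

text \<open>Conventions: input-output space \<open>\<complex>\<close> and directing operator \<open>J = 1\<close>.\<close>

definition is_l_system :: "'a l_system \<Rightarrow> bool" where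
  "is_l_system \<Theta> \<longleftrightarrow> (let H = state_space \<Theta>; A = sym_op \<Theta>; T = main_op \<Theta>;
       B = state_op \<Theta>; K = channel_op \<Theta> in
     chilbert_space H \<and>
     linear_operator H A \<and> densely_defined H A \<and> closed_operator H A \<and>
     symmetric_operator H A \<and> deficiency_indices_1_1 H A \<and>
     admissible_main_operator H A T \<and> star_extension H A T B \<and> bounded_channel H A K \<and>
     (\<forall>f \<in> carrier (plus_space H A). Im_pm H A B f = K (channel_adj K f)) \<and>
     range K = Im_pm H A B ` carrier (plus_space H A))"

definition minimal_l_system :: "'a l_system \<Rightarrow> bool" where
  "minimal_l_system \<Theta> \<longleftrightarrow> is_l_system \<Theta> \<and> prime_operator (state_space \<Theta>) (sym_op \<Theta>)"

definition system_quasi_kernel :: "'a l_system \<Rightarrow> ('a \<times> 'a) set" where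
  "system_quasi_kernel \<Theta> = quasi_kernel (state_space \<Theta>) (sym_op \<Theta>) (state_op \<Theta>)"

definition Re_minus_z :: "'a l_system \<Rightarrow> complex \<Rightarrow> 'a \<Rightarrow> ('a \<Rightarrow> complex)" where
  "Re_minus_z \<Theta> z f = (let H = state_space \<Theta>; A = sym_op \<Theta> in
     (\<lambda>g. Re_pm H A (state_op \<Theta>) f g - z * embed H A f g))"

text \<open>An operator from \<open>\<complex>\<close> to \<open>\<complex>\<close> is identified with its value at 1. Meaningful for \<open>z\<close> in
  the resolvent set of the quasi-kernel, where \<open>Re_minus_z\<close> is injective on \<open>H\<^sub>+\<close>.\<close>

definition impedance :: "'a l_system \<Rightarrow> complex \<Rightarrow> complex" where
  "impedance \<Theta> z = (let K = channel_op \<Theta>;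
       H_plus = carrier (plus_space (state_space \<Theta>) (sym_op \<Theta>)) in
     channel_adj K (inv_into H_plus (Re_minus_z \<Theta> z) (K 1)))"

text \<open>The first two conjuncts make sure that \<open>impedance \<Theta> z\<close> is defined.\<close>

definition realized_by :: "(complex \<Rightarrow> complex) \<Rightarrow> 'a l_system \<Rightarrow> bool" where
  "realized_by V \<Theta> \<longleftrightarrow> (\<forall>z. Im z \<noteq> 0 \<longrightarrow>
     z \<in> resolvent_set (state_space \<Theta>) (system_quasi_kernel \<Theta>) \<and>
     channel_op \<Theta> 1 \<in> Re_minus_z \<Theta> z ` carrier (plus_space (state_space \<Theta>) (sym_op \<Theta>)) \<and>
     V z = impedance \<Theta> z)"

definition normalized_deficiency_pair :: "'a l_system \<Rightarrow> 'a \<Rightarrow> 'a \<Rightarrow> bool" where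
  "normalized_deficiency_pair \<Theta> gp gm \<longleftrightarrow> (let H = state_space \<Theta>; S = hadjoint H (sym_op \<Theta>) in
     gp \<in> eigenspace H S \<i> \<and> hnorm H gp = 1 \<and> gm \<in> eigenspace H S (- \<i>) \<and> hnorm H gm = 1)"

definition main_parameter :: "'a l_system \<Rightarrow> 'a \<Rightarrow> 'a \<Rightarrow> complex \<Rightarrow> bool" where
  "main_parameter \<Theta> gp gm \<kappa> \<longleftrightarrow> (let H = state_space \<Theta> in
     cmod \<kappa> < 1 \<and> gp \<ominus>\<^bsub>H\<^esub> \<kappa> \<odot>\<^bsub>H\<^esub> gm \<in> Domain (main_op \<Theta>))"

definition quasi_kernel_parameter :: "'a l_system \<Rightarrow> 'a \<Rightarrow> 'a \<Rightarrow> complex \<Rightarrow> bool" where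
  "quasi_kernel_parameter \<Theta> gp gm U \<longleftrightarrow> (let H = state_space \<Theta> in
     cmod U = 1 \<and> gp \<oplus>\<^bsub>H\<^esub> U \<odot>\<^bsub>H\<^esub> gm \<in> Domain (system_quasi_kernel \<Theta>))"


section \<open>The function class and the parameter formulas\<close>

definition class_N :: "real \<Rightarrow> real \<Rightarrow> (complex \<Rightarrow> complex) \<Rightarrow> bool" where
  "class_N Q a V \<longleftrightarrow> (\<exists>\<mu> :: real measure.
     sets \<mu> = sets borel \<and> emeasure \<mu> UNIV = \<infinity> \<and>
     integrable \<mu> (\<lambda>t. 1 / (1 + t\<^sup>2)) \<and> (LINT t|\<mu>. 1 / (1 + t\<^sup>2)) = a \<and>
     (\<forall>z. Im z \<noteq> 0 \<longrightarrow>
        V z = of_real Q + (LINT t|\<mu>. 1 / (of_real t - z) - of_real (t / (1 + t\<^sup>2)))))"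

definition exactly_one :: "bool \<Rightarrow> bool \<Rightarrow> bool \<Rightarrow> bool" where
  "exactly_one P Q R \<longleftrightarrow> (P \<and> \<not> Q \<and> \<not> R) \<or> (\<not> P \<and> Q \<and> \<not> R) \<or> (\<not> P \<and> \<not> Q \<and> R)"

end

(* Take H = L^2(mu), and let A be multiplication by the variable t on those f in L^2(mu) with t f in
   L^2(mu) and integral 0; A is densely defined because mu is infinite. Its adjoint is
   f |-> t f - c, where c = c(f) is the only constant that makes the result square integrable. Let
   phi(f) be Q c(f) plus the regularized integral of f. Then (c, phi) is a boundary triple:
     (A* f, g) - (f, A* g) = phi(f) cnj(c(g)) - c(f) cnj(phi(g)),
   and the state space operator f |-> A* f + (c(f) + i phi(f)) phi, with channel x |-> x phi, is an
   L-system whose main operator has the domain c + i phi = 0 and whose quasi-kernel has the domain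
   c = 0. The deficiency vectors are the Cauchy kernels 1/(t - z); they satisfy c = 1 and phi = V(z),
   so the impedance function is V. The parameters are read off from V(i) = Q + i a and
   V(-i) = Q - i a. Primeness follows from the totality of the Cauchy kernels, that is, from the
   uniqueness of the measure in the Cauchy transform. *)

theory Submission
  imports Defs "HOL-Real_Asymp.Real_Asymp"
begin

section \<open>Inner product spaces with explicit carrier\<close>

text \<open>The locale \<open>boundary_triple\<close> cuts the proof in two: above it there are only
  operators and boundary values, and measures occur only in the model that satisfies its axioms.
  Besides density, the infinite total mass gives that c(f) is well defined, since no nonzero
  constant is square integrable. The state space operator has this form because c + i phi vanishes
  on the main operator, while passing to the adjoint turns i phi into -i phi. So the real part keeps
  c, and the imaginary part is phi(f) phi, of rank one. The three cases describe one number. Put N =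
  (1 + a)^2 + Q^2 and let w be the free phase of the second deficiency vector. The boundary
  condition of the main operator says kappa w = (1 - a + i Q) / (1 + a + i Q). Taking moduli gives
  kappa = s / N with s = sqrt (b^2 + 4 Q^2), because ((1 - a)^2 + Q^2) N = b^2 + 4 Q^2. As Q
  \<noteq> 0, kappa is positive, so w is determined, and c = 0 on the quasi-kernel gives U = - cnj
  w. The cases only write s / N in different forms.\<close>

lemma ring_of_type_algebra_simps [simp]:
  "carrier (ring_of_type_algebra :: complex ring) = UNIV"
  "x \<oplus>\<^bsub>ring_of_type_algebra :: complex ring\<^esub> y = x + y"
  "x \<otimes>\<^bsub>ring_of_type_algebra :: complex ring\<^esub> y = x * y"
  "\<one>\<^bsub>ring_of_type_algebra :: complex ring\<^esub> = 1"
  "\<zero>\<^bsub>ring_of_type_algebra :: complex ring\<^esub> = 0"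
  by (auto simp: ring_of_type_algebra_def)

lemma ring_of_type_algebra_minus [simp]:
  "\<ominus>\<^bsub>ring_of_type_algebra :: complex ring\<^esub> x = - x"
proof -
  interpret cring "ring_of_type_algebra :: complex ring"
    by (rule cring_from_type_algebra)
  show ?thesis
    using minus_equality[of "- x" x] by simp
qed

text \<open>Completeness is left out, so that the norm, its inequalities and the metric are at hand
  while the completeness of \<open>l2_space\<close> is being proved.\<close>

locale prehilbert_space = Module.module "ring_of_type_algebra :: complex ring" H
  for H :: "('a, 'm) inner_module_scheme" (structure) +
  assumes ip_add: "\<lbrakk>x \<in> carrier H; y \<in> carrier H; z \<in> carrier H\<rbrakk>
      \<Longrightarrow> ip H (x \<oplus> y) z = ip H x z + ip H y z"
    and ip_smult: "\<lbrakk>x \<in> carrier H; y \<in> carrier H\<rbrakk> \<Longrightarrow> ip H (c \<odot> x) y = c * ip H x y"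
    and ip_cnj: "\<lbrakk>x \<in> carrier H; y \<in> carrier H\<rbrakk> \<Longrightarrow> ip H y x = cnj (ip H x y)"
    and ip_pos: "\<lbrakk>x \<in> carrier H; x \<noteq> \<zero>\<rbrakk> \<Longrightarrow> 0 < Re (ip H x x)"
begin

lemma scal_closed [simp, intro]: "x \<in> carrier H \<Longrightarrow> c \<odot> x \<in> carrier H"
  using smult_closed by simp

lemma scal_add_right:
  "\<lbrakk>x \<in> carrier H; y \<in> carrier H\<rbrakk> \<Longrightarrow> c \<odot> (x \<oplus> y) = c \<odot> x \<oplus> c \<odot> y"
  using smult_r_distr[of c x y] by simp

lemma scal_scal [simp]: "x \<in> carrier H \<Longrightarrow> c \<odot> (d \<odot> x) = (c * d) \<odot> x"
  using smult_assoc1[of c d x] by simp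

lemma scal_one [simp]: "x \<in> carrier H \<Longrightarrow> 1 \<odot> x = x"
  using smult_one by simp

lemma scal_zero_left [simp]: "x \<in> carrier H \<Longrightarrow> 0 \<odot> x = \<zero>"
  using smult_l_null[of x] by simp

lemma scal_zero_right [simp]: "c \<odot> \<zero> = \<zero>"
  using smult_r_null[of c] by simp

lemma minus_eq_scal: "x \<in> carrier H \<Longrightarrow> \<ominus> x = (-1) \<odot> x"
  using smult_l_minus[of 1 x] by simp

lemma diff_eq_scal: "\<lbrakk>x \<in> carrier H; y \<in> carrier H\<rbrakk> \<Longrightarrow> x \<ominus> y = x \<oplus> (-1) \<odot> y"
  by (simp add: a_minus_def minus_eq_scal)

lemma ip_add_right: "\<lbrakk>x \<in> carrier H; y \<in> carrier H; z \<in> carrier H\<rbrakk>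
    \<Longrightarrow> ip H x (y \<oplus> z) = ip H x y + ip H x z"
  using ip_cnj[of x "y \<oplus> z"] ip_cnj[of x y] ip_cnj[of x z] ip_add[of y z x]
    ip_cnj[of "y \<oplus> z" x]
  by simp

lemma ip_smult_right: "\<lbrakk>x \<in> carrier H; y \<in> carrier H\<rbrakk> \<Longrightarrow> ip H x (c \<odot> y) = cnj c * ip H x y"
  using ip_cnj[of "c \<odot> y" x] ip_smult[of y x c] ip_cnj[of y x] by simp

lemma ip_zero [simp]: "x \<in> carrier H \<Longrightarrow> ip H \<zero> x = 0" "x \<in> carrier H \<Longrightarrow> ip H x \<zero> = 0"
  using ip_smult[of x x 0] ip_smult_right[of x x 0] by simp_all

lemma ip_diff: "\<lbrakk>x \<in> carrier H; y \<in> carrier H; z \<in> carrier H\<rbrakk>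
    \<Longrightarrow> ip H (x \<ominus> y) z = ip H x z - ip H y z"
  by (simp add: diff_eq_scal ip_add ip_smult)

lemma ip_diff_right: "\<lbrakk>x \<in> carrier H; y \<in> carrier H; z \<in> carrier H\<rbrakk>
    \<Longrightarrow> ip H x (y \<ominus> z) = ip H x y - ip H x z"
  by (simp add: diff_eq_scal ip_add_right ip_smult_right)

lemmas ip_simps = ip_add ip_add_right ip_smult ip_smult_right ip_diff ip_diff_right

lemma ip_ge_0: "x \<in> carrier H \<Longrightarrow> 0 \<le> Re (ip H x x)"
  by (cases "x = \<zero>") (auto dest: ip_pos)

lemma hnorm_ge_0 [simp]: "x \<in> carrier H \<Longrightarrow> 0 \<le> hnorm H x"
  by (simp add: hnorm_def ip_ge_0)

lemma hnorm_sq: "x \<in> carrier H \<Longrightarrow> (hnorm H x)\<^sup>2 = Re (ip H x x)"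
  by (simp add: hnorm_def ip_ge_0)

lemma ip_self: "x \<in> carrier H \<Longrightarrow> ip H x x = of_real ((hnorm H x)\<^sup>2)"
  using ip_cnj[of x x] by (simp add: complex_eq_iff hnorm_sq)

lemma ip_self_eq_0: "x \<in> carrier H \<Longrightarrow> ip H x x = 0 \<longleftrightarrow> x = \<zero>"
  using ip_pos[of x] by (cases "x = \<zero>") auto

lemma hnorm_eq_0: "x \<in> carrier H \<Longrightarrow> hnorm H x = 0 \<longleftrightarrow> x = \<zero>"
  using ip_self_eq_0[of x] ip_self[of x] by auto

lemma hnorm_zero [simp]: "hnorm H \<zero> = 0"
  by (simp add: hnorm_eq_0)

lemma hnorm_smult: "x \<in> carrier H \<Longrightarrow> hnorm H (c \<odot> x) = cmod c * hnorm H x"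
proof -
  assume x: "x \<in> carrier H"
  have "ip H (c \<odot> x) (c \<odot> x) = of_real ((cmod c)\<^sup>2 * (hnorm H x)\<^sup>2)"
    using x by (simp add: ip_smult ip_smult_right ip_self[of x] complex_norm_square mult_ac
        del: of_real_power)
  thus ?thesis
    using x by (simp add: hnorm_def[of H "c \<odot> x"] real_sqrt_mult)
qed

lemma cauchy_schwarz:
  assumes x: "x \<in> carrier H" and y: "y \<in> carrier H"
  shows "cmod (ip H x y) \<le> hnorm H x * hnorm H y"
proof (cases "y = \<zero>")
  case True
  thus ?thesis using x by simp
next
  case False
  define n where "n = (hnorm H y)\<^sup>2"
  have n: "n > 0" using False y by (simp add: n_def hnorm_sq ip_pos)
  define c where "c = ip H x y"
  \<comment> \<open>The component of \<open>x\<close> orthogonal to \<open>y\<close>; the inequality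
    says that its square norm is nonnegative.\<close>
  define u where "u = x \<ominus> (c / of_real n) \<odot> y"
  have "ip H u u = of_real ((hnorm H x)\<^sup>2) - c * cnj c / of_real n"
  proof -
    have yy: "ip H y y = of_real n" and yx: "ip H y x = cnj c" and xy: "ip H x y = c"
      using ip_self[OF y] ip_cnj[OF x y] by (simp_all add: n_def c_def)
    have "ip H u u = ip H x x - cnj (c / of_real n) * ip H x y
        - c / of_real n * (ip H y x - cnj (c / of_real n) * ip H y y)"
      using x y by (simp only: u_def ip_diff ip_diff_right ip_smult ip_smult_right
          scal_closed minus_closed algebra_simps)
    thus ?thesis
      unfolding yy yx xy ip_self[OF x] using n by (simp add: field_simps)
  qed
  also have "\<dots> = of_real ((hnorm H x)\<^sup>2 - (cmod c)\<^sup>2 / n)"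
    by (simp add: complex_norm_square del: of_real_power)
  finally have "0 \<le> (hnorm H x)\<^sup>2 - (cmod c)\<^sup>2 / n"
    using ip_ge_0[of u] x y by (simp add: u_def)
  hence "(cmod c)\<^sup>2 \<le> (hnorm H x * hnorm H y)\<^sup>2"
    using n by (simp add: field_simps n_def)
  thus ?thesis
    using x y by (simp add: c_def)
qed

lemma hnorm_triangle:
  assumes x: "x \<in> carrier H" and y: "y \<in> carrier H"
  shows "hnorm H (x \<oplus> y) \<le> hnorm H x + hnorm H y"
proof -
  have "(hnorm H (x \<oplus> y))\<^sup>2 = (hnorm H x)\<^sup>2 + 2 * Re (ip H x y) + (hnorm H y)\<^sup>2"
    using x y ip_cnj[OF x y] by (simp add: hnorm_sq ip_simps)
  also have "Re (ip H x y) \<le> hnorm H x * hnorm H y"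
    using cauchy_schwarz[OF x y] complex_Re_le_cmod[of "ip H x y"] by linarith
  finally have "(hnorm H (x \<oplus> y))\<^sup>2 \<le> (hnorm H x + hnorm H y)\<^sup>2"
    by (simp add: power2_eq_square algebra_simps)
  thus ?thesis using x y by (simp add: power2_le_iff_abs_le)
qed

lemma diff_eq_zero_iff: "\<lbrakk>x \<in> carrier H; y \<in> carrier H\<rbrakk> \<Longrightarrow> x \<ominus> y = \<zero> \<longleftrightarrow> x = y"
  by (metis a_minus_def add.inv_closed add.inv_solve_right l_zero r_neg zero_closed)

text \<open>Reduces an identity between vectors to one between complex numbers, where ring
  arithmetic is automatic. Below it replaces manipulations with the module laws.\<close>

lemma eq_by_ip:
  assumes x: "x \<in> carrier H" and y: "y \<in> carrier H"
    and eq: "\<And>u. u \<in> carrier H \<Longrightarrow> ip H x u = ip H y u"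
  shows "x = y"
proof -
  have "ip H (x \<ominus> y) (x \<ominus> y) = 0"
    using x y eq by (simp add: ip_diff)
  hence "x \<ominus> y = \<zero>" using x y ip_self_eq_0[of "x \<ominus> y"] by simp
  thus ?thesis using x y by (simp add: diff_eq_zero_iff)
qed

section \<open>Metric, continuity of the inner product, density\<close>

sublocale Metric_space "carrier H" "hdist H"
proof
  fix x y
  show "0 \<le> hdist H x y"
    by (simp add: hdist_def)
  have "hnorm H (x \<ominus> y) = hnorm H (y \<ominus> x)" if x: "x \<in> carrier H" and y: "y \<in> carrier H"
  proof -
    have "y \<ominus> x = (-1) \<odot> (x \<ominus> y)"
      by (rule eq_by_ip) (use x y in \<open>auto simp: ip_simps\<close>)
    thus ?thesis using x y by (simp add: hnorm_smult)
  qed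
  thus "hdist H x y = hdist H y x"
    by (simp add: hdist_def)
next
  fix x y
  assume "x \<in> carrier H" "y \<in> carrier H"
  thus "hdist H x y = 0 \<longleftrightarrow> x = y"
    by (simp add: hdist_def hnorm_eq_0 diff_eq_zero_iff)
next
  fix x y z
  assume xyz: "x \<in> carrier H" "y \<in> carrier H" "z \<in> carrier H"
  have "x \<ominus> z = (x \<ominus> y) \<oplus> (y \<ominus> z)"
    by (rule eq_by_ip) (use xyz in \<open>auto simp: ip_simps\<close>)
  thus "hdist H x z \<le> hdist H x y + hdist H y z"
    using hnorm_triangle[of "x \<ominus> y" "y \<ominus> z"] xyz by (simp add: hdist_def)
qed

lemma htopology_eq: "htopology H = mtopology"
  by (simp add: htopology_def)

lemma topspace_htopology [simp]: "topspace (htopology H) = carrier H"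
  by (simp add: htopology_eq)

lemma continuous_map_ip_left:
  assumes y: "y \<in> carrier H"
  shows "continuous_map (htopology H) euclidean (\<lambda>x. ip H x y)"
proof -
  have "\<exists>\<delta>>0. \<forall>x. x \<in> carrier H \<and> hdist H a x < \<delta> \<longrightarrow> dist (ip H a y) (ip H x y) < \<epsilon>"
    if a: "a \<in> carrier H" and \<epsilon>: "\<epsilon> > 0" for a \<epsilon>
  proof (intro exI conjI allI impI)
    show "0 < \<epsilon> / (hnorm H y + 1)"
      using y \<epsilon> by (simp add: add_nonneg_pos)
    fix x
    assume x: "x \<in> carrier H \<and> hdist H a x < \<epsilon> / (hnorm H y + 1)"
    have "dist (ip H a y) (ip H x y) = cmod (ip H (a \<ominus> x) y)"
      using a x y by (simp add: dist_norm ip_diff)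
    also have "\<dots> \<le> hdist H a x * hnorm H y"
      using a x y cauchy_schwarz[of "a \<ominus> x" y] by (simp add: hdist_def)
    also have "\<dots> \<le> hdist H a x * (hnorm H y + 1)"
      by (simp add: mult_left_mono)
    also have "\<dots> < \<epsilon>"
      using x y by (simp add: pos_less_divide_eq add_nonneg_pos)
    finally show "dist (ip H a y) (ip H x y) < \<epsilon>" .
  qed
  thus ?thesis
    using metric_continuous_map[OF Met_TC.Metric_space_axioms, of "\<lambda>x. ip H x y"]
    by (simp add: htopology_eq)
qed

lemma continuous_map_ip_right:
  assumes y: "y \<in> carrier H"
  shows "continuous_map (htopology H) euclidean (\<lambda>x. ip H y x)"
proof (rule continuous_map_eq)
  show "continuous_map (htopology H) euclidean (cnj \<circ> (\<lambda>x. ip H x y))"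
    by (rule continuous_map_compose[OF continuous_map_ip_left[OF y]])
      (simp add: continuous_on_cnj)
  show "(cnj \<circ> (\<lambda>x. ip H x y)) x = ip H y x" if "x \<in> topspace (htopology H)" for x
    using that y ip_cnj[of x y] by simp
qed

lemma closed_hadjoint:
  assumes A: "A \<subseteq> carrier H \<times> carrier H"
  shows "closed_operator H (hadjoint H A)"
proof -
  let ?X = "prod_topology (htopology H) (htopology H)"
  have cl: "closedin ?X {z \<in> topspace ?X. ip H f' (fst z) - ip H f (snd z) \<in> {0}}"
    if "(f, f') \<in> A" for f f'
  proof (rule closedin_continuous_map_preimage)
    have f: "f \<in> carrier H" "f' \<in> carrier H" using that A by auto
    have "continuous_map ?X euclidean ((\<lambda>x. ip H f' x) \<circ> fst)"
      "continuous_map ?X euclidean ((\<lambda>x. ip H f x) \<circ> snd)"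
      by (rule continuous_map_compose[OF continuous_map_fst continuous_map_ip_right[OF f(2)]]
          continuous_map_compose[OF continuous_map_snd continuous_map_ip_right[OF f(1)]])+
    thus "continuous_map ?X euclidean (\<lambda>z. ip H f' (fst z) - ip H f (snd z))"
      by (auto intro: continuous_map_diff simp: o_def)
  qed simp
  \<comment> \<open>The index \<open>None\<close> contributes the whole product space, so that the
    family of closed sets is nonempty even if \<open>A\<close> is empty.\<close>
  have "hadjoint H A = (\<Inter>p\<in>insert None (Some ` A). case p of None \<Rightarrow> topspace ?X
      | Some (f, f') \<Rightarrow> {z \<in> topspace ?X. ip H f' (fst z) - ip H f (snd z) \<in> {0}})"
    by (auto simp: hadjoint_def)
  moreover have "closedin ?X \<dots>"
    by (rule closedin_INT) (use cl closedin_topspace[of ?X] in \<open>auto split: option.splits\<close>)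
  ultimately show ?thesis
    by (simp add: closed_operator_def)
qed

definition dense_in :: "'a set \<Rightarrow> bool" where
  "dense_in D \<longleftrightarrow> D \<subseteq> carrier H \<and> (\<forall>x\<in>carrier H. \<forall>\<epsilon>>0. \<exists>f\<in>D. hnorm H (x \<ominus> f) < \<epsilon>)"

lemma dense_in_mono: "\<lbrakk>dense_in D; D \<subseteq> E; E \<subseteq> carrier H\<rbrakk> \<Longrightarrow> dense_in E"
  unfolding dense_in_def by (meson subsetD)

lemma densely_definedI:
  assumes "dense_in (Domain A)"
  shows "densely_defined H A"
  using assms unfolding densely_defined_def dense_in_def htopology_eq metric_closure_of
  by (auto simp: hdist_def subset_iff)

text \<open>For \<open>f\<close> in \<open>D\<close> close to \<open>x\<close>, the square of the
  norm of \<open>x\<close> equals the inner product of \<open>x\<close> with \<open>x - f\<close>,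
  which is too small unless \<open>x\<close> is zero.\<close>

lemma orthogonal_dense:
  assumes D: "dense_in D" and x: "x \<in> carrier H" and orth: "\<And>f. f \<in> D \<Longrightarrow> ip H x f = 0"
  shows "x = \<zero>"
proof (rule ccontr)
  assume "x \<noteq> \<zero>"
  hence n: "0 < hnorm H x" using x hnorm_eq_0[of x] hnorm_ge_0[of x] by linarith
  obtain f where f: "f \<in> D" "hnorm H (x \<ominus> f) < hnorm H x"
    using D x n unfolding dense_in_def by blast
  have fc: "f \<in> carrier H" using D f by (auto simp: dense_in_def)
  have "(hnorm H x)\<^sup>2 = cmod (ip H x (x \<ominus> f))"
    using x fc orth[OF f(1)] by (simp add: ip_diff_right ip_self norm_power)
  also have "\<dots> \<le> hnorm H x * hnorm H (x \<ominus> f)"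
    using x fc by (intro cauchy_schwarz) auto
  also have "\<dots> < hnorm H x * hnorm H x"
    using f n by simp
  finally show False by (simp add: power2_eq_square)
qed

end

sublocale chilbert_space \<subseteq> prehilbert_space
  by unfold_locales (fact ip_add ip_smult ip_cnj ip_pos)+

section \<open>L-systems from boundary triples\<close>

text \<open>Here \<open>\<gamma>\<close> and \<open>\<phi>\<close> are boundary maps, continuous in
  the graph norm, and \<open>V\<close> is their Weyl function: the value of \<open>\<phi>\<close> at
  the deficiency vector normalized by \<open>\<gamma> = 1\<close>. \<open>S\<close> is not assumed
  to be an adjoint, nor the pair of boundary maps to be onto; both are derived, in
  \<open>hadjoint_A\<close> and \<open>obtain_boundary\<close>.\<close>

locale boundary_triple = chilbert_space H
  for H :: "'a inner_module" (structure) +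
  fixes S :: "('a \<times> 'a) set" and \<gamma> \<phi> :: "'a \<Rightarrow> complex"
    and e :: "complex \<Rightarrow> 'a" and V :: "complex \<Rightarrow> complex"
  assumes linear_S: "linear_operator H S"
    and \<gamma>_add: "\<lbrakk>f \<in> Domain S; g \<in> Domain S\<rbrakk> \<Longrightarrow> \<gamma> (f \<oplus> g) = \<gamma> f + \<gamma> g"
    and \<gamma>_smult: "f \<in> Domain S \<Longrightarrow> \<gamma> (c \<odot> f) = c * \<gamma> f"
    and \<phi>_add: "\<lbrakk>f \<in> Domain S; g \<in> Domain S\<rbrakk> \<Longrightarrow> \<phi> (f \<oplus> g) = \<phi> f + \<phi> g"
    and \<phi>_smult: "f \<in> Domain S \<Longrightarrow> \<phi> (c \<odot> f) = c * \<phi> f"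
    and \<gamma>_bound: "\<exists>C. \<forall>(f, f')\<in>S. cmod (\<gamma> f) \<le> C * (hnorm H f + hnorm H f')"
    and \<phi>_bound: "\<exists>C. \<forall>(f, f')\<in>S. cmod (\<phi> f) \<le> C * (hnorm H f + hnorm H f')"
    and green: "\<lbrakk>(f, f') \<in> S; (g, g') \<in> S\<rbrakk>
      \<Longrightarrow> ip H f' g - ip H f g' = \<phi> f * cnj (\<gamma> g) - \<gamma> f * cnj (\<phi> g)"
    and e_S: "Im z \<noteq> 0 \<Longrightarrow> (e z, z \<odot> e z) \<in> S"
    and \<gamma>_e: "Im z \<noteq> 0 \<Longrightarrow> \<gamma> (e z) = 1"
    and \<phi>_e: "Im z \<noteq> 0 \<Longrightarrow> \<phi> (e z) = V z"
    and resolvent: "\<lbrakk>Im z \<noteq> 0; k \<in> carrier H\<rbrakk> \<Longrightarrow> \<exists>f. (f, k \<oplus> z \<odot> f) \<in> S \<and> \<gamma> f = 0"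
    and dense: "dense_in {f \<in> Domain S. \<gamma> f = 0 \<and> \<phi> f = 0}"
    and total: "\<lbrakk>x \<in> carrier H; \<And>z. Im z \<noteq> 0 \<Longrightarrow> ip H x (e z) = 0\<rbrakk> \<Longrightarrow> x = \<zero>"
begin

text \<open>\<open>A\<close> will be the symmetric operator, \<open>A0\<close> the quasi-kernel,
  \<open>T\<close> the main operator and \<open>T'\<close> the adjoint of \<open>T\<close>.\<close>

definition A :: "('a \<times> 'a) set" where "A = {(f, f') \<in> S. \<gamma> f = 0 \<and> \<phi> f = 0}"
definition A0 :: "('a \<times> 'a) set" where "A0 = {(f, f') \<in> S. \<gamma> f = 0}"
definition T :: "('a \<times> 'a) set" where "T = {(f, f') \<in> S. \<gamma> f + \<i> * \<phi> f = 0}"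
definition T' :: "('a \<times> 'a) set" where "T' = {(f, f') \<in> S. \<gamma> f - \<i> * \<phi> f = 0}"

section \<open>Boundary conditions, adjoints and deficiency vectors\<close>

lemma S_closed: "(f, f') \<in> S \<Longrightarrow> f \<in> carrier H \<and> f' \<in> carrier H \<and> f \<in> Domain S"
  using linear_S by (auto simp: linear_operator_def)

lemma S_add: "\<lbrakk>(f, f') \<in> S; (g, g') \<in> S\<rbrakk> \<Longrightarrow> (f \<oplus> g, f' \<oplus> g') \<in> S"
  using linear_S unfolding linear_operator_def by fast

lemma S_smult: "(f, f') \<in> S \<Longrightarrow> (c \<odot> f, c \<odot> f') \<in> S"
  using linear_S unfolding linear_operator_def by fast

lemma S_zero: "(\<zero>, \<zero>) \<in> S"
  using linear_S unfolding linear_operator_def by fast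

lemma S_unique: "\<lbrakk>(f, f') \<in> S; (f, f'') \<in> S\<rbrakk> \<Longrightarrow> f' = f''"
  using linear_S unfolding linear_operator_def single_valued_def by fast

lemma \<gamma>_zero: "\<gamma> \<zero> = 0"
  using \<gamma>_smult[of \<zero> 0] S_zero by auto

lemma \<phi>_zero: "\<phi> \<zero> = 0"
  using \<phi>_smult[of \<zero> 0] S_zero by auto

lemma e_closed [simp]: "Im z \<noteq> 0 \<Longrightarrow> e z \<in> carrier H"
  using e_S S_closed by blast

lemma e_nonzero: "Im z \<noteq> 0 \<Longrightarrow> e z \<noteq> \<zero>"
  using \<gamma>_e[of z] \<gamma>_zero by auto

lemma boundary_restriction_linear:
  assumes "Y = {(f, f') \<in> S. \<alpha> * \<gamma> f + \<beta> * \<phi> f = 0}"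
  shows "linear_operator H Y"
proof -
  have "\<alpha> * \<gamma> (f \<oplus> g) + \<beta> * \<phi> (f \<oplus> g) = 0"
    if "(f, f') \<in> S" "(g, g') \<in> S" "\<alpha> * \<gamma> f + \<beta> * \<phi> f = 0" "\<alpha> * \<gamma> g + \<beta> * \<phi> g = 0" for f f' g g'
  proof -
    have "\<alpha> * \<gamma> (f \<oplus> g) + \<beta> * \<phi> (f \<oplus> g) = (\<alpha> * \<gamma> f + \<beta> * \<phi> f) + (\<alpha> * \<gamma> g + \<beta> * \<phi> g)"
      using \<gamma>_add[OF DomainI DomainI, OF that(1,2)] \<phi>_add[OF DomainI DomainI, OF that(1,2)]
      by (simp add: algebra_simps)
    thus ?thesis using that by simp
  qed
  moreover have "\<alpha> * \<gamma> (c \<odot> f) + \<beta> * \<phi> (c \<odot> f) = 0"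
    if "(f, f') \<in> S" "\<alpha> * \<gamma> f + \<beta> * \<phi> f = 0" for f f' c
  proof -
    have "\<alpha> * \<gamma> (c \<odot> f) + \<beta> * \<phi> (c \<odot> f) = c * (\<alpha> * \<gamma> f + \<beta> * \<phi> f)"
      using \<gamma>_smult[OF DomainI, OF that(1), of c] \<phi>_smult[OF DomainI, OF that(1), of c]
      by (simp add: algebra_simps)
    thus ?thesis using that by simp
  qed
  ultimately show ?thesis
    unfolding assms linear_operator_def single_valued_def
    by (auto simp: S_add S_smult S_zero \<gamma>_zero \<phi>_zero dest: S_closed S_unique)
qed

lemma linear_A0: "linear_operator H A0"
  by (rule boundary_restriction_linear[where \<alpha> = 1 and \<beta> = 0]) (simp add: A0_def)

lemma linear_T: "linear_operator H T"
  by (rule boundary_restriction_linear[where \<alpha> = 1 and \<beta> = \<i>]) (simp add: T_def)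

lemma linear_A: "linear_operator H A"
proof -
  have "linear_operator H {(f, f') \<in> S. 0 * \<gamma> f + 1 * \<phi> f = 0}"
    by (rule boundary_restriction_linear) (rule refl)
  moreover have "A = A0 \<inter> {(f, f') \<in> S. 0 * \<gamma> f + 1 * \<phi> f = 0}"
    by (auto simp: A_def A0_def)
  ultimately show ?thesis
    using linear_A0 unfolding linear_operator_def single_valued_def
    by (simp add: Ball_def split_paired_all) blast
qed

lemma A_subset: "A \<subseteq> A0" "A \<subseteq> T" "A0 \<subseteq> S" "T \<subseteq> S" "A \<subseteq> S"
  by (auto simp: A_def A0_def T_def)

lemma dense_A: "dense_in (Domain A)"
proof -
  have "Domain A = {f \<in> Domain S. \<gamma> f = 0 \<and> \<phi> f = 0}" by (auto simp: A_def)
  thus ?thesis using dense by simp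
qed

text \<open>With \<open>\<gamma> = 0\<close> on both sides Green's identity makes \<open>A0\<close>
  symmetric, so it has no nonreal eigenvalue.\<close>

lemma A0_eigen: "\<lbrakk>(f, z \<odot> f) \<in> A0; Im z \<noteq> 0\<rbrakk> \<Longrightarrow> f = \<zero>"
proof -
  assume f: "(f, z \<odot> f) \<in> A0" and z: "Im z \<noteq> 0"
  have fc: "f \<in> carrier H" using f S_closed by (auto simp: A0_def)
  have "(z - cnj z) * ip H f f = 0"
    using f fc green[of f "z \<odot> f" f "z \<odot> f"] by (auto simp: A0_def ip_simps algebra_simps)
  moreover have "z - cnj z \<noteq> 0" using z by (simp add: complex_eq_iff)
  ultimately show "f = \<zero>" using fc by (simp add: ip_self_eq_0)
qed

text \<open>One inclusion is Green's identity. For the other, an element of the adjoint is split as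
  in von Neumann's formula: \<open>h\<close> in the domain of \<open>A0\<close> absorbs
  \<open>g' - \<i> g\<close> through the resolvent equation, and what is left is a multiple of the
  deficiency vector \<open>E\<close>.\<close>

lemma hadjoint_A: "hadjoint H A = S"
proof (intro equalityI subrelI)
  fix g g' assume "(g, g') \<in> S"
  thus "(g, g') \<in> hadjoint H A"
    using green[of _ _ g g'] S_closed[of g g'] by (fastforce simp: hadjoint_def A_def)
next
  fix g g' assume g: "(g, g') \<in> hadjoint H A"
  have gc: "g \<in> carrier H" "g' \<in> carrier H" using g by (auto simp: hadjoint_def)
  define E where "E = e \<i>"
  have E: "(E, \<i> \<odot> E) \<in> S" "\<gamma> E = 1" "E \<in> carrier H" "E \<noteq> \<zero>"
    using e_S[of \<i>] \<gamma>_e[of \<i>] e_nonzero[of \<i>] by (auto simp: E_def)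
  obtain h where h: "(h, (g' \<ominus> \<i> \<odot> g) \<oplus> \<i> \<odot> h) \<in> S" "\<gamma> h = 0"
    using resolvent[of \<i> "g' \<ominus> \<i> \<odot> g"] gc by auto
  define h' where "h' = (g' \<ominus> \<i> \<odot> g) \<oplus> \<i> \<odot> h"
  have hc: "h \<in> carrier H" "h' \<in> carrier H" using S_closed[OF h(1)] by (auto simp: h'_def)
  define u where "u = g \<ominus> h"
  have uc: "u \<in> carrier H" using gc hc by (simp add: u_def)
  \<comment> \<open>\<open>u\<close> is orthogonal to the range of \<open>A + i\<close>, which is the orthogonal complement of \<open>E\<close>.\<close>
  have perp: "ip H k u = 0" if k: "k \<in> carrier H" "ip H k E = 0" for k
  proof -
    obtain f where f: "(f, k \<oplus> (-\<i>) \<odot> f) \<in> S" "\<gamma> f = 0"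
      using resolvent[of "-\<i>" k] k by auto
    have fc: "f \<in> carrier H" using S_closed f by blast
    \<comment> \<open>Green's identity for \<open>f\<close> and \<open>E\<close> gives that
      \<open>\<phi> f\<close> is the inner product of \<open>k\<close> and \<open>E\<close>: the
      terms with \<open>\<i>\<close> cancel because \<open>f\<close> solves the equation at
      \<open>-\<i>\<close>.\<close>
    have "\<phi> f = 0"
      using green[OF f(1) E(1)] E f fc k by (simp add: ip_simps)
    hence "(f, k \<oplus> (-\<i>) \<odot> f) \<in> A" using f by (simp add: A_def)
    hence "ip H (k \<oplus> (-\<i>) \<odot> f) g = ip H f g'"
      using g by (auto simp: hadjoint_def)
    moreover have "ip H (k \<oplus> (-\<i>) \<odot> f) h = ip H f h'"
      using green[OF f(1) h(1)] f \<open>\<phi> f = 0\<close> by (simp add: h'_def)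
    ultimately show ?thesis
      using k fc gc hc by (simp add: u_def h'_def ip_simps algebra_simps)
  qed
  define \<alpha> where "\<alpha> = ip H u E / ip H E E"
  have "ip H (u \<ominus> \<alpha> \<odot> E) E = 0"
    using E uc ip_self_eq_0[of E] by (simp add: \<alpha>_def ip_simps)
  hence "ip H (u \<ominus> \<alpha> \<odot> E) (u \<ominus> \<alpha> \<odot> E) = 0"
    using perp[of "u \<ominus> \<alpha> \<odot> E"] E uc by (simp add: ip_diff_right[of "u \<ominus> \<alpha> \<odot> E"] ip_smult_right)
  hence ueq: "u = \<alpha> \<odot> E"
    using E uc by (simp add: ip_self_eq_0 diff_eq_zero_iff)
  have "g = h \<oplus> u"
    by (rule eq_by_ip) (use gc hc in \<open>auto simp: u_def ip_simps\<close>)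
  moreover have "g' = h' \<oplus> \<i> \<odot> u"
    by (rule eq_by_ip) (use gc hc in \<open>auto simp: u_def h'_def ip_simps algebra_simps\<close>)
  moreover have "(h \<oplus> u, h' \<oplus> \<i> \<odot> u) \<in> S"
    using S_add[OF h(1) S_smult[OF E(1), of \<alpha>]] E by (simp add: h'_def ueq mult.commute)
  ultimately show "(g, g') \<in> S" by simp
qed

text \<open>The adjoint of \<open>Y\<close> lies in the adjoint of \<open>A\<close>, which is
  \<open>S\<close>, and there Green's identity turns the adjoint relation into a condition on
  boundary values alone. Adjoints of extensions thus become complements of subspaces of the plane of
  boundary values.\<close>

lemma hadjoint_between:
  assumes "A \<subseteq> Y" "Y \<subseteq> S"
  shows "hadjoint H Y = {(g, g') \<in> S. \<forall>(f, f')\<in>Y. \<phi> f * cnj (\<gamma> g) = \<gamma> f * cnj (\<phi> g)}"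
proof -
  have "hadjoint H Y \<subseteq> hadjoint H A"
    using assms by (auto simp: hadjoint_def)
  hence "hadjoint H Y \<subseteq> S"
    by (simp add: hadjoint_A)
  moreover have "(g, g') \<in> hadjoint H Y \<longleftrightarrow> (\<forall>(f, f')\<in>Y. \<phi> f * cnj (\<gamma> g) = \<gamma> f * cnj (\<phi> g))"
    if g: "(g, g') \<in> S" for g g'
  proof -
    have "ip H f' g = ip H f g' \<longleftrightarrow> \<phi> f * cnj (\<gamma> g) = \<gamma> f * cnj (\<phi> g)" if "(f, f') \<in> Y" for f f'
      using green[OF _ g, of f f'] that assms by (metis eq_iff_diff_eq_0 subsetD)
    thus ?thesis using S_closed[OF g] by (auto simp: hadjoint_def)
  qed
  ultimately show ?thesis by (intro equalityI subrelI CollectI case_prodI conjI) blast+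
qed

text \<open>The boundary values of \<open>e \<i>\<close> and \<open>e (-\<i>)\<close> are (1, V(i))
  and (1, V(-i)), which are linearly independent; \<open>\<beta>\<close> solves the resulting linear
  system.\<close>

lemma boundary_surj: "\<exists>(f, f')\<in>S. \<gamma> f = c \<and> \<phi> f = d" if nz: "V \<i> \<noteq> V (-\<i>)"
proof -
  define \<beta> where "\<beta> = (d - c * V (-\<i>)) / (V \<i> - V (-\<i>))"
  define f where "f = \<beta> \<odot> e \<i> \<oplus> (c - \<beta>) \<odot> e (-\<i>)"
  have D: "e \<i> \<in> Domain S" "e (-\<i>) \<in> Domain S" "\<beta> \<odot> e \<i> \<in> Domain S" "(c - \<beta>) \<odot> e (-\<i>) \<in> Domain S"
    using e_S[of \<i>] e_S[of "-\<i>"] S_smult by auto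
  have "\<gamma> f = c"
    using D \<gamma>_e[of \<i>] \<gamma>_e[of "-\<i>"] by (simp add: f_def \<gamma>_add \<gamma>_smult)
  moreover have "\<phi> f = \<beta> * (V \<i> - V (-\<i>)) + c * V (-\<i>)"
    using D \<phi>_e[of \<i>] \<phi>_e[of "-\<i>"] by (simp add: f_def \<phi>_add \<phi>_smult algebra_simps)
  moreover have "\<beta> * (V \<i> - V (-\<i>)) = d - c * V (-\<i>)"
    using nz by (simp add: \<beta>_def)
  ultimately have "\<gamma> f = c \<and> \<phi> f = d" by simp
  moreover have "f \<in> Domain S"
    using S_add D unfolding f_def by (meson Domain.cases Domain.intros)
  ultimately show ?thesis by blast
qed

text \<open>Green's identity for \<open>e z\<close> and \<open>e w\<close> expresses their inner
  product times \<open>z - cnj w\<close> as \<open>V z - cnj (V w)\<close>. The factor vanishes for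
  \<open>z = \<i>\<close>, \<open>w = -\<i>\<close>, which gives the symmetry of \<open>V\<close>;
  the choices \<open>z = w\<close> give the norms.\<close>

lemma V_relations:
  shows V_cnj: "V (-\<i>) = cnj (V \<i>)"
    and norm_e: "(hnorm H (e \<i>))\<^sup>2 = Im (V \<i>)"
    and norm_e': "(hnorm H (e (-\<i>)))\<^sup>2 = Im (V \<i>)"
    and Im_V_pos: "0 < Im (V \<i>)"
proof -
  have *: "z * ip H (e z) (e w) - cnj w * ip H (e z) (e w) = V z - cnj (V w)"
    if "Im z \<noteq> 0" "Im w \<noteq> 0" for z w
    using green[OF e_S[OF that(1)] e_S[OF that(2)]] that
    by (simp add: ip_simps \<gamma>_e \<phi>_e)
  have 1: "V \<i> = cnj (V (-\<i>))" using *[of \<i> "-\<i>"] by simp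
  thus V: "V (-\<i>) = cnj (V \<i>)" by simp
  have "2 * \<i> * of_real ((hnorm H (e \<i>))\<^sup>2) = V \<i> - cnj (V \<i>)"
    using *[of \<i> \<i>] ip_self[of "e \<i>"] by (simp del: of_real_power add: mult.assoc)
  thus 2: "(hnorm H (e \<i>))\<^sup>2 = Im (V \<i>)"
    by (simp add: complex_eq_iff)
  have "- 2 * \<i> * of_real ((hnorm H (e (-\<i>)))\<^sup>2) = V (-\<i>) - cnj (V (-\<i>))"
    using *[of "-\<i>" "-\<i>"] ip_self[of "e (-\<i>)"] by (simp del: of_real_power add: mult.assoc)
  thus "(hnorm H (e (-\<i>)))\<^sup>2 = Im (V \<i>)"
    unfolding V by (simp add: complex_eq_iff)
  show "0 < Im (V \<i>)"
    using e_nonzero[of \<i>] hnorm_eq_0[of "e \<i>"] by (simp add: 2[symmetric])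
qed

lemma obtain_boundary:
  obtains f f' where "(f, f') \<in> S" "\<gamma> f = c" "\<phi> f = d"
proof -
  have "V \<i> \<noteq> V (-\<i>)" using Im_V_pos unfolding V_cnj by (auto simp: complex_eq_iff)
  from boundary_surj[OF this] show ?thesis using that by blast
qed

lemma hadjoint_S: "hadjoint H S = A"
proof -
  obtain f f' where f: "(f, f') \<in> S" "\<gamma> f = 1" "\<phi> f = 0" by (rule obtain_boundary)
  obtain g g' where g: "(g, g') \<in> S" "\<gamma> g = 0" "\<phi> g = 1" by (rule obtain_boundary)
  show ?thesis
    using f g unfolding hadjoint_between[OF A_subset(5) order_refl]
    by (fastforce simp: A_def)
qed

lemma hadjoint_A0: "hadjoint H A0 = A0"
proof -
  obtain g g' where g: "(g, g') \<in> S" "\<gamma> g = 0" "\<phi> g = 1" by (rule obtain_boundary)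
  show ?thesis
    using g unfolding hadjoint_between[OF A_subset(1) A_subset(3)]
    by (fastforce simp: A0_def)
qed

text \<open>The boundary values on \<open>T\<close> fill the line through (-i, 1). Its complement
  with respect to the form in \<open>hadjoint_between\<close> is the line through (i, 1), which is
  the condition of \<open>T'\<close>.\<close>

lemma hadjoint_T: "hadjoint H T = T'"
proof -
  obtain g g' where g: "(g, g') \<in> S" "\<gamma> g = -\<i>" "\<phi> g = 1" by (rule obtain_boundary)
  have gT: "(g, g') \<in> T" using g by (simp add: T_def)
  have "cnj (\<gamma> f) = -\<i> * cnj (\<phi> f) \<longleftrightarrow> \<gamma> f - \<i> * \<phi> f = 0" for f
    by (auto simp: complex_eq_iff)
  moreover have "\<gamma> h = -\<i> * \<phi> h" if "(h, h') \<in> T" for h h'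
    using that by (simp add: T_def eq_neg_iff_add_eq_0)
  ultimately show ?thesis
    using g gT unfolding hadjoint_between[OF A_subset(2) A_subset(4)]
    by (fastforce simp: T'_def)
qed

lemma symmetric_A: "symmetric_operator H A"
  using A_subset by (simp add: symmetric_operator_def hadjoint_A)

lemma closed_A: "closed_operator H A"
  unfolding hadjoint_S[symmetric] using S_closed by (intro closed_hadjoint) auto

lemma selfadjoint_A0: "selfadjoint_operator H A0"
  unfolding selfadjoint_operator_def
proof (intro conjI linear_A0 hadjoint_A0 densely_definedI)
  show "dense_in (Domain A0)"
    by (rule dense_in_mono[OF dense_A]) (use A_subset S_closed in \<open>blast+\<close>)
qed

text \<open>Subtracting \<open>\<gamma> f\<close> times \<open>e z\<close> from an eigenvector
  \<open>f\<close> leaves an eigenvector of \<open>A0\<close>, which is zero.\<close>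

lemma eigenspace_S: "Im z \<noteq> 0 \<Longrightarrow> eigenspace H S z = range (\<lambda>c. c \<odot> e z)"
proof (intro equalityI subsetI)
  fix f assume z: "Im z \<noteq> 0" and "f \<in> eigenspace H S z"
  hence f: "(f, z \<odot> f) \<in> S" by (simp add: eigenspace_def)
  note fc = S_closed[OF f]
  have D: "e z \<in> Domain S" using e_S[OF z] by blast
  define u where "u = f \<oplus> (- \<gamma> f) \<odot> e z"
  have u: "(u, z \<odot> f \<oplus> (- \<gamma> f) \<odot> (z \<odot> e z)) \<in> S"
    unfolding u_def by (rule S_add[OF f S_smult[OF e_S[OF z]]])
  moreover have "z \<odot> f \<oplus> (- \<gamma> f) \<odot> (z \<odot> e z) = z \<odot> u"
    using fc z by (simp add: u_def scal_add_right mult.commute)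
  moreover have "\<gamma> u = 0"
  proof -
    have "(- \<gamma> f) \<odot> e z \<in> Domain S" using S_smult[OF e_S[OF z]] by blast
    thus ?thesis using fc D z by (simp add: u_def \<gamma>_add \<gamma>_smult \<gamma>_e)
  qed
  ultimately have "u = \<zero>" using A0_eigen[of u z] z by (simp add: A0_def)
  have "f = u \<oplus> \<gamma> f \<odot> e z"
    by (rule eq_by_ip) (use fc z in \<open>auto simp: u_def ip_simps\<close>)
  thus "f \<in> range (\<lambda>c. c \<odot> e z)" using z \<open>u = \<zero>\<close> by auto
next
  fix f assume z: "Im z \<noteq> 0" and "f \<in> range (\<lambda>c. c \<odot> e z)"
  then obtain c where "f = c \<odot> e z" by auto
  thus "f \<in> eigenspace H S z"
    using S_smult[OF e_S[OF z], of c] z by (simp add: eigenspace_def mult.commute)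
qed

section \<open>Deficiency indices and resolvent sets\<close>

lemma deficiency_A: "deficiency_indices_1_1 H A"
  using eigenspace_S[of \<i>] eigenspace_S[of "-\<i>"] e_nonzero[of \<i>] e_nonzero[of "-\<i>"]
  unfolding deficiency_indices_1_1_def hadjoint_A one_dimensional_def
  by (metis e_closed imaginary_unit.simps(2) uminus_complex.sel(2) zero_neq_neg_one zero_neq_one)

text \<open>The usual estimate for symmetric operators: pair the resolvent equation with
  \<open>f\<close> and compare imaginary parts.\<close>

lemma A0_resolvent:
  assumes z: "Im z \<noteq> 0" and f: "(f, k \<oplus> z \<odot> f) \<in> A0" and k: "k \<in> carrier H"
  shows "hnorm H f \<le> hnorm H k / \<bar>Im z\<bar>"
proof -
  have fS: "(f, k \<oplus> z \<odot> f) \<in> S" "\<gamma> f = 0" using f by (auto simp: A0_def)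
  note fc = S_closed[OF fS(1)]
  have "(z - cnj z) * ip H f f = ip H f k - ip H k f"
    using green[OF fS(1) fS(1)] fS(2) fc k by (simp add: ip_simps algebra_simps)
  hence "cmod (z - cnj z) * (hnorm H f)\<^sup>2 = cmod (ip H f k - ip H k f)"
    using fc by (metis ip_self norm_mult norm_of_real abs_power2)
  also have "\<dots> \<le> hnorm H f * hnorm H k + hnorm H k * hnorm H f"
    using cauchy_schwarz[of f k] cauchy_schwarz[of k f] fc k norm_triangle_ineq4[of "ip H f k" "ip H k f"]
    by linarith
  also have "cmod (z - cnj z) = 2 * \<bar>Im z\<bar>"
    by (simp add: complex_diff_cnj norm_mult)
  finally have "(\<bar>Im z\<bar> * hnorm H f) * hnorm H f \<le> hnorm H k * hnorm H f"
    by (simp add: power2_eq_square algebra_simps)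
  hence "\<bar>Im z\<bar> * hnorm H f \<le> hnorm H k"
    using fc k z by (cases "hnorm H f = 0") (auto simp: less_le dest: mult_right_le_imp_le)
  thus ?thesis using z by (simp add: field_simps)
qed

lemma resolvent_set_A0:
  assumes z: "Im z \<noteq> 0"
  shows "z \<in> resolvent_set H A0"
proof -
  have "\<exists>!f. (f, h \<oplus> z \<odot> f) \<in> A0" if h: "h \<in> carrier H" for h
  proof (rule ex_ex1I)
    show "\<exists>f. (f, h \<oplus> z \<odot> f) \<in> A0"
      using resolvent[OF z h] by (auto simp: A0_def)
    fix f g assume fg: "(f, h \<oplus> z \<odot> f) \<in> A0" "(g, h \<oplus> z \<odot> g) \<in> A0"
    have c: "f \<in> carrier H" "g \<in> carrier H" using fg A_subset S_closed by blast+
    have "(f \<oplus> (-1) \<odot> g, (h \<oplus> z \<odot> f) \<oplus> (-1) \<odot> (h \<oplus> z \<odot> g)) \<in> A0"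
      using fg linear_A0 unfolding linear_operator_def by fast
    moreover have "(h \<oplus> z \<odot> f) \<oplus> (-1) \<odot> (h \<oplus> z \<odot> g) = z \<odot> (f \<oplus> (-1) \<odot> g)"
      by (rule eq_by_ip) (use c h in \<open>auto simp: ip_simps algebra_simps\<close>)
    ultimately have "f \<oplus> (-1) \<odot> g = \<zero>" using A0_eigen z by simp
    thus "f = g" using c by (simp add: diff_eq_scal[symmetric] diff_eq_zero_iff)
  qed
  moreover have "hnorm H f \<le> 1 / \<bar>Im z\<bar> * hnorm H (g \<ominus> z \<odot> f)" if fg: "(f, g) \<in> A0" for f g
  proof -
    have c: "f \<in> carrier H" "g \<in> carrier H" using fg A_subset S_closed by blast+
    have "g = (g \<ominus> z \<odot> f) \<oplus> z \<odot> f"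
      by (rule eq_by_ip) (use c in \<open>auto simp: ip_simps\<close>)
    thus ?thesis using A0_resolvent[OF z, of f "g \<ominus> z \<odot> f"] fg c by simp
  qed
  ultimately show ?thesis
    unfolding resolvent_set_def by blast
qed

text \<open>The solution \<open>f0\<close> for \<open>A0\<close> is corrected by a multiple of the
  deficiency vector \<open>E\<close> until the condition of \<open>T\<close> holds. The coefficient
  has the denominator \<open>d\<close>, the value of \<open>\<gamma> + \<i> * \<phi>\<close> at
  \<open>E\<close>. At \<open>-\<i>\<close> its real part is 1 + Im V(i), hence positive; at
  \<open>\<i>\<close> the corresponding number can vanish.\<close>

lemma resolvent_set_T: "-\<i> \<in> resolvent_set H T"
proof -
  define E where "E = e (-\<i>)"
  define d where "d = 1 + \<i> * V (-\<i>)"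
  have "Re d > 1" using Im_V_pos by (simp add: d_def V_cnj)
  hence d: "d \<noteq> 0" by auto
  have E: "(E, (-\<i>) \<odot> E) \<in> S" "\<gamma> E = 1" "\<phi> E = V (-\<i>)" "E \<in> carrier H" "E \<in> Domain S"
    using e_S[of "-\<i>"] \<gamma>_e[of "-\<i>"] \<phi>_e[of "-\<i>"] by (auto simp: E_def)
  have DE: "c \<odot> E \<in> Domain S" for c using S_smult[OF E(1)] by blast
  obtain C where C: "\<forall>(f, f')\<in>S. cmod (\<phi> f) \<le> C * (hnorm H f + hnorm H f')"
    using \<phi>_bound by auto
  have ex: "\<exists>f0. (f0, h \<oplus> (-\<i>) \<odot> f0) \<in> A0 \<and>
      (f0 \<oplus> (-\<i> * \<phi> f0 / d) \<odot> E, h \<oplus> (-\<i>) \<odot> (f0 \<oplus> (-\<i> * \<phi> f0 / d) \<odot> E)) \<in> T"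
    if h: "h \<in> carrier H" for h
  proof -
    obtain f0 where f0: "(f0, h \<oplus> (-\<i>) \<odot> f0) \<in> S" "\<gamma> f0 = 0"
      using resolvent[of "-\<i>" h] h by auto
    define \<alpha> where "\<alpha> = -\<i> * \<phi> f0 / d"
    note c = S_closed[OF f0(1)]
    have "(f0 \<oplus> \<alpha> \<odot> E, (h \<oplus> (-\<i>) \<odot> f0) \<oplus> \<alpha> \<odot> ((-\<i>) \<odot> E)) \<in> S"
      by (rule S_add[OF f0(1) S_smult[OF E(1)]])
    moreover have "(h \<oplus> (-\<i>) \<odot> f0) \<oplus> \<alpha> \<odot> ((-\<i>) \<odot> E) = h \<oplus> (-\<i>) \<odot> (f0 \<oplus> \<alpha> \<odot> E)"
      by (rule eq_by_ip) (use c h E in \<open>auto simp: ip_simps algebra_simps\<close>)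
    moreover have "\<gamma> (f0 \<oplus> \<alpha> \<odot> E) + \<i> * \<phi> (f0 \<oplus> \<alpha> \<odot> E) = 0"
    proof -
      have "\<gamma> (f0 \<oplus> \<alpha> \<odot> E) + \<i> * \<phi> (f0 \<oplus> \<alpha> \<odot> E) = \<alpha> * d + \<i> * \<phi> f0"
        using c f0 E DE by (simp add: \<gamma>_add \<gamma>_smult \<phi>_add \<phi>_smult d_def algebra_simps)
      thus ?thesis using d by (simp add: \<alpha>_def)
    qed
    ultimately show ?thesis using f0 unfolding \<alpha>_def A0_def T_def by auto
  qed
  have unique: "f = \<zero>" if f: "(f, (-\<i>) \<odot> f) \<in> T" for f
  proof -
    have "f \<in> eigenspace H S (-\<i>)" using f A_subset by (auto simp: eigenspace_def)
    then obtain c where fc: "f = c \<odot> E" using eigenspace_S[of "-\<i>"] by (auto simp: E_def)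
    have "c * d = \<gamma> f + \<i> * \<phi> f"
      using E by (simp add: fc \<gamma>_smult \<phi>_smult d_def algebra_simps)
    also have "\<dots> = 0" using f by (simp add: T_def)
    finally show ?thesis using d fc E by simp
  qed
  have ex1: "f = g" if fg: "(f, h \<oplus> (-\<i>) \<odot> f) \<in> T" "(g, h \<oplus> (-\<i>) \<odot> g) \<in> T"
    and h: "h \<in> carrier H" for f g h
  proof -
    have c: "f \<in> carrier H" "g \<in> carrier H" using fg A_subset S_closed by blast+
    have "(f \<oplus> (-1) \<odot> g, (h \<oplus> (-\<i>) \<odot> f) \<oplus> (-1) \<odot> (h \<oplus> (-\<i>) \<odot> g)) \<in> T"
      using fg linear_T unfolding linear_operator_def by fast
    moreover have "(h \<oplus> (-\<i>) \<odot> f) \<oplus> (-1) \<odot> (h \<oplus> (-\<i>) \<odot> g) = (-\<i>) \<odot> (f \<oplus> (-1) \<odot> g)"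
      by (rule eq_by_ip) (use c h in \<open>auto simp: ip_simps algebra_simps\<close>)
    ultimately have "f \<oplus> (-1) \<odot> g = \<zero>" using unique by simp
    thus "f = g" using c by (simp add: diff_eq_scal[symmetric] diff_eq_zero_iff)
  qed
  \<comment> \<open>The 1 bounds \<open>f0\<close>. The 3 comes from \<open>f0\<close> and its image
    under \<open>A0\<close>, whose norms are at most one and two times the norm of
    \<open>h\<close>.\<close>
  define M where "M = 1 + 3 * \<bar>C\<bar> / cmod d * hnorm H E"
  have "hnorm H f \<le> M * hnorm H (g \<ominus> (-\<i>) \<odot> f)" if fg: "(f, g) \<in> T" for f g
  proof -
    have c: "f \<in> carrier H" "g \<in> carrier H" using fg A_subset S_closed by blast+
    define h where "h = g \<ominus> (-\<i>) \<odot> f"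
    have hc: "h \<in> carrier H" using c by (simp add: h_def)
    have gh: "g = h \<oplus> (-\<i>) \<odot> f"
      by (rule eq_by_ip) (use c in \<open>auto simp: h_def ip_simps\<close>)
    obtain f0 where f0: "(f0, h \<oplus> (-\<i>) \<odot> f0) \<in> A0"
      "(f0 \<oplus> (-\<i> * \<phi> f0 / d) \<odot> E, h \<oplus> (-\<i>) \<odot> (f0 \<oplus> (-\<i> * \<phi> f0 / d) \<odot> E)) \<in> T"
      using ex[OF hc] by blast
    have f0c: "f0 \<in> carrier H" using f0 A_subset S_closed by blast
    have feq: "f = f0 \<oplus> (-\<i> * \<phi> f0 / d) \<odot> E"
      using ex1[OF _ f0(2) hc, of f] fg gh by simp
    have n0: "hnorm H f0 \<le> hnorm H h"
      using A0_resolvent[OF _ f0(1) hc] by simp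
    have "hnorm H (h \<oplus> (-\<i>) \<odot> f0) \<le> hnorm H h + hnorm H f0"
      using hnorm_triangle[of h "(-\<i>) \<odot> f0"] f0c hc by (simp add: hnorm_smult)
    hence "hnorm H f0 + hnorm H (h \<oplus> (-\<i>) \<odot> f0) \<le> 3 * hnorm H h"
      using n0 by simp
    moreover have "cmod (\<phi> f0) \<le> C * (hnorm H f0 + hnorm H (h \<oplus> (-\<i>) \<odot> f0))"
      using C f0(1) A_subset by blast
    moreover have "C * (hnorm H f0 + hnorm H (h \<oplus> (-\<i>) \<odot> f0))
        \<le> \<bar>C\<bar> * (hnorm H f0 + hnorm H (h \<oplus> (-\<i>) \<odot> f0))"
      using f0c hc by (intro mult_right_mono) auto
    ultimately have \<phi>0: "cmod (\<phi> f0) \<le> 3 * \<bar>C\<bar> * hnorm H h"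
      using mult_left_mono[of "hnorm H f0 + hnorm H (h \<oplus> (-\<i>) \<odot> f0)" "3 * hnorm H h" "\<bar>C\<bar>"]
      by simp
    have "hnorm H f \<le> hnorm H f0 + cmod (\<phi> f0) / cmod d * hnorm H E"
      unfolding feq using hnorm_triangle[of f0 "(-\<i> * \<phi> f0 / d) \<odot> E"] f0c E
      by (simp add: hnorm_smult norm_mult norm_divide)
    also have "\<dots> \<le> hnorm H h + (3 * \<bar>C\<bar> * hnorm H h) / cmod d * hnorm H E"
      using n0 \<phi>0 E by (intro add_mono mult_right_mono divide_right_mono) auto
    also have "\<dots> = M * hnorm H h" by (simp add: M_def algebra_simps)
    finally show ?thesis by (simp add: h_def)
  qed
  moreover have "\<exists>!f. (f, h \<oplus> (-\<i>) \<odot> f) \<in> T" if "h \<in> carrier H" for h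
    using ex[OF that] ex1 that by blast
  ultimately show ?thesis unfolding resolvent_set_def by blast
qed

text \<open>The boundary lines of \<open>T\<close> and of its adjoint are distinct and meet only in
  zero. This gives both the lack of symmetry and the condition on the domains.\<close>

lemma admissible_T: "admissible_main_operator H A T"
proof -
  obtain g g' where g: "(g, g') \<in> S" "\<gamma> g = -\<i>" "\<phi> g = 1" by (rule obtain_boundary)
  have "(g, g') \<in> T" "(g, g') \<notin> T'" using g by (auto simp: T_def T'_def)
  hence "\<not> symmetric_operator H T" by (auto simp: symmetric_operator_def hadjoint_T)
  moreover have "Domain A = Domain T \<inter> Domain T'"
  proof -
    have "\<gamma> f = 0 \<and> \<phi> f = 0 \<longleftrightarrow> \<gamma> f + \<i> * \<phi> f = 0 \<and> \<gamma> f - \<i> * \<phi> f = 0" for f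
      by (auto simp: complex_eq_iff)
    thus ?thesis by (fastforce simp: A_def T_def T'_def)
  qed
  ultimately show ?thesis
    using linear_T A_subset resolvent_set_T
    by (auto simp: admissible_main_operator_def hadjoint_A hadjoint_T)
qed

section \<open>The rigged space and the state space operator\<close>

abbreviation P where "P \<equiv> plus_space H A"

lemma carrier_P [simp]: "carrier P = Domain S"
  by (simp add: plus_space_def hadjoint_A)

lemma op_apply_S: "(f, f') \<in> S \<Longrightarrow> op_apply S f = f'"
  unfolding op_apply_def by (rule the_equality) (auto dest: S_unique)

lemma S_apply: "f \<in> Domain S \<Longrightarrow> (f, op_apply S f) \<in> S"
  using op_apply_S by auto

lemma Domain_S_closed [simp]: "f \<in> Domain S \<Longrightarrow> f \<in> carrier H"
  "f \<in> Domain S \<Longrightarrow> op_apply S f \<in> carrier H"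
  using S_apply S_closed by blast+

lemma Domain_S_add [simp]: "\<lbrakk>f \<in> Domain S; g \<in> Domain S\<rbrakk> \<Longrightarrow> f \<oplus> g \<in> Domain S"
  using S_add by blast

lemma Domain_S_smult [simp]: "f \<in> Domain S \<Longrightarrow> c \<odot> f \<in> Domain S"
  using S_smult by blast

lemma op_apply_add: "\<lbrakk>f \<in> Domain S; g \<in> Domain S\<rbrakk>
    \<Longrightarrow> op_apply S (f \<oplus> g) = op_apply S f \<oplus> op_apply S g"
  by (intro op_apply_S S_add S_apply)

lemma op_apply_smult: "f \<in> Domain S \<Longrightarrow> op_apply S (c \<odot> f) = c \<odot> op_apply S f"
  by (intro op_apply_S S_smult S_apply)

lemma hnorm_P:
  assumes "f \<in> Domain S"
  shows "hnorm P f = sqrt ((hnorm H f)\<^sup>2 + (hnorm H (op_apply S f))\<^sup>2)"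
  using assms by (simp add: hnorm_def plus_space_def hadjoint_A ip_ge_0)

lemma hnorm_P_ge:
  assumes "f \<in> Domain S"
  shows "hnorm H f \<le> hnorm P f" "hnorm H (op_apply S f) \<le> hnorm P f" "0 \<le> hnorm P f"
  using assms by (auto simp: hnorm_P intro!: real_le_rsqrt)

lemma minus_norm_le:
  assumes "\<And>g. g \<in> Domain S \<Longrightarrow> cmod (F g) \<le> C * hnorm P g" and "0 \<le> C"
  shows "minus_norm H A F \<le> C"
  unfolding minus_norm_def Let_def
proof (rule cSUP_least)
  have "op_apply S \<zero> = \<zero>" by (rule op_apply_S[OF S_zero])
  hence "hnorm P \<zero> = 0" using S_zero by (subst hnorm_P) auto
  thus "{f \<in> carrier P. hnorm P f \<le> 1} \<noteq> {}"
    using S_zero by (auto intro!: exI[of _ \<zero>])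
next
  fix f assume f: "f \<in> {f \<in> carrier P. hnorm P f \<le> 1}"
  hence "cmod (F f) \<le> C * hnorm P f" using assms(1) by simp
  also have "\<dots> \<le> C" using f assms(2) by (simp add: mult_left_le)
  finally show "cmod (F f) \<le> C" .
qed

lemma boundary_bound:
  obtains C where "0 \<le> C" "\<And>f. f \<in> Domain S \<Longrightarrow> cmod (\<gamma> f) \<le> C * hnorm P f"
    "\<And>f. f \<in> Domain S \<Longrightarrow> cmod (\<phi> f) \<le> C * hnorm P f"
proof -
  obtain C1 C2 where C: "\<forall>(f, f')\<in>S. cmod (\<gamma> f) \<le> C1 * (hnorm H f + hnorm H f')"
    "\<forall>(f, f')\<in>S. cmod (\<phi> f) \<le> C2 * (hnorm H f + hnorm H f')"
    using \<gamma>_bound \<phi>_bound by auto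
  have *: "x \<le> 2 * (\<bar>C1\<bar> + \<bar>C2\<bar>) * hnorm P f"
    if f: "f \<in> Domain S" and x: "x \<le> c * (hnorm H f + hnorm H (op_apply S f))"
      and c: "c \<le> \<bar>C1\<bar> + \<bar>C2\<bar>" for f x c
  proof -
    have "x \<le> (\<bar>C1\<bar> + \<bar>C2\<bar>) * (hnorm H f + hnorm H (op_apply S f))"
      using x c f by (meson Domain_S_closed add_nonneg_nonneg hnorm_ge_0 mult_right_mono order_trans)
    also have "\<dots> \<le> (\<bar>C1\<bar> + \<bar>C2\<bar>) * (2 * hnorm P f)"
      using hnorm_P_ge[OF f] by (intro mult_left_mono) auto
    finally show ?thesis by (simp add: algebra_simps)
  qed
  show ?thesis
  proof (rule that[of "2 * (\<bar>C1\<bar> + \<bar>C2\<bar>)"])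
    fix f assume f: "f \<in> Domain S"
    show "cmod (\<gamma> f) \<le> 2 * (\<bar>C1\<bar> + \<bar>C2\<bar>) * hnorm P f"
      by (rule *[OF f, of _ C1]) (use C(1) S_apply[OF f] in auto)
    show "cmod (\<phi> f) \<le> 2 * (\<bar>C1\<bar> + \<bar>C2\<bar>) * hnorm P f"
      by (rule *[OF f, of _ C2]) (use C(2) S_apply[OF f] in auto)
  qed auto
qed

text \<open>As an element of the minus space \<open>\<phi>\<close> is the antilinear functional
  sending \<open>g\<close> to \<open>cnj (\<phi> g)\<close>, hence the conjugate. The coefficient
  \<open>\<gamma> f + \<i> * \<phi> f\<close> vanishes exactly on the domain of \<open>T\<close>, so
  \<open>B\<close> extends \<open>T\<close>.\<close>

definition B :: "'a \<Rightarrow> 'a \<Rightarrow> complex" where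
  "B f g = (if g \<in> Domain S
     then ip H (op_apply S f) g + (\<gamma> f + \<i> * \<phi> f) * cnj (\<phi> g) else 0)"

definition K :: "complex \<Rightarrow> 'a \<Rightarrow> complex" where
  "K c g = (if g \<in> Domain S then c * cnj (\<phi> g) else 0)"

lemma embed_eq: "embed H A h = (\<lambda>g. if g \<in> Domain S then ip H h g else 0)"
  by (simp add: embed_def)

text \<open>\<open>B f\<close> and \<open>K c\<close> both have this shape: a regular part, zero for
  \<open>K c\<close>, and a multiple of the functional induced by \<open>\<phi>\<close>.\<close>

lemma minus_spaceI:
  assumes "\<And>g. g \<in> Domain S \<Longrightarrow> F g = ip H h g + c * cnj (\<phi> g)"
    and "\<And>g. g \<notin> Domain S \<Longrightarrow> F g = 0" and h: "h \<in> carrier H"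
  shows "F \<in> minus_space H A"
proof -
  obtain C where C: "0 \<le> C" "\<And>f. f \<in> Domain S \<Longrightarrow> cmod (\<phi> f) \<le> C * hnorm P f"
    using boundary_bound by metis
  have "cmod (F f) \<le> (hnorm H h + cmod c * C) * hnorm P f" if f: "f \<in> Domain S" for f
  proof -
    have "cmod (F f) \<le> cmod (ip H h f) + cmod c * cmod (\<phi> f)"
      using assms(1)[OF f] norm_triangle_ineq[of "ip H h f" "c * cnj (\<phi> f)"]
      by (simp add: norm_mult)
    also have "\<dots> \<le> hnorm H h * hnorm P f + cmod c * (C * hnorm P f)"
      using cauchy_schwarz[of h f] f h hnorm_P_ge(1)[OF f] C
      by (intro add_mono mult_left_mono order_trans[OF cauchy_schwarz]) auto
    finally show ?thesis by (simp add: algebra_simps)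
  qed
  hence "\<exists>C. \<forall>f\<in>Domain S. cmod (F f) \<le> C * hnorm P f" by blast
  moreover have "F (f \<oplus> g) = F f + F g" if "f \<in> Domain S" "g \<in> Domain S" for f g
    using that h by (simp add: assms(1) ip_simps \<phi>_add algebra_simps)
  moreover have "F (d \<odot> f) = cnj d * F f" if "f \<in> Domain S" for f d
    using that h by (simp add: assms(1) ip_simps \<phi>_smult algebra_simps)
  ultimately show ?thesis
    using assms(2) unfolding minus_space_def Let_def carrier_P by blast
qed

lemma bounded_B: "bounded_plus_minus H A B"
  unfolding bounded_plus_minus_def Let_def carrier_P
proof (intro conjI ballI allI)
  fix f assume f: "f \<in> Domain S"
  show "B f \<in> minus_space H A"
    by (rule minus_spaceI[of _ "op_apply S f" "\<gamma> f + \<i> * \<phi> f"]) (use f in \<open>auto simp: B_def\<close>)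
  show "B (c \<odot> f) = (\<lambda>x. c * B f x)" for c
    using f by (auto simp: B_def fun_eq_iff op_apply_smult ip_simps \<gamma>_smult \<phi>_smult algebra_simps)
  show "B (f \<oplus> g) = (\<lambda>x. B f x + B g x)" if "g \<in> Domain S" for g
    using f that by (auto simp: B_def fun_eq_iff op_apply_add ip_simps \<gamma>_add \<phi>_add algebra_simps)
next
  obtain C where C: "0 \<le> C" "\<And>f. f \<in> Domain S \<Longrightarrow> cmod (\<gamma> f) \<le> C * hnorm P f"
    "\<And>f. f \<in> Domain S \<Longrightarrow> cmod (\<phi> f) \<le> C * hnorm P f"
    using boundary_bound by metis
  have "minus_norm H A (B f) \<le> (1 + 2 * C * C) * hnorm P f" if f: "f \<in> Domain S" for f
  proof (rule minus_norm_le)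
    fix g assume g: "g \<in> Domain S"
    have "cmod (\<gamma> f + \<i> * \<phi> f) \<le> 2 * C * hnorm P f"
      using norm_triangle_ineq[of "\<gamma> f" "\<i> * \<phi> f"] C(2)[OF f] C(3)[OF f] by (simp add: norm_mult)
    hence "cmod (\<gamma> f + \<i> * \<phi> f) * cmod (\<phi> g) \<le> (2 * C * hnorm P f) * (C * hnorm P g)"
      using C(3)[OF g] C(1) hnorm_P_ge(3)[OF f] by (intro mult_mono) auto
    moreover have "cmod (ip H (op_apply S f) g) \<le> hnorm P f * hnorm P g"
      using cauchy_schwarz[of "op_apply S f" g] f g hnorm_P_ge[OF f] hnorm_P_ge[OF g]
      by (meson Domain_S_closed hnorm_ge_0 mult_mono order_trans)
    moreover have "cmod (B f g) \<le> cmod (ip H (op_apply S f) g) + cmod (\<gamma> f + \<i> * \<phi> f) * cmod (\<phi> g)"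
      using g norm_triangle_ineq[of "ip H (op_apply S f) g" "(\<gamma> f + \<i> * \<phi> f) * cnj (\<phi> g)"]
      by (simp add: B_def norm_mult)
    ultimately show "cmod (B f g) \<le> (1 + 2 * C * C) * hnorm P f * hnorm P g"
      by (simp add: algebra_simps)
  qed (use C hnorm_P_ge[OF f] in auto)
  thus "\<exists>C. \<forall>f\<in>Domain S. minus_norm H A (B f) \<le> C * hnorm P f" by blast
qed

lemma bounded_K: "bounded_channel H A K"
  unfolding bounded_channel_def
proof (intro conjI allI)
  show "K c \<in> minus_space H A" for c
    by (rule minus_spaceI[of _ \<zero> c]) (auto simp: K_def)
  show "K (c + d) = (\<lambda>f. K c f + K d f)" "K (c * d) = (\<lambda>f. c * K d f)" for c d
    by (auto simp: K_def fun_eq_iff algebra_simps)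
  obtain C where C: "0 \<le> C" "\<And>f. f \<in> Domain S \<Longrightarrow> cmod (\<phi> f) \<le> C * hnorm P f"
    using boundary_bound by metis
  have "minus_norm H A (K c) \<le> C * cmod c" for c
  proof (rule minus_norm_le)
    fix g assume g: "g \<in> Domain S"
    have "cmod c * cmod (\<phi> g) \<le> cmod c * (C * hnorm P g)"
      using C(2)[OF g] by (intro mult_left_mono) auto
    thus "cmod (K c g) \<le> C * cmod c * hnorm P g"
      using g by (simp add: K_def norm_mult algebra_simps)
  qed (use C in auto)
  thus "\<exists>C. \<forall>c. minus_norm H A (K c) \<le> C * cmod c" by blast
qed

text \<open>Moving \<open>S\<close> to the other side by Green's identity trades the product of
  \<open>\<phi> f\<close> and \<open>cnj (\<gamma> g)\<close> for that of \<open>\<gamma> f\<close>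
  and \<open>cnj (\<phi> g)\<close>. In the end only the sign of \<open>\<i> * \<phi> f\<close> has
  changed.\<close>

lemma adj_B:
  assumes f: "f \<in> Domain S"
  shows "adj_pm H A B f = (\<lambda>g. if g \<in> Domain S
     then ip H (op_apply S f) g + (\<gamma> f - \<i> * \<phi> f) * cnj (\<phi> g) else 0)"
proof
  fix g
  have "cnj (B g f) = ip H (op_apply S f) g + (\<gamma> f - \<i> * \<phi> f) * cnj (\<phi> g)" if g: "g \<in> Domain S"
  proof -
    have "ip H f (op_apply S g) = cnj (ip H (op_apply S g) f)"
      by (rule ip_cnj) (use f g in auto)
    thus ?thesis
      using green[OF S_apply[OF f] S_apply[OF g]] f by (simp add: B_def algebra_simps)
  qed
  thus "adj_pm H A B f g = (if g \<in> Domain S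
     then ip H (op_apply S f) g + (\<gamma> f - \<i> * \<phi> f) * cnj (\<phi> g) else 0)"
    by (simp add: adj_pm_def)
qed

lemma Re_B:
  assumes f: "f \<in> Domain S"
  shows "Re_pm H A B f = (\<lambda>g. if g \<in> Domain S
     then ip H (op_apply S f) g + \<gamma> f * cnj (\<phi> g) else 0)"
  using f by (auto simp: fun_eq_iff Re_pm_def adj_B B_def field_simps)

lemma Im_B:
  assumes f: "f \<in> Domain S"
  shows "Im_pm H A B f = K (\<phi> f)"
  using f by (auto simp: fun_eq_iff Im_pm_def adj_B B_def K_def field_simps)

lemma channel_adj_K: "f \<in> Domain S \<Longrightarrow> channel_adj K f = \<phi> f"
  by (simp add: channel_adj_def K_def)

text \<open>Testing with the dense domain of \<open>A\<close>, where the singular term is invisible,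
  identifies \<open>h\<close>. Testing with a vector of boundary value \<open>\<phi> = 1\<close>
  then forces the coefficient \<open>\<gamma> f\<close> of the singular term to vanish.\<close>

lemma Re_B_regular:
  assumes f: "f \<in> Domain S" and h: "h \<in> carrier H" and eq: "Re_pm H A B f = embed H A h"
  shows "(f, h) \<in> A0"
proof -
  have *: "ip H (op_apply S f) g + \<gamma> f * cnj (\<phi> g) = ip H h g" if "g \<in> Domain S" for g
    using fun_cong[OF eq, of g] f that by (simp add: Re_B embed_eq)
  have "op_apply S f \<ominus> h = \<zero>"
  proof (rule orthogonal_dense[OF dense_A])
    show "ip H (op_apply S f \<ominus> h) g = 0" if "g \<in> Domain A" for g
    proof -
      have "g \<in> Domain S" "\<phi> g = 0" using that by (auto simp: A_def)
      thus ?thesis using *[of g] f h by (simp add: ip_diff)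
    qed
  qed (use f h in auto)
  hence h_eq: "h = op_apply S f" using f h by (simp add: diff_eq_zero_iff)
  obtain g g' where "(g, g') \<in> S" "\<phi> g = 1" by (rule obtain_boundary)
  hence "\<gamma> f = 0" using *[of g] by (auto simp: h_eq)
  thus ?thesis using S_apply[OF f] by (simp add: A0_def h_eq)
qed

lemma quasi_kernel_B: "quasi_kernel H A B = A0"
proof (intro equalityI subrelI)
  fix f h assume "(f, h) \<in> quasi_kernel H A B"
  thus "(f, h) \<in> A0" using Re_B_regular by (simp add: quasi_kernel_def)
next
  fix f h assume fh: "(f, h) \<in> A0"
  have f: "f \<in> Domain S" "op_apply S f = h" using fh op_apply_S by (auto simp: A0_def)
  thus "(f, h) \<in> quasi_kernel H A B"
    using fh by (auto simp: quasi_kernel_def A0_def Re_B embed_eq dest: S_closed)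
qed

lemma star_extension_B: "star_extension H A T B"
proof -
  have "extended_by H A T B"
    unfolding extended_by_def
    by (auto simp: T_def fun_eq_iff B_def embed_eq op_apply_S)
  moreover have "extended_by H A T' (adj_pm H A B)"
    unfolding extended_by_def
  proof (intro ballI, clarify)
    fix f h assume fh: "(f, h) \<in> T'"
    hence "f \<in> Domain S" "op_apply S f = h" using op_apply_S by (auto simp: T'_def)
    thus "f \<in> carrier P \<and> adj_pm H A B f = embed H A h"
      using fh by (auto simp: adj_B embed_eq T'_def)
  qed
  moreover have "A \<subseteq> T'" by (auto simp: A_def T'_def)
  ultimately show ?thesis
    using bounded_B A_subset selfadjoint_A0
    by (simp add: star_extension_def hadjoint_T quasi_kernel_B)
qed

section \<open>The L-system and its impedance function\<close>

definition system :: "'a l_system" where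
  "system = \<lparr>state_space = H, sym_op = A, main_op = T, state_op = B, channel_op = K\<rparr>"

lemma l_system: "is_l_system system"
proof -
  have "range K = Im_pm H A B ` Domain S"
  proof -
    have "\<phi> ` Domain S = UNIV"
    proof -
      have "c \<in> \<phi> ` Domain S" for c
      proof -
        obtain f f' where "(f, f') \<in> S" "\<phi> f = c" by (rule obtain_boundary)
        thus ?thesis by blast
      qed
      thus ?thesis by blast
    qed
    moreover have "Im_pm H A B ` Domain S = K ` \<phi> ` Domain S"
      using Im_B by (force simp: image_image)
    ultimately show ?thesis by simp
  qed
  moreover have "chilbert_space H" ..
  ultimately show ?thesis
    using linear_A densely_definedI[OF dense_A] closed_A symmetric_A deficiency_A admissible_T
      star_extension_B bounded_K
    by (simp add: is_l_system_def system_def Im_B channel_adj_K)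
qed

lemma system_quasi_kernel: "system_quasi_kernel system = A0"
  by (simp add: system_quasi_kernel_def system_def quasi_kernel_B)

text \<open>\<open>e z\<close> solves the equation with right-hand side \<open>K 1\<close> because
  its \<open>\<gamma>\<close> is 1. Since \<open>impedance\<close> is defined through
  \<open>inv_into\<close>, uniqueness in the plus space is needed too: the difference of two
  solutions is an eigenvector of \<open>A0\<close>.\<close>

lemma realized: "realized_by V system"
  unfolding realized_by_def
proof (intro allI impI)
  fix z assume z: "Im z \<noteq> 0"
  have D: "e z \<in> Domain S" "op_apply S (e z) = z \<odot> e z"
    using e_S[OF z] op_apply_S by auto
  have R: "Re_minus_z system z f = (\<lambda>g. if g \<in> Domain S
      then ip H (op_apply S f) g + \<gamma> f * cnj (\<phi> g) - z * ip H f g else 0)" if "f \<in> Domain S" for f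
    using that by (auto simp: Re_minus_z_def system_def Let_def Re_B embed_eq fun_eq_iff)
  have e_solves: "Re_minus_z system z (e z) = K 1"
    using D z by (auto simp: R K_def fun_eq_iff ip_smult \<gamma>_e)
  have inj: "f = e z" if f: "f \<in> Domain S" "Re_minus_z system z f = K 1" for f
  proof -
    define u where "u = f \<oplus> (-1) \<odot> e z"
    have u: "u \<in> Domain S" using f D by (simp add: u_def)
    have "Re_pm H A B u = embed H A (z \<odot> u)"
    proof
      fix g
      show "Re_pm H A B u g = embed H A (z \<odot> u) g"
      proof (cases "g \<in> Domain S")
        case True
        have "ip H (op_apply S f) g + \<gamma> f * cnj (\<phi> g) - z * ip H f g = cnj (\<phi> g)"
          using fun_cong[OF f(2)[unfolded R[OF f(1)]], of g] True by (simp add: K_def)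
        moreover have "Re_pm H A B u g = ip H (op_apply S f) g - z * ip H (e z) g
            + (\<gamma> f - 1) * cnj (\<phi> g)"
          using True u f D z
          by (simp add: Re_B) (simp add: u_def op_apply_add op_apply_smult \<gamma>_add \<gamma>_smult ip_simps \<gamma>_e)
        moreover have "embed H A (z \<odot> u) g = z * (ip H f g - ip H (e z) g)"
          using True f D by (simp add: embed_eq u_def ip_simps)
        ultimately show ?thesis by (simp add: algebra_simps) (metis add_left_imp_eq)
      qed (use u in \<open>auto simp: Re_B embed_eq\<close>)
    qed
    hence "(u, z \<odot> u) \<in> A0" using u by (intro Re_B_regular) auto
    hence "u = \<zero>" using z by (rule A0_eigen)
    thus ?thesis using f D by (simp add: u_def diff_eq_scal[symmetric] diff_eq_zero_iff)
  qed
  let ?D = "carrier (plus_space (state_space system) (sym_op system))"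
  have carr: "?D = Domain S" by (simp add: system_def)
  have mem: "K 1 \<in> Re_minus_z system z ` Domain S" using e_solves D by force
  have "inv_into (Domain S) (Re_minus_z system z) (K 1) = e z"
    using inj inv_into_into[OF mem] f_inv_into_f[OF mem] by blast
  hence "impedance system z = V z"
    using D z by (simp add: impedance_def Let_def carr) (simp add: system_def channel_adj_K \<phi>_e)
  thus "z \<in> resolvent_set (state_space system) (system_quasi_kernel system) \<and>
     channel_op system 1 \<in> Re_minus_z system z ` ?D \<and> V z = impedance system z"
    unfolding carr using resolvent_set_A0[OF z] mem system_quasi_kernel by (simp add: system_def)
qed

section \<open>Primeness of the symmetric operator\<close>

text \<open>\<open>reduces\<close> decomposes only the domain of \<open>A\<close>. The component in \<open>M\<close> is a contraction, so the
  decomposition extends to the closure of that domain.\<close>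

lemma reducing_decomposition:
  assumes red: "reduces H M A" and k: "k \<in> carrier H"
  shows "\<exists>k1\<in>M. \<exists>k2\<in>orth_complement H M. k = k1 \<oplus> k2"
proof -
  have sub: "submodule M (ring_of_type_algebra :: complex ring) H" and cl: "closedin (htopology H) M"
    using red by (auto simp: reduces_def closed_subspace_def)
  have Mc: "M \<subseteq> carrier H"
    and M_add: "\<And>x y. \<lbrakk>x \<in> M; y \<in> M\<rbrakk> \<Longrightarrow> x \<oplus> y \<in> M"
    and M_smult: "\<And>c x. x \<in> M \<Longrightarrow> c \<odot> x \<in> M"
    using submoduleE[OF sub] by auto
  have "\<exists>d p q. d \<in> carrier H \<and> hnorm H (k \<ominus> d) < 1 / Suc n \<and> p \<in> M \<and> q \<in> orth_complement H M \<and> d = p \<oplus> q"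
    for n
  proof -
    have "1 / real (Suc n) > 0" by simp
    then obtain d where d: "d \<in> Domain A" "hnorm H (k \<ominus> d) < 1 / Suc n"
      using dense_A k unfolding dense_in_def by blast
    then obtain d' where "(d, d') \<in> A" by blast
    hence "\<exists>p\<in>M. \<exists>q\<in>orth_complement H M. d = p \<oplus> q" and "d \<in> carrier H"
      using red S_closed unfolding reduces_def A_def by blast+
    thus ?thesis using d by blast
  qed
  then obtain d p q where d: "\<And>n. d n \<in> carrier H" "\<And>n. hnorm H (k \<ominus> d n) < 1 / Suc n"
    and p: "\<And>n. p n \<in> M" and q: "\<And>n. q n \<in> orth_complement H M" and dpq: "\<And>n. d n = p n \<oplus> q n"
    by metis
  have pc: "p n \<in> carrier H" for n using p Mc by blast
  have qc: "q n \<in> carrier H" for n using q by (simp add: orth_complement_def)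
  have qm: "ip H (q n) m = 0" "ip H m (q n) = 0" if "m \<in> M" for n m
    using q[of n] that Mc ip_cnj[of "q n" m] by (auto simp: orth_complement_def)
  have contract: "hdist H (p m) (p n) \<le> 1 / Suc m + 1 / Suc n" for m n
  proof -
    define u where "u = p m \<oplus> (-1) \<odot> p n"
    \<comment> \<open>This is \<open>d m - d n\<close>, written through \<open>k\<close> because
      only the distances to \<open>k\<close> are under control. It has the same inner product with
      \<open>u\<close> as \<open>u\<close> itself, since the components \<open>q\<close> are
      orthogonal to \<open>M\<close>.\<close>
    define v where "v = (k \<ominus> d n) \<ominus> (k \<ominus> d m)"
    have u: "u \<in> M" "u \<in> carrier H" using M_add M_smult p pc by (auto simp: u_def)
    have v: "v \<in> carrier H" using k d by (simp add: v_def)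
    have "ip H u u = ip H (p m) u - ip H (p n) u"
      using u pc by (subst (1) u_def) (simp add: ip_add ip_smult)
    also have "\<dots> = ip H v u"
      using u qm[OF u(1)] k pc qc unfolding v_def dpq by (simp add: ip_simps)
    finally have "ip H u u = ip H v u" .
    hence "(hnorm H u)\<^sup>2 = Re (ip H v u)" using u by (simp add: hnorm_sq)
    also have "\<dots> \<le> hnorm H v * hnorm H u"
      using cauchy_schwarz[OF v u(2)] complex_Re_le_cmod[of "ip H v u"] by linarith
    finally have "hnorm H u \<le> hnorm H v"
      using u v by (cases "hnorm H u = 0") (auto simp: power2_eq_square less_le dest: mult_right_le_imp_le)
    also have "\<dots> \<le> hnorm H (k \<ominus> d n) + hnorm H ((-1) \<odot> (k \<ominus> d m))"
      unfolding v_def using k d hnorm_triangle[of "k \<ominus> d n" "(-1) \<odot> (k \<ominus> d m)"]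
      by (simp add: diff_eq_scal[of "k \<ominus> d n"])
    also have "\<dots> \<le> 1 / Suc n + 1 / Suc m"
      using d(2)[of m] d(2)[of n] k d(1) by (simp add: hnorm_smult)
    finally show ?thesis using pc by (simp add: hdist_def diff_eq_scal u_def add.commute)
  qed
  have "MCauchy p"
    unfolding MCauchy_def
  proof (intro conjI allI impI)
    show "range p \<subseteq> carrier H" using pc by auto
    fix \<epsilon> :: real assume "0 < \<epsilon>"
    then obtain N where N: "1 / real (Suc N) < \<epsilon> / 2"
      using nat_approx_posE[of "\<epsilon> / 2"] by (auto simp: field_simps)
    have "hdist H (p m) (p n) < \<epsilon>" if "N \<le> m" "N \<le> n" for m n
    proof -
      have "1 / real (Suc m) \<le> 1 / real (Suc N)" "1 / real (Suc n) \<le> 1 / real (Suc N)"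
        using that by (simp_all add: frac_le)
      thus ?thesis using contract[of m n] N by linarith
    qed
    thus "\<exists>N. \<forall>n n'. N \<le> n \<longrightarrow> N \<le> n' \<longrightarrow> hdist H (p n) (p n') < \<epsilon>" by blast
  qed
  then obtain k1 where lim: "limitin mtopology p k1 sequentially"
    using complete unfolding mcomplete_def by blast
  have k1: "k1 \<in> M"
    using limitin_closedin[OF lim, of M] cl p by (simp add: htopology_eq)
  hence k1c: "k1 \<in> carrier H" using Mc by blast
  \<comment> \<open>\<open>k - k1\<close> is the sum of \<open>k - d n\<close>,
    \<open>p n - k1\<close> and \<open>q n\<close>. The first two are small, and \<open>q n\<close>
    is orthogonal to \<open>m\<close>.\<close>
  have "ip H (k \<ominus> k1) m = 0" if m: "m \<in> M" for m
  proof (rule ccontr)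
    define \<delta> where "\<delta> = cmod (ip H (k \<ominus> k1) m)"
    assume "ip H (k \<ominus> k1) m \<noteq> 0"
    hence \<delta>: "\<delta> > 0" by (simp add: \<delta>_def)
    have mc: "m \<in> carrier H" using m Mc by blast
    define \<epsilon> where "\<epsilon> = \<delta> / (2 * (hnorm H m + 1))"
    have \<epsilon>: "\<epsilon> > 0" using \<delta> mc by (simp add: \<epsilon>_def add_nonneg_pos)
    have "\<forall>\<^sub>F n in sequentially. hdist H (p n) k1 < \<epsilon>"
      using lim \<epsilon> unfolding limitin_metric by (auto elim: eventually_mono)
    moreover have "\<forall>\<^sub>F n in sequentially. 1 / real (Suc n) < \<epsilon>"
      using \<epsilon> lim_inverse_n' LIMSEQ_Suc[OF lim_inverse_n'] by (intro order_tendstoD(2)[of _ 0]) (auto simp: field_simps)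
    ultimately obtain n where n: "hdist H (p n) k1 < \<epsilon>" "1 / real (Suc n) < \<epsilon>"
      using eventually_happens'[OF sequentially_bot eventually_conj] by blast
    have "ip H (k \<ominus> k1) m = ip H (k \<ominus> d n) m + ip H (p n \<ominus> k1) m"
      using k k1c d pc qc mc qm[OF m] by (simp add: ip_simps dpq)
    hence "\<delta> \<le> hnorm H (k \<ominus> d n) * hnorm H m + hnorm H (p n \<ominus> k1) * hnorm H m"
      unfolding \<delta>_def
      using norm_triangle_ineq[of "ip H (k \<ominus> d n) m" "ip H (p n \<ominus> k1) m"]
        cauchy_schwarz[of "k \<ominus> d n" m] cauchy_schwarz[of "p n \<ominus> k1" m] k k1c d pc mc by simp
    also have "\<dots> \<le> \<epsilon> * hnorm H m + \<epsilon> * hnorm H m"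
      using n d(2)[of n] pc k1c mc by (intro add_mono mult_right_mono) (auto simp: hdist_def)
    also have "\<dots> < \<epsilon> * (2 * (hnorm H m + 1))" using \<epsilon> by (simp add: algebra_simps)
    also have "\<dots> = \<delta>"
    proof -
      have "hnorm H m + 1 \<noteq> 0" using hnorm_ge_0[OF mc] by linarith
      thus ?thesis by (simp add: \<epsilon>_def)
    qed
    finally show False by simp
  qed
  moreover have "k = k1 \<oplus> (k \<ominus> k1)"
    by (rule eq_by_ip) (use k k1c in \<open>auto simp: ip_simps\<close>)
  moreover have "k \<ominus> k1 \<in> carrier H" using k k1c by simp
  ultimately have "k \<ominus> k1 \<in> orth_complement H M \<and> k = k1 \<oplus> (k \<ominus> k1)"
    by (simp add: orth_complement_def)
  thus ?thesis using k1 by blast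
qed

text \<open>By Green's identity the inner product of \<open>x\<close> with \<open>e z\<close> is
  \<open>\<phi>\<close> of the resolvent of \<open>A0\<close> at \<open>cnj z\<close> applied to
  \<open>x\<close>. On a self-adjoint part in \<open>M\<close> that resolvent takes its values in
  the domain of \<open>A\<close>, where \<open>\<phi>\<close> is zero. So \<open>M\<close> is
  orthogonal to all \<open>e z\<close>.\<close>

lemma prime_A: "prime_operator H A"
  unfolding prime_operator_def
proof (rule notI, elim exE conjE)
  fix M assume nz: "M \<noteq> {\<zero>}" and red: "reduces H M A"
    and sa: "selfadjoint_operator (H\<lparr>carrier := M\<rparr>) (A \<inter> M \<times> M)"
  have sub: "submodule M (ring_of_type_algebra :: complex ring) H"
    using red by (auto simp: reduces_def closed_subspace_def)
  have Mc: "M \<subseteq> carrier H"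
    and M_add: "\<And>x y. \<lbrakk>x \<in> M; y \<in> M\<rbrakk> \<Longrightarrow> x \<oplus> y \<in> M"
    and M_smult: "\<And>c x. x \<in> M \<Longrightarrow> c \<odot> x \<in> M"
    using submoduleE[OF sub] by auto
  have "x = \<zero>" if x: "x \<in> M" for x
  proof (rule total)
    show xc: "x \<in> carrier H" using x Mc by blast
    fix z :: complex assume z: "Im z \<noteq> 0"
    define w where "w = cnj z"
    have w: "Im w \<noteq> 0" using z by (simp add: w_def)
    obtain k where k: "(k, x \<oplus> w \<odot> k) \<in> S" "\<gamma> k = 0"
      using resolvent[OF w xc] by blast
    have kc: "k \<in> carrier H" using S_closed[OF k(1)] by blast
    obtain k1 k2 where k1: "k1 \<in> M" and k2: "k2 \<in> orth_complement H M" and keq: "k = k1 \<oplus> k2"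
      using reducing_decomposition[OF red kc] by blast
    have c: "k1 \<in> carrier H" "k2 \<in> carrier H" using k1 k2 Mc by (auto simp: orth_complement_def)
    have perp: "ip H m k2 = 0" if "m \<in> M" for m
      using k2 that Mc ip_cnj[of k2 m] by (auto simp: orth_complement_def)
    \<comment> \<open>Vectors of \<open>M\<close> see only the component \<open>k1\<close> of
      \<open>k\<close>, so the adjoint relation for \<open>k\<close> passes to \<open>k1\<close>
      inside \<open>M\<close>.\<close>
    have "ip H f' k1 = ip H f (x \<oplus> w \<odot> k1)" if f: "(f, f') \<in> A" "f \<in> M" "f' \<in> M" for f f'
    proof -
      have "(k, x \<oplus> w \<odot> k) \<in> hadjoint H A" using k by (simp add: hadjoint_A)
      hence "ip H f' k = ip H f (x \<oplus> w \<odot> k)" using f by (auto simp: hadjoint_def)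
      thus ?thesis
        using f c xc perp[OF f(2)] perp[OF f(3)] Mc by (simp add: keq ip_simps subset_iff)
    qed
    hence "(k1, x \<oplus> w \<odot> k1) \<in> hadjoint (H\<lparr>carrier := M\<rparr>) (A \<inter> M \<times> M)"
      using k1 x M_add M_smult by (auto simp: hadjoint_def)
    \<comment> \<open>So \<open>k1\<close> is the resolvent at \<open>w\<close> of the self-adjoint part, and it agrees with \<open>k\<close>.\<close>
    hence k1A: "(k1, x \<oplus> w \<odot> k1) \<in> A" using sa by (auto simp: selfadjoint_operator_def)
    hence k1S: "(k1, x \<oplus> w \<odot> k1) \<in> A0" using A_subset by blast
    have "(k \<oplus> (-1) \<odot> k1, (x \<oplus> w \<odot> k) \<oplus> (-1) \<odot> (x \<oplus> w \<odot> k1)) \<in> A0"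
      using k1S k linear_A0 unfolding linear_operator_def A0_def by fast
    moreover have "(x \<oplus> w \<odot> k) \<oplus> (-1) \<odot> (x \<oplus> w \<odot> k1) = w \<odot> (k \<oplus> (-1) \<odot> k1)"
      by (rule eq_by_ip) (use c xc kc in \<open>auto simp: ip_simps algebra_simps\<close>)
    ultimately have "k \<oplus> (-1) \<odot> k1 = \<zero>" using A0_eigen w by simp
    hence "k = k1" using kc c by (simp add: diff_eq_scal[symmetric] diff_eq_zero_iff)
    hence "\<phi> k = 0" using k1A by (simp add: A_def)
    thus "ip H x (e z) = 0"
      using green[OF k(1) e_S[OF z]] k z xc kc by (simp add: ip_simps \<gamma>_e w_def)
  qed
  moreover have "\<zero> \<in> M" using submoduleE[OF sub] by (metis M_smult Mc all_not_in_conv scal_zero_left subsetD)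
  ultimately show False using nz by blast
qed

lemma minimal: "minimal_l_system system"
  using l_system prime_A by (simp add: minimal_l_system_def system_def)

text \<open>The scaling of \<open>gp\<close> and \<open>gm\<close> comes from \<open>norm_e\<close>
  and \<open>norm_e'\<close>, and \<open>w\<close> is the phase left free in \<open>gm\<close>. The
  hypothesis on \<open>\<kappa>\<close> is the boundary condition of \<open>T\<close> for
  \<open>gp - \<kappa> gm\<close>; the condition \<open>\<gamma> = 0\<close> for
  \<open>gp + U gm\<close> reads 1 + U w = 0.\<close>

lemma von_Neumann_parameters:
  assumes w: "cmod w = 1" and \<kappa>: "cmod \<kappa> < 1" "\<kappa> * w * (1 + \<i> * V (-\<i>)) = 1 + \<i> * V \<i>"
    and U: "U = - cnj w"
  defines "gp \<equiv> of_real (1 / sqrt (Im (V \<i>))) \<odot> e \<i>"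
    and "gm \<equiv> (w * of_real (1 / sqrt (Im (V \<i>)))) \<odot> e (-\<i>)"
  shows "normalized_deficiency_pair system gp gm \<and> main_parameter system gp gm \<kappa> \<and>
    quasi_kernel_parameter system gp gm U"
proof -
  define r where "r = complex_of_real (1 / sqrt (Im (V \<i>)))"
  have r: "cmod r = 1 / sqrt (Im (V \<i>))" using Im_V_pos by (simp add: r_def norm_divide)
  have D: "e \<i> \<in> Domain S" "e (-\<i>) \<in> Domain S" using e_S[of \<i>] e_S[of "-\<i>"] by auto
  have ww: "w * cnj w = 1" using w by (metis complex_norm_square of_real_1 one_power2)
  have n: "hnorm H (e \<i>) = sqrt (Im (V \<i>))" "hnorm H (e (-\<i>)) = sqrt (Im (V \<i>))"
    using real_sqrt_unique[OF norm_e] real_sqrt_unique[OF norm_e'] by simp_all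
  have gp: "gp = r \<odot> e \<i>" and gm: "gm = (w * r) \<odot> e (-\<i>)"
    by (simp_all add: gp_def gm_def r_def)
  have "gp \<in> eigenspace H S \<i>" "gm \<in> eigenspace H S (-\<i>)"
    unfolding gp gm by (simp_all add: eigenspace_S)
  moreover have "hnorm H gp = 1" "hnorm H gm = 1"
    using Im_V_pos w unfolding gp gm by (simp_all add: hnorm_smult n r norm_mult)
  moreover have "gp \<ominus> \<kappa> \<odot> gm \<in> Domain T"
  proof -
    define f where "f = gp \<oplus> (-1) \<odot> (\<kappa> \<odot> gm)"
    have f: "f \<in> Domain S" using D by (simp add: f_def gp gm)
    have "\<gamma> f + \<i> * \<phi> f = r * ((1 + \<i> * V \<i>) - \<kappa> * w * (1 + \<i> * V (-\<i>)))"
      using D by (simp add: f_def gp gm \<gamma>_add \<gamma>_smult \<phi>_add \<phi>_smult \<gamma>_e \<phi>_e) (simp add: algebra_simps)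
    hence "\<gamma> f + \<i> * \<phi> f = 0" using \<kappa>(2) by simp
    hence "f \<in> Domain T" using f by (auto simp: T_def)
    thus ?thesis using D by (simp add: f_def gp gm diff_eq_scal)
  qed
  moreover have "gp \<oplus> U \<odot> gm \<in> Domain A0"
  proof -
    have f: "gp \<oplus> U \<odot> gm \<in> Domain S" using D by (simp add: gp gm)
    have "\<gamma> (gp \<oplus> U \<odot> gm) = r * (1 + U * w)"
      using D by (simp add: gp gm \<gamma>_add \<gamma>_smult \<gamma>_e algebra_simps)
    also have "U * w = -1" using ww by (simp add: U mult.commute)
    finally show ?thesis using f by (auto simp: A0_def)
  qed
  ultimately show ?thesis
    using w U \<kappa>(1) system_quasi_kernel
    by (simp add: normalized_deficiency_pair_def main_parameter_def quasi_kernel_parameter_def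
        Let_def) (simp add: system_def hadjoint_A)
qed

end

section \<open>The Hilbert space of square integrable functions\<close>

definition L2 :: "'b measure \<Rightarrow> ('b \<Rightarrow> complex) set" where
  "L2 M = {f \<in> borel_measurable M. integrable M (\<lambda>t. (cmod (f t))\<^sup>2)}"

text \<open>Functions that agree almost everywhere must be identified, because \<open>ip_pos\<close>
  allows only the zero vector to have norm 0. The operations act on representatives chosen by
  \<open>l2_rep\<close>; \<open>l2_add\<close>, \<open>l2_smult\<close> and \<open>l2_ip\<close>
  show that the choice does not matter.\<close>

definition l2_class :: "'b measure \<Rightarrow> ('b \<Rightarrow> complex) \<Rightarrow> ('b \<Rightarrow> complex) set" where
  "l2_class M f = {g \<in> L2 M. AE t in M. f t = g t}"

definition l2_rep :: "('b \<Rightarrow> complex) set \<Rightarrow> ('b \<Rightarrow> complex)" where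
  "l2_rep F = (SOME f. f \<in> F)"

text \<open>The fields \<open>mult\<close> and \<open>one\<close> are junk.\<close>

definition l2_space :: "'b measure \<Rightarrow> ('b \<Rightarrow> complex) set inner_module" where
  "l2_space M = \<lparr>carrier = l2_class M ` L2 M, mult = (\<lambda>F G. F), one = {},
     zero = l2_class M (\<lambda>t. 0), add = (\<lambda>F G. l2_class M (\<lambda>t. l2_rep F t + l2_rep G t)),
     smult = (\<lambda>c F. l2_class M (\<lambda>t. c * l2_rep F t)),
     ip = (\<lambda>F G. LINT t|M. l2_rep F t * cnj (l2_rep G t))\<rparr>"

lemma L2_measurable [measurable_dest]: "f \<in> L2 M \<Longrightarrow> f \<in> borel_measurable M"
  by (simp add: L2_def)

lemma L2_bound:
  assumes "g \<in> borel_measurable M" and "integrable M h" and "\<And>t. (cmod (g t))\<^sup>2 \<le> h t"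
  shows "g \<in> L2 M"
  unfolding L2_def
proof (intro CollectI conjI)
  show "integrable M (\<lambda>t. (cmod (g t))\<^sup>2)"
    by (rule Bochner_Integration.integrable_bound[OF assms(2)])
      (use assms(1,3) in \<open>auto intro!: AE_I2 order_trans[OF assms(3)]\<close>)
qed (fact assms)

lemma L2_zero: "(\<lambda>t. 0) \<in> L2 M"
  by (simp add: L2_def)

lemma L2_add: "\<lbrakk>f \<in> L2 M; g \<in> L2 M\<rbrakk> \<Longrightarrow> (\<lambda>t. f t + g t) \<in> L2 M"
proof (rule L2_bound)
  fix t
  have "(cmod (f t + g t))\<^sup>2 \<le> (cmod (f t) + cmod (g t))\<^sup>2"
    by (simp add: norm_triangle_ineq power_mono)
  also have "\<dots> \<le> 2 * (cmod (f t))\<^sup>2 + 2 * (cmod (g t))\<^sup>2"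
    using zero_le_power2[of "cmod (f t) - cmod (g t)"] by (simp add: power2_eq_square algebra_simps)
  finally show "(cmod (f t + g t))\<^sup>2 \<le> 2 * (cmod (f t))\<^sup>2 + 2 * (cmod (g t))\<^sup>2" .
qed (auto simp: L2_def)

lemma L2_smult: "f \<in> L2 M \<Longrightarrow> (\<lambda>t. c * f t) \<in> L2 M"
  by (auto simp: L2_def norm_mult power_mult_distrib)

lemma L2_diff: "\<lbrakk>f \<in> L2 M; g \<in> L2 M\<rbrakk> \<Longrightarrow> (\<lambda>t. f t - g t) \<in> L2 M"
  using L2_add[of f M "\<lambda>t. (-1) * g t"] L2_smult[of g M "-1"] by simp

lemma borel_measurable_cnj [measurable (raw)]:
  "f \<in> borel_measurable M \<Longrightarrow> (\<lambda>t. cnj (f t)) \<in> borel_measurable M"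
  by (rule measurable_compose[OF _ borel_measurable_continuous_onI]) (simp_all add: continuous_on_cnj)

lemma L2_cnj: "f \<in> L2 M \<Longrightarrow> (\<lambda>t. cnj (f t)) \<in> L2 M"
  by (auto simp: L2_def)

lemma L2_integrable_mult: "\<lbrakk>f \<in> L2 M; g \<in> L2 M\<rbrakk> \<Longrightarrow> integrable M (\<lambda>t. f t * g t)"
proof -
  assume fg: "f \<in> L2 M" "g \<in> L2 M"
  show ?thesis
  proof (rule Bochner_Integration.integrable_bound)
    show "integrable M (\<lambda>t. (cmod (f t))\<^sup>2 + (cmod (g t))\<^sup>2)"
      using fg by (simp add: L2_def)
    have "cmod (f t * g t) \<le> (cmod (f t))\<^sup>2 + (cmod (g t))\<^sup>2" for t
      using sum_squares_bound[of "cmod (f t)" "cmod (g t)"]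
        mult_nonneg_nonneg[OF norm_ge_zero[of "f t"] norm_ge_zero[of "g t"]] unfolding norm_mult by linarith
    thus "AE t in M. cmod (f t * g t) \<le> norm ((cmod (f t))\<^sup>2 + (cmod (g t))\<^sup>2)"
      by simp
  qed (use fg in \<open>auto simp: L2_def\<close>)
qed

lemma l2_class_eq:
  assumes "f \<in> L2 M" "g \<in> L2 M"
  shows "l2_class M f = l2_class M g \<longleftrightarrow> (AE t in M. f t = g t)"
proof
  assume "l2_class M f = l2_class M g"
  moreover have "g \<in> l2_class M g" using assms by (simp add: l2_class_def)
  ultimately show "AE t in M. f t = g t" by (auto simp: l2_class_def)
next
  assume *: "AE t in M. f t = g t"
  have "(AE t in M. f t = h t) \<longleftrightarrow> (AE t in M. g t = h t)" for h
  proof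
    assume "AE t in M. f t = h t"
    with * show "AE t in M. g t = h t" by eventually_elim simp
  next
    assume "AE t in M. g t = h t"
    with * show "AE t in M. f t = h t" by eventually_elim simp
  qed
  thus "l2_class M f = l2_class M g" by (auto simp: l2_class_def)
qed

lemma l2_rep_class:
  assumes "f \<in> L2 M"
  shows "l2_rep (l2_class M f) \<in> L2 M" "AE t in M. l2_rep (l2_class M f) t = f t"
proof -
  have "f \<in> l2_class M f" using assms by (simp add: l2_class_def)
  hence "l2_rep (l2_class M f) \<in> l2_class M f" unfolding l2_rep_def by (rule someI[of "\<lambda>h. h \<in> l2_class M f"])
  thus "l2_rep (l2_class M f) \<in> L2 M" "AE t in M. l2_rep (l2_class M f) t = f t"
    by (auto simp: l2_class_def)
qed

lemma l2_carrier: "F \<in> carrier (l2_space M) \<longleftrightarrow> (\<exists>f\<in>L2 M. F = l2_class M f)"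
  by (auto simp: l2_space_def)

lemma l2_class_closed [simp]: "f \<in> L2 M \<Longrightarrow> l2_class M f \<in> carrier (l2_space M)"
  by (auto simp: l2_space_def)

lemma l2_carrierE:
  assumes "F \<in> carrier (l2_space M)"
  obtains f where "f \<in> L2 M" "F = l2_class M f"
  using assms by (auto simp: l2_space_def)

lemma l2_zero: "\<zero>\<^bsub>l2_space M\<^esub> = l2_class M (\<lambda>t. 0)"
  by (simp add: l2_space_def)

lemma l2_add:
  assumes "f \<in> L2 M" "g \<in> L2 M"
  shows "l2_class M f \<oplus>\<^bsub>l2_space M\<^esub> l2_class M g = l2_class M (\<lambda>t. f t + g t)"
proof -
  have "l2_class M (\<lambda>t. l2_rep (l2_class M f) t + l2_rep (l2_class M g) t) = l2_class M (\<lambda>t. f t + g t)"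
    using l2_rep_class[OF assms(1)] l2_rep_class[OF assms(2)] assms
    by (subst l2_class_eq) (auto intro!: L2_add)
  thus ?thesis by (simp add: l2_space_def)
qed

lemma l2_smult:
  assumes "f \<in> L2 M"
  shows "c \<odot>\<^bsub>l2_space M\<^esub> l2_class M f = l2_class M (\<lambda>t. c * f t)"
proof -
  have "l2_class M (\<lambda>t. c * l2_rep (l2_class M f) t) = l2_class M (\<lambda>t. c * f t)"
    using l2_rep_class[OF assms(1)] assms
    by (subst l2_class_eq) (auto intro!: L2_smult)
  thus ?thesis by (simp add: l2_space_def)
qed

lemma l2_ip:
  assumes "f \<in> L2 M" "g \<in> L2 M"
  shows "ip (l2_space M) (l2_class M f) (l2_class M g) = (LINT t|M. f t * cnj (g t))"
proof -
  have "(LINT t|M. l2_rep (l2_class M f) t * cnj (l2_rep (l2_class M g) t)) = (LINT t|M. f t * cnj (g t))"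
  proof (rule integral_cong_AE)
    show "AE t in M. l2_rep (l2_class M f) t * cnj (l2_rep (l2_class M g) t) = f t * cnj (g t)"
      using l2_rep_class(2)[OF assms(1)] l2_rep_class(2)[OF assms(2)] by eventually_elim simp
  qed (use assms l2_rep_class(1)[OF assms(1)] l2_rep_class(1)[OF assms(2)] in \<open>auto simp: L2_def\<close>)
  thus ?thesis by (simp add: l2_space_def)
qed

lemma l2_ip_self:
  assumes "f \<in> L2 M"
  shows "ip (l2_space M) (l2_class M f) (l2_class M f) = of_real (LINT t|M. (cmod (f t))\<^sup>2)"
  by (simp add: l2_ip[OF assms assms] complex_norm_square[symmetric] del: of_real_power)

lemma l2_abelian_group: "abelian_group (l2_space M)"
proof (rule abelian_groupI)
  fix F assume "F \<in> carrier (l2_space M)"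
  then obtain f where f: "f \<in> L2 M" "F = l2_class M f" by (auto simp: l2_carrier)
  show "\<exists>G\<in>carrier (l2_space M). G \<oplus>\<^bsub>l2_space M\<^esub> F = \<zero>\<^bsub>l2_space M\<^esub>"
    using f L2_smult[OF f(1), of "-1"]
    by (intro bexI[of _ "l2_class M (\<lambda>t. (-1) * f t)"]) (auto simp: l2_add l2_zero)
qed (auto simp: l2_add L2_add l2_zero L2_zero algebra_simps elim!: l2_carrierE)

lemma l2_prehilbert: "prehilbert_space (l2_space M)"
proof (intro prehilbert_space.intro prehilbert_space_axioms.intro)
  show "module (ring_of_type_algebra :: complex ring) (l2_space M)"
    by (rule moduleI[OF cring_from_type_algebra l2_abelian_group])
      (auto simp: l2_add L2_add l2_smult L2_smult algebra_simps elim!: l2_carrierE)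
next
  fix F G E assume *: "F \<in> carrier (l2_space M)" "G \<in> carrier (l2_space M)" "E \<in> carrier (l2_space M)"
  then obtain f g e where fge: "f \<in> L2 M" "F = l2_class M f" "g \<in> L2 M" "G = l2_class M g"
    "e \<in> L2 M" "E = l2_class M e" by (auto simp: l2_carrier)
  show "ip (l2_space M) (F \<oplus>\<^bsub>l2_space M\<^esub> G) E = ip (l2_space M) F E + ip (l2_space M) G E"
    using fge L2_integrable_mult[OF fge(1) L2_cnj[OF fge(5)]] L2_integrable_mult[OF fge(3) L2_cnj[OF fge(5)]]
    by (simp add: l2_add l2_ip L2_add distrib_right)
next
  fix F G c assume *: "F \<in> carrier (l2_space M)" "G \<in> carrier (l2_space M)"
  then obtain f g where fg: "f \<in> L2 M" "F = l2_class M f" "g \<in> L2 M" "G = l2_class M g"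
    by (auto simp: l2_carrier)
  show "ip (l2_space M) (c \<odot>\<^bsub>l2_space M\<^esub> F) G = c * ip (l2_space M) F G"
    using fg by (simp add: l2_smult l2_ip L2_smult mult.assoc)
  have "(LINT t|M. g t * cnj (f t)) = (LINT t|M. cnj (f t * cnj (g t)))"
    by (simp add: mult.commute)
  also have "\<dots> = cnj (LINT t|M. f t * cnj (g t))"
    by (rule Bochner_Integration.integral_cnj)
  finally show "ip (l2_space M) G F = cnj (ip (l2_space M) F G)"
    using fg by (simp add: l2_ip)
next
  fix F assume "F \<in> carrier (l2_space M)" and nz: "F \<noteq> \<zero>\<^bsub>l2_space M\<^esub>"
  then obtain f where f: "f \<in> L2 M" "F = l2_class M f" by (auto simp: l2_carrier)
  have int: "integrable M (\<lambda>t. (cmod (f t))\<^sup>2)" using f by (simp add: L2_def)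
  have "\<not> (AE t in M. f t = 0)"
    using nz f l2_class_eq[OF f(1) L2_zero] by (simp add: l2_zero)
  hence "(LINT t|M. (cmod (f t))\<^sup>2) \<noteq> 0"
    using integral_nonneg_eq_0_iff_AE[OF int] by simp
  hence "0 < (LINT t|M. (cmod (f t))\<^sup>2)" by (auto simp: less_le)
  thus "0 < Re (ip (l2_space M) F F)"
    unfolding f(2) l2_ip_self[OF f(1)] by simp
qed

section \<open>Completeness\<close>

lemma l2_hdist:
  assumes "f \<in> L2 M" "g \<in> L2 M"
  shows "(hdist (l2_space M) (l2_class M f) (l2_class M g))\<^sup>2 = (LINT t|M. (cmod (f t - g t))\<^sup>2)"
proof -
  interpret prehilbert_space "l2_space M" by (rule l2_prehilbert)
  have "l2_class M f \<ominus>\<^bsub>l2_space M\<^esub> l2_class M g = l2_class M (\<lambda>t. f t - g t)"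
    using assms L2_smult[OF assms(2), of "-1"] by (simp add: diff_eq_scal l2_smult l2_add)
  thus ?thesis
    using assms L2_diff[OF assms] by (simp add: hdist_def hnorm_sq l2_ip_self)
qed

text \<open>The terms of a summable series are bounded, and the weight 4^n then pushes the
  increments below a multiple of 2^(-n).\<close>

lemma summable_weighted_differences_convergent:
  fixes f :: "nat \<Rightarrow> complex"
  assumes "summable (\<lambda>n. 4 ^ n * (cmod (f (Suc n) - f n))\<^sup>2)"
  shows "convergent f"
proof -
  have "Bseq (\<lambda>n. 4 ^ n * (cmod (f (Suc n) - f n))\<^sup>2)"
    using summable_LIMSEQ_zero[OF assms] convergentI convergent_imp_Bseq by blast
  then obtain K where K: "0 < K" "\<And>n. norm (4 ^ n * (cmod (f (Suc n) - f n))\<^sup>2) \<le> K"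
    by (auto simp: Bseq_def)
  have "norm (f (Suc n) - f n) \<le> sqrt K * (1 / 2) ^ n" for n
  proof -
    have "(2 ^ n * cmod (f (Suc n) - f n))\<^sup>2 \<le> K"
    proof -
      have "((2::real) ^ n)\<^sup>2 = 4 ^ n" by (metis num_double numeral_times_numeral power2_eq_square power_mult_distrib)
      thus ?thesis using K(2)[of n] by (simp add: power_mult_distrib)
    qed
    hence "2 ^ n * cmod (f (Suc n) - f n) \<le> sqrt K" by (rule real_le_rsqrt)
    thus ?thesis by (simp add: power_divide field_simps)
  qed
  moreover have "summable (\<lambda>n. sqrt K * (1 / 2 :: real) ^ n)"
    by (intro summable_mult summable_geometric) simp
  ultimately have "summable (\<lambda>n. f (Suc n) - f n)"
    by (rule summable_comparison_test'[where N = 0, rotated])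
  hence "convergent (\<lambda>n. \<Sum>k<n. f (Suc k) - f k)"
    by (simp add: summable_iff_convergent)
  hence "convergent (\<lambda>n. (\<Sum>k<n. f (Suc k) - f k) + f 0)"
    by (intro convergent_add convergent_const)
  thus ?thesis by (simp add: sum_lessThan_telescope)
qed

text \<open>The weighted series has integral at most the sum of 4^n / 8^n = 2^(-n). Hence it is
  finite almost everywhere, where the previous lemma applies.\<close>

lemma l2_fast_Cauchy_converges:
  assumes f: "\<And>n. f n \<in> L2 M"
    and fast: "\<And>n. (LINT t|M. (cmod (f (Suc n) t - f n t))\<^sup>2) \<le> (1 / 8) ^ n"
  shows "AE t in M. convergent (\<lambda>n. f n t)"
proof -
  note [measurable] = L2_measurable[OF f]
  let ?g = "\<lambda>n t. 4 ^ n * (cmod (f (Suc n) t - f n t))\<^sup>2"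
  have int: "integrable M (?g n)" for n
    using L2_diff[OF f[of "Suc n"] f[of n]] by (simp add: L2_def)
  have "(\<integral>\<^sup>+t. (\<Sum>n. ennreal (?g n t)) \<partial>M) = (\<Sum>n. \<integral>\<^sup>+t. ennreal (?g n t) \<partial>M)"
    by (rule nn_integral_suminf) simp
  also have "\<dots> \<le> (\<Sum>n. ennreal ((1 / 2) ^ n))"
  proof (rule suminf_le)
    fix n
    have "(\<integral>\<^sup>+t. ennreal (?g n t) \<partial>M) = ennreal (LINT t|M. ?g n t)"
      using int by (intro nn_integral_eq_integral) auto
    also have "\<dots> \<le> ennreal (4 ^ n * (1 / 8) ^ n)"
      using fast[of n] by (intro ennreal_leI) simp
    also have "(4::real) ^ n * (1 / 8) ^ n = (1 / 2) ^ n"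
      by (simp add: power_mult_distrib[symmetric])
    finally show "(\<integral>\<^sup>+t. ennreal (?g n t) \<partial>M) \<le> ennreal ((1 / 2) ^ n)" .
  qed auto
  also have "\<dots> = ennreal (\<Sum>n. (1 / 2) ^ n)"
    by (intro suminf_ennreal2 summable_geometric) auto
  finally have "(\<integral>\<^sup>+t. (\<Sum>n. ennreal (?g n t)) \<partial>M) \<noteq> \<infinity>"
    by (auto simp: top_unique)
  hence "AE t in M. (\<Sum>n. ennreal (?g n t)) \<noteq> \<infinity>"
    by (intro nn_integral_PInf_AE) auto
  thus ?thesis
    by eventually_elim (rule summable_weighted_differences_convergent,
        rule summable_suminf_not_top, auto)
qed

text \<open>Taken with \<open>g\<close> a member of the sequence, this turns Cauchy estimates into
  estimates of the distance to the pointwise limit.\<close>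

lemma l2_fatou:
  assumes f: "\<And>n. f n \<in> L2 M" and g: "g \<in> L2 M" and F: "F \<in> borel_measurable M"
    and lim: "AE t in M. (\<lambda>n. f n t) \<longlonglongrightarrow> F t"
    and bd: "\<forall>\<^sub>F n in sequentially. (LINT t|M. (cmod (f n t - g t))\<^sup>2) \<le> \<epsilon>"
  shows "F \<in> L2 M" "(LINT t|M. (cmod (F t - g t))\<^sup>2) \<le> \<epsilon>"
proof -
  note [measurable] = L2_measurable[OF f] L2_measurable[OF g] F
  have \<epsilon>: "0 \<le> \<epsilon>"
  proof -
    obtain n where "(LINT t|M. (cmod (f n t - g t))\<^sup>2) \<le> \<epsilon>"
      using eventually_happens'[OF sequentially_bot bd] by blast
    thus ?thesis by (rule order_trans[rotated]) simp
  qed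
  have "(\<integral>\<^sup>+t. ennreal ((cmod (F t - g t))\<^sup>2) \<partial>M)
      = (\<integral>\<^sup>+t. liminf (\<lambda>n. ennreal ((cmod (f n t - g t))\<^sup>2)) \<partial>M)"
  proof (rule nn_integral_cong_AE)
    show "AE t in M. ennreal ((cmod (F t - g t))\<^sup>2) = liminf (\<lambda>n. ennreal ((cmod (f n t - g t))\<^sup>2))"
      using lim
    proof eventually_elim
      case (elim t)
      hence "(\<lambda>n. ennreal ((cmod (f n t - g t))\<^sup>2)) \<longlonglongrightarrow> ennreal ((cmod (F t - g t))\<^sup>2)"
        by (intro tendsto_intros)
      thus ?case using lim_imp_Liminf[OF sequentially_bot] by metis
    qed
  qed
  also have "\<dots> \<le> liminf (\<lambda>n. \<integral>\<^sup>+t. ennreal ((cmod (f n t - g t))\<^sup>2) \<partial>M)"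
    by (rule nn_integral_liminf) simp
  also have "\<dots> \<le> liminf (\<lambda>n. ennreal \<epsilon>)"
  proof (rule Liminf_mono)
    show "\<forall>\<^sub>F n in sequentially. (\<integral>\<^sup>+t. ennreal ((cmod (f n t - g t))\<^sup>2) \<partial>M) \<le> ennreal \<epsilon>"
      using bd
    proof eventually_elim
      case (elim n)
      have "(\<integral>\<^sup>+t. ennreal ((cmod (f n t - g t))\<^sup>2) \<partial>M) = ennreal (LINT t|M. (cmod (f n t - g t))\<^sup>2)"
        using L2_diff[OF f[of n] g] by (intro nn_integral_eq_integral) (auto simp: L2_def)
      thus ?case using elim by (simp add: ennreal_leI)
    qed
  qed
  finally have le: "(\<integral>\<^sup>+t. ennreal ((cmod (F t - g t))\<^sup>2) \<partial>M) \<le> ennreal \<epsilon>"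
    by (simp add: Liminf_const)
  have int: "integrable M (\<lambda>t. (cmod (F t - g t))\<^sup>2)"
  proof (rule integrableI_bounded)
    show "(\<integral>\<^sup>+t. ennreal (norm ((cmod (F t - g t))\<^sup>2)) \<partial>M) < \<infinity>"
      using le by (simp add: le_less_trans[OF _ ennreal_less_top])
  qed simp
  hence "(\<lambda>t. F t - g t) \<in> L2 M" by (simp add: L2_def)
  from L2_add[OF this g] show "F \<in> L2 M" by simp
  have "ennreal (LINT t|M. (cmod (F t - g t))\<^sup>2) \<le> ennreal \<epsilon>"
    using le nn_integral_eq_integral[OF int] by simp
  thus "(LINT t|M. (cmod (F t - g t))\<^sup>2) \<le> \<epsilon>"
    using \<epsilon> by (simp add: ennreal_le_iff)
qed

text \<open>The Riesz-Fischer argument: a fast subsequence converges almost everywhere, Fatou's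
  lemma upgrades this to convergence in norm, and a Cauchy sequence with a convergent subsequence
  converges.\<close>

lemma l2_chilbert: "chilbert_space (l2_space M)"
proof -
  interpret prehilbert_space "l2_space M" by (rule l2_prehilbert)
  have "\<exists>l. limitin mtopology s l sequentially" if s: "MCauchy s" for s
  proof -
    have sc: "s n \<in> carrier (l2_space M)" for n using s by (auto simp: MCauchy_def)
    hence "\<exists>f. f \<in> L2 M \<and> s n = l2_class M f" for n by (auto simp: l2_carrier)
    then obtain u where u: "\<And>n. u n \<in> L2 M" "\<And>n. s n = l2_class M (u n)" by metis
    have dist: "(hdist (l2_space M) (s m) (s n))\<^sup>2 = (LINT t|M. (cmod (u m t - u n t))\<^sup>2)" for m n
      using u by (simp add: l2_hdist)
    have "\<exists>N. \<forall>m n. N \<le> m \<longrightarrow> N \<le> n \<longrightarrow> (LINT t|M. (cmod (u m t - u n t))\<^sup>2) \<le> \<epsilon>"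
      if "\<epsilon> > 0" for \<epsilon> :: real
    proof -
      obtain N where N: "\<forall>m n. N \<le> m \<longrightarrow> N \<le> n \<longrightarrow> hdist (l2_space M) (s m) (s n) < sqrt \<epsilon>"
        using s real_sqrt_gt_zero[OF \<open>\<epsilon> > 0\<close>] unfolding MCauchy_def by blast
      have "(hdist (l2_space M) (s m) (s n))\<^sup>2 \<le> \<epsilon>" if "N \<le> m" "N \<le> n" for m n
      proof -
        have "hdist (l2_space M) (s m) (s n) \<le> sqrt \<epsilon>" using N that by (simp add: less_imp_le)
        hence "(hdist (l2_space M) (s m) (s n))\<^sup>2 \<le> (sqrt \<epsilon>)\<^sup>2"
          by (intro power_mono nonneg)
        thus ?thesis using \<open>\<epsilon> > 0\<close> by simp
      qed
      thus ?thesis unfolding dist by blast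
    qed
    note cau = this
    obtain N where N: "\<And>k m n. N k \<le> m \<Longrightarrow> N k \<le> n \<Longrightarrow> (LINT t|M. (cmod (u m t - u n t))\<^sup>2) \<le> (1 / 8) ^ k"
    proof -
      have "\<forall>k. \<exists>N. \<forall>m n. N \<le> m \<longrightarrow> N \<le> n \<longrightarrow> (LINT t|M. (cmod (u m t - u n t))\<^sup>2) \<le> (1 / 8) ^ k"
        by (intro allI cau) simp
      thus ?thesis using that by metis
    qed
    \<comment> \<open>Strictly increasing and at least \<open>N k\<close> at \<open>k\<close>, so
      that consecutive terms of the subsequence obey the rate (1/8)^k.\<close>
    define r where "r = rec_nat (N 0) (\<lambda>k x. max (Suc x) (N (Suc k)))"
    have r: "r 0 = N 0" "r (Suc k) = max (Suc (r k)) (N (Suc k))" for k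
      by (simp_all add: r_def)
    have mono: "strict_mono r" by (rule strict_mono_Suc_iff[THEN iffD2]) (simp add: r less_max_iff_disj)
    have rN: "N k \<le> r k" for k by (cases k) (simp_all add: r)
    have AEc: "AE t in M. convergent (\<lambda>n. u (r n) t)"
    proof (rule l2_fast_Cauchy_converges)
      fix n
      have "N n \<le> r (Suc n)" using rN[of n] strict_monoD[OF mono, of n "Suc n"] by simp
      thus "(LINT t|M. (cmod (u (r (Suc n)) t - u (r n) t))\<^sup>2) \<le> (1 / 8) ^ n"
        using N rN by blast
    qed (rule u)
    define F where "F t = lim (\<lambda>n. u (r n) t)" for t
    have Fm: "F \<in> borel_measurable M"
      unfolding F_def using u by (intro borel_measurable_lim_metric) (auto simp: L2_def)
    have lim: "AE t in M. (\<lambda>n. u (r n) t) \<longlonglongrightarrow> F t"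
      using AEc by eventually_elim (simp add: F_def convergent_LIMSEQ_iff)
    have ev: "\<forall>\<^sub>F m in sequentially. (LINT t|M. (cmod (u (r m) t - u (r n) t))\<^sup>2) \<le> (1 / 8) ^ n" for n
      using eventually_ge_at_top[of n]
    proof eventually_elim
      case (elim m)
      hence "N n \<le> r m" using rN[of n] strict_mono_leD[OF mono elim] by simp
      thus ?case using N rN by blast
    qed
    note fat = l2_fatou[OF u(1) u(1) Fm lim ev]
    have FL: "F \<in> L2 M" by (rule fat(1))
    have d: "(hdist (l2_space M) ((s \<circ> r) n) (l2_class M F))\<^sup>2 \<le> (1 / 8) ^ n" for n
      using fat(2)[of n] u FL by (simp add: l2_hdist norm_minus_commute)
    have "limitin mtopology (s \<circ> r) (l2_class M F) sequentially"
      unfolding limitin_metric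
    proof (intro conjI allI impI)
      fix \<epsilon> :: real assume \<epsilon>: "\<epsilon> > 0"
      have "\<forall>\<^sub>F n in sequentially. (1 / 8 :: real) ^ n < \<epsilon>\<^sup>2"
        using \<epsilon> by (intro order_tendstoD(2)[OF LIMSEQ_realpow_zero]) auto
      thus "\<forall>\<^sub>F n in sequentially. (s \<circ> r) n \<in> carrier (l2_space M) \<and>
          hdist (l2_space M) ((s \<circ> r) n) (l2_class M F) < \<epsilon>"
      proof eventually_elim
        case (elim n)
        hence "(hdist (l2_space M) ((s \<circ> r) n) (l2_class M F))\<^sup>2 < \<epsilon>\<^sup>2" using d[of n] by linarith
        thus ?case using \<epsilon> sc by (auto intro: power_less_imp_less_base)
      qed
    qed (use FL in simp)
    from MCauchy_convergent_subsequence[OF s mono this] show ?thesis by blast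
  qed
  thus ?thesis
    by unfold_locales (auto simp: ip_add ip_smult ip_pos mcomplete_def intro: ip_cnj)
qed

section \<open>Uniqueness of the Poisson integral\<close>

text \<open>By the mean value theorem the error is \<open>s\<close> times an increment of 1 / (1 +
  x^2), a function with Lipschitz constant 1. The bound is uniform in \<open>u\<close>, so it can be
  integrated later.\<close>

lemma arctan_first_order: "\<bar>arctan (u + s) - arctan u - s / (1 + u\<^sup>2)\<bar> \<le> s\<^sup>2" for u s :: real
proof (cases "s = 0")
  case False
  obtain v where v: "\<bar>v - u\<bar> \<le> \<bar>s\<bar>" "arctan (u + s) - arctan u = s / (1 + v\<^sup>2)"
  proof (cases "0 < s")
    case True
    then obtain z where "u < z" "z < u + s" "arctan (u + s) - arctan u = (u + s - u) * inverse (1 + z\<^sup>2)"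
      using MVT2[of u "u + s" arctan "\<lambda>x. inverse (1 + x\<^sup>2)"] DERIV_arctan by auto
    thus ?thesis using that[of z] True by (simp add: field_simps)
  next
    assume "\<not> 0 < s"
    hence s: "s < 0" using \<open>s \<noteq> 0\<close> by simp
    then obtain z where "u + s < z" "z < u" "arctan u - arctan (u + s) = (u - (u + s)) * inverse (1 + z\<^sup>2)"
      using MVT2[of "u + s" u arctan "\<lambda>x. inverse (1 + x\<^sup>2)"] DERIV_arctan by auto
    thus ?thesis using that[of z] s by (simp add: field_simps)
  qed
  have "\<bar>1 / (1 + v\<^sup>2) - 1 / (1 + u\<^sup>2)\<bar> \<le> \<bar>v - u\<bar>"
  proof -
    have pos: "0 < 1 + v\<^sup>2" "0 < 1 + u\<^sup>2" by (simp_all add: add_pos_nonneg)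
    have "1 / (1 + v\<^sup>2) - 1 / (1 + u\<^sup>2) = (u - v) * (u + v) / ((1 + v\<^sup>2) * (1 + u\<^sup>2))"
      using pos by (simp add: field_simps power2_eq_square)
    hence eq: "\<bar>1 / (1 + v\<^sup>2) - 1 / (1 + u\<^sup>2)\<bar> = \<bar>v - u\<bar> * (\<bar>u + v\<bar> / ((1 + v\<^sup>2) * (1 + u\<^sup>2)))"
      using pos by (simp add: abs_mult abs_minus_commute)
    have "2 * \<bar>u\<bar> \<le> 1 + u\<^sup>2" "2 * \<bar>v\<bar> \<le> 1 + v\<^sup>2"
      using sum_squares_bound[of 1 "\<bar>u\<bar>"] sum_squares_bound[of 1 "\<bar>v\<bar>"] by simp_all
    moreover have "0 \<le> u\<^sup>2 * v\<^sup>2" by simp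
    moreover have "0 \<le> u\<^sup>2" "0 \<le> v\<^sup>2" by simp_all
    ultimately have "\<bar>u + v\<bar> \<le> 1 + v\<^sup>2 + u\<^sup>2 + u\<^sup>2 * v\<^sup>2"
      using abs_triangle_ineq[of u v] by linarith
    hence "\<bar>u + v\<bar> \<le> (1 + v\<^sup>2) * (1 + u\<^sup>2)"
      by (simp add: algebra_simps)
    hence "\<bar>u + v\<bar> / ((1 + v\<^sup>2) * (1 + u\<^sup>2)) \<le> 1" using pos by simp
    thus ?thesis unfolding eq by (intro mult_left_le) simp_all
  qed
  hence "\<bar>s\<bar> * \<bar>1 / (1 + v\<^sup>2) - 1 / (1 + u\<^sup>2)\<bar> \<le> \<bar>s\<bar> * \<bar>s\<bar>"
    using v(1) by (intro mult_left_mono) auto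
  moreover have "arctan (u + s) - arctan u - s / (1 + u\<^sup>2) = s * (1 / (1 + v\<^sup>2) - 1 / (1 + u\<^sup>2))"
    unfolding v(2) by (simp add: algebra_simps)
  ultimately show ?thesis by (simp add: abs_mult power2_eq_square)
qed simp

text \<open>The derivative vanishes everywhere. For an integral depending on a parameter this
  replaces differentiation under the integral sign.\<close>

lemma quadratic_modulus_constant:
  fixes G :: "real \<Rightarrow> complex"
  assumes "\<And>x s. norm (G (x + s) - G x) \<le> C * s\<^sup>2"
  shows "G x = G y"
proof -
  have "(G has_derivative (\<lambda>h. 0)) (at x)" for x
  proof (rule has_derivativeI_sandwich[where e = 1 and H = "\<lambda>y. C * \<bar>y - x\<bar>"])
    show "norm (G y - G x - 0) / norm (y - x) \<le> C * \<bar>y - x\<bar>" if "y \<noteq> x" for y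
      using assms[of x "y - x"] that
      by (simp add: pos_divide_le_eq) (simp add: power2_eq_square[symmetric] mult.assoc abs_mult_self_eq flip: abs_mult)
    show "((\<lambda>y. C * \<bar>y - x\<bar>) \<longlongrightarrow> 0) (at x)"
      by (rule tendsto_eq_intros refl | simp)+
  qed auto
  hence "\<exists>c. \<forall>x\<in>UNIV. G x = c"
    by (intro has_derivative_zero_constant) auto
  thus ?thesis by auto
qed

text \<open>The positive and the negative part of \<open>k\<close> are densities of finite measures
  that agree on all half-lines, hence everywhere.\<close>

lemma half_line_integrals_zero:
  fixes k :: "real \<Rightarrow> real"
  assumes sets: "sets M = sets borel" and k: "integrable M k"
    and zero: "\<And>x. (LINT t|M. k t * indicator {x<..} t) = 0"
  shows "AE t in M. k t = 0"
proof -
  have [measurable_cong, simp]: "sets M = sets borel" by (rule sets)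
  note [measurable] = borel_measurable_integrable[OF k]
  let ?p = "\<lambda>t. ennreal (max 0 (k t))" and ?n = "\<lambda>t. ennreal (max 0 (- k t))"
  have int: "integrable M (\<lambda>t. max 0 (k t) * indicator A t)" "integrable M (\<lambda>t. max 0 (- k t) * indicator A t)"
    if "A \<in> sets borel" for A
    using k that by (auto intro!: integrable_real_mult_indicator integrable_max)
  have half: "emeasure (density M ?p) {x<..} = ennreal (LINT t|M. max 0 (k t) * indicator {x<..} t)"
    "emeasure (density M ?n) {x<..} = ennreal (LINT t|M. max 0 (- k t) * indicator {x<..} t)" for x
  proof -
    have "emeasure (density M ?p) {x<..} = (\<integral>\<^sup>+t. ennreal (max 0 (k t) * indicator {x<..} t) \<partial>M)"
      by (subst emeasure_density) (auto intro!: nn_integral_cong simp: indicator_def)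
    also have "\<dots> = ennreal (LINT t|M. max 0 (k t) * indicator {x<..} t)"
      by (intro nn_integral_eq_integral int) auto
    finally show "emeasure (density M ?p) {x<..} = ennreal (LINT t|M. max 0 (k t) * indicator {x<..} t)" .
    have "emeasure (density M ?n) {x<..} = (\<integral>\<^sup>+t. ennreal (max 0 (- k t) * indicator {x<..} t) \<partial>M)"
      by (subst emeasure_density) (auto intro!: nn_integral_cong simp: indicator_def)
    also have "\<dots> = ennreal (LINT t|M. max 0 (- k t) * indicator {x<..} t)"
      by (intro nn_integral_eq_integral int) auto
    finally show "emeasure (density M ?n) {x<..} = ennreal (LINT t|M. max 0 (- k t) * indicator {x<..} t)" .
  qed
  have "density M ?p = density M ?n"
  proof (rule measure_eqI_lessThan)
    fix x
    have "(LINT t|M. max 0 (k t) * indicator {x<..} t) - (LINT t|M. max 0 (- k t) * indicator {x<..} t)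
        = (LINT t|M. max 0 (k t) * indicator {x<..} t - max 0 (- k t) * indicator {x<..} t)"
      using int by simp
    also have "\<dots> = (LINT t|M. k t * indicator {x<..} t)"
      by (intro Bochner_Integration.integral_cong) (auto simp: indicator_def)
    also have "\<dots> = 0" by (rule zero)
    finally show "emeasure (density M ?p) {x<..} = emeasure (density M ?n) {x<..}"
      unfolding half by simp
    show "emeasure (density M ?p) {x<..} < \<infinity>" unfolding half by simp
  qed simp_all
  moreover have "(\<integral>\<^sup>+t. ?p t \<partial>M) \<noteq> \<infinity>"
  proof -
    have "(\<integral>\<^sup>+t. ?p t \<partial>M) = ennreal (LINT t|M. max 0 (k t))"
      using k by (intro nn_integral_eq_integral integrable_max) auto
    thus ?thesis by simp
  qed
  ultimately have "AE t in M. ?p t = ?n t"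
    by (subst (asm) finite_density_unique) auto
  thus ?thesis
    by eventually_elim (auto simp: max_def split: if_splits)
qed

text \<open>Stieltjes inversion, with \<open>arctan\<close> as primitive of the Poisson kernel. The
  vanishing total integral fixes the constant of integration. The range \<open>y < 1\<close> keeps
  the point i out of reach, since the application divides by \<open>z - \<i>\<close>.\<close>

lemma poisson_integral_zero:
  fixes h :: "real \<Rightarrow> complex"
  assumes sets: "sets M = sets borel" and h: "integrable M h" and total: "(LINT t|M. h t) = 0"
    and poisson: "\<And>x y. \<lbrakk>0 < y; y < 1\<rbrakk> \<Longrightarrow> (LINT t|M. h t * of_real (y / ((t - x)\<^sup>2 + y\<^sup>2))) = 0"
  shows "AE t in M. h t = 0"
proof -
  have [measurable_cong, simp]: "sets M = sets borel" by (rule sets)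
  have space: "space M = UNIV" using sets_eq_imp_space_eq[OF sets] by simp
  note [measurable] = borel_measurable_integrable[OF h]
  have intb: "integrable M (\<lambda>t. h t * of_real (g t))"
    if "g \<in> borel_measurable borel" "\<And>t. \<bar>g t\<bar> \<le> B" for g :: "real \<Rightarrow> real" and B
  proof (rule Bochner_Integration.integrable_bound)
    show "integrable M (\<lambda>t. B * norm (h t))" using h by simp
    show "AE t in M. norm (h t * of_real (g t)) \<le> norm (B * norm (h t))"
    proof (rule AE_I2)
      fix t
      have "\<bar>g t\<bar> * norm (h t) \<le> B * norm (h t)" using that(2) by (intro mult_right_mono) auto
      thus "norm (h t * of_real (g t)) \<le> norm (B * norm (h t))"
        by (simp add: norm_mult mult.commute)
    qed
    show "(\<lambda>t. h t * of_real (g t)) \<in> borel_measurable M" using that(1) by measurable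
  qed
  have dct: "(\<lambda>n. LINT t|M. h t * of_real (g n t)) \<longlonglongrightarrow> (LINT t|M. h t * of_real (l t))"
    if m: "\<And>n. g n \<in> borel_measurable borel" "l \<in> borel_measurable borel"
      and b: "\<And>n t. \<bar>g n t\<bar> \<le> 2" and l: "\<And>t. (\<lambda>n. g n t) \<longlonglongrightarrow> l t"
    for g :: "nat \<Rightarrow> real \<Rightarrow> real" and l
  proof (rule integral_dominated_convergence[where w = "\<lambda>t. 2 * norm (h t)"])
    show "integrable M (\<lambda>t. 2 * norm (h t))" using h by simp
    show "AE t in M. (\<lambda>n. h t * of_real (g n t)) \<longlonglongrightarrow> h t * of_real (l t)"
      using l by (intro AE_I2 tendsto_intros)
    show "AE t in M. norm (h t * of_real (g n t)) \<le> 2 * norm (h t)" for n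
    proof (rule AE_I2)
      fix t
      have "\<bar>g n t\<bar> * norm (h t) \<le> 2 * norm (h t)" using b by (intro mult_right_mono) auto
      thus "norm (h t * of_real (g n t)) \<le> 2 * norm (h t)"
        by (simp add: norm_mult mult.commute)
    qed
  qed (use m in \<open>measurable\<close>)
  have arctan_le: "\<bar>arctan x\<bar> \<le> 2" for x
    using arctan_bounded[of x] pi_less_4 by auto
  \<comment> \<open>\<open>G y\<close> is a primitive of the Poisson integral, so it is constant; letting \<open>y\<close> tend to 0
    turns the kernel into a step function.\<close>
  define G where "G y x = (LINT t|M. h t * of_real (arctan ((x - t) / y)))" for y x
  have G_zero: "G y x = 0" if y: "0 < y" "y < 1" for x y
  proof -
    define C where "C = (LINT t|M. norm (h t)) / y\<^sup>2"
    have "norm (G y (x + s) - G y x) \<le> C * s\<^sup>2" for x s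
    proof -
      define k where "k t = y / ((t - x)\<^sup>2 + y\<^sup>2)" for t
      let ?r = "\<lambda>t. arctan ((x + s - t) / y) - arctan ((x - t) / y) - s * k t"
      have ib: "integrable M (\<lambda>t. h t * of_real (k t))"
      proof (rule intb[where B = "1 / y"])
        fix t
        have le: "y * y \<le> (t - x)\<^sup>2 + y\<^sup>2" by (simp add: power2_eq_square)
        have "y / ((t - x)\<^sup>2 + y\<^sup>2) \<le> y / (y * y)"
          using y by (intro divide_left_mono[OF le] mult_pos_pos) (auto intro: add_nonneg_pos)
        moreover have "0 \<le> y / ((t - x)\<^sup>2 + y\<^sup>2)" using y by simp
        ultimately show "\<bar>k t\<bar> \<le> 1 / y"
          using y by (simp add: k_def)
      qed (simp add: k_def)
      have i1: "integrable M (\<lambda>t. h t * of_real (arctan ((z - t) / y)))" for z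
        by (rule intb[where B = 2]) (auto simp: arctan_le)
      \<comment> \<open>The term with \<open>s\<close> is zero by hypothesis. It is inserted so that
        the integrand becomes the second-order remainder of \<open>arctan\<close>.\<close>
      have "G y (x + s) - G y x = (LINT t|M. h t * of_real (arctan ((x + s - t) / y)))
          - (LINT t|M. h t * of_real (arctan ((x - t) / y)))
          - of_real s * (LINT t|M. h t * of_real (k t))"
        using poisson[OF y, of x, folded k_def] by (simp add: G_def)
      also have "\<dots> = (LINT t|M. h t * of_real (?r t))"
      proof -
        have "(LINT t|M. h t * of_real (?r t)) = (LINT t|M. h t * of_real (arctan ((x + s - t) / y))
          - h t * of_real (arctan ((x - t) / y)) - of_real s * (h t * of_real (k t)))"
          by (intro Bochner_Integration.integral_cong) (auto simp: algebra_simps)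
        thus ?thesis using i1 ib by simp
      qed
      also have "norm \<dots> \<le> (LINT t|M. norm (h t) * (s / y)\<^sup>2)"
      proof (rule order_trans[OF integral_norm_bound integral_mono])
        show "integrable M (\<lambda>t. norm (h t * of_real (?r t)))"
        proof -
          have "integrable M (\<lambda>t. h t * of_real (arctan ((x + s - t) / y))
            - h t * of_real (arctan ((x - t) / y)) - of_real s * (h t * of_real (k t)))"
            using i1 ib by simp
          thus ?thesis by (intro integrable_norm) (simp add: algebra_simps)
        qed
        show "integrable M (\<lambda>t. norm (h t) * (s / y)\<^sup>2)" using h by simp
        fix t
        have "s * k t = (s / y) / (1 + ((x - t) / y)\<^sup>2)"
          using y unfolding k_def by (simp add: power_divide divide_simps power2_eq_square) (simp add: algebra_simps)
        moreover have "(x + s - t) / y = (x - t) / y + s / y"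
          by (simp add: diff_divide_distrib add_divide_distrib)
        ultimately have "\<bar>?r t\<bar> \<le> (s / y)\<^sup>2"
          using arctan_first_order[of "(x - t) / y" "s / y"] by simp
        thus "norm (h t * of_real (?r t)) \<le> norm (h t) * (s / y)\<^sup>2"
          unfolding norm_mult norm_of_real by (rule mult_left_mono) simp
      qed
      also have "\<dots> = C * s\<^sup>2" by (simp add: C_def power_divide)
      finally show ?thesis .
    qed
    note const = quadratic_modulus_constant[OF this]
    \<comment> \<open>The constant is read off at minus infinity, where the kernel tends to -pi/2
      and the integral to a multiple of the total one.\<close>
    have "(\<lambda>n. G y (- real n)) \<longlonglongrightarrow> (LINT t|M. h t * of_real (- (pi / 2)))"
      unfolding G_def
    proof (rule dct)
      fix t
      have "filterlim (\<lambda>n. (- real n - t) / y) at_bot sequentially"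
        using y by real_asymp
      thus "(\<lambda>n. arctan ((- real n - t) / y)) \<longlonglongrightarrow> - (pi / 2)"
        by (rule filterlim_compose[OF tendsto_arctan_at_bot])
    qed (auto simp: arctan_le)
    also have "(LINT t|M. h t * of_real (- (pi / 2))) = 0"
      using total by simp
    also have "(\<lambda>n. G y (- real n)) = (\<lambda>n. G y x)" using const by blast
    finally show ?thesis by (simp add: LIMSEQ_const_iff)
  qed
  have sgn_zero: "(LINT t|M. h t * of_real (sgn (x - t))) = 0" for x
  proof -
    \<comment> \<open>The summand 2 keeps the height strictly below 1 already for
      \<open>n = 0\<close>.\<close>
    have "(\<lambda>n. G (1 / (real n + 2)) x) \<longlonglongrightarrow> (LINT t|M. h t * of_real (pi / 2 * sgn (x - t)))"
      unfolding G_def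
    proof (rule dct)
      fix t
      consider "x < t" | "x = t" | "t < x" by linarith
      thus "(\<lambda>n. arctan ((x - t) / (1 / (real n + 2)))) \<longlonglongrightarrow> pi / 2 * sgn (x - t)"
      proof cases
        case 1
        hence "filterlim (\<lambda>n. (x - t) / (1 / (real n + 2))) at_bot sequentially" by real_asymp
        thus ?thesis using filterlim_compose[OF tendsto_arctan_at_bot] 1 by fastforce
      next
        case 3
        hence "filterlim (\<lambda>n. (x - t) / (1 / (real n + 2))) at_top sequentially" by real_asymp
        thus ?thesis using filterlim_compose[OF tendsto_arctan_at_top] 3 by fastforce
      qed simp
    qed (auto simp: arctan_le)
    moreover have "(\<lambda>n. G (1 / (real n + 2)) x) = (\<lambda>n. 0)"
      by (intro ext G_zero) auto
    ultimately have "(LINT t|M. h t * of_real (pi / 2 * sgn (x - t))) = 0"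
      by (simp add: LIMSEQ_const_iff)
    moreover have "(LINT t|M. h t * of_real (pi / 2 * sgn (x - t)))
        = (LINT t|M. of_real (pi / 2) * (h t * of_real (sgn (x - t))))"
      by (intro Bochner_Integration.integral_cong) auto
    ultimately show ?thesis by simp
  qed
  have half: "(LINT t|M. h t * of_real (indicator {x<..} t)) = 0" for x
  proof -
    \<comment> \<open>\<open>sgn\<close> is zero at \<open>t = x\<close>, which would leave a
      possible atom there undecided. Approaching \<open>x\<close> from the right assigns the value 1
      to it, so the limit involves only the open half-line.\<close>
    let ?l = "\<lambda>t. 1 - 2 * indicator {x<..} t :: real"
    have "(\<lambda>n. LINT t|M. h t * of_real (sgn (x + 1 / (real n + 1) - t))) \<longlonglongrightarrow> (LINT t|M. h t * of_real (?l t))"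
    proof (rule dct)
      fix t
      have lim: "(\<lambda>n. x + 1 / (real n + 1)) \<longlonglongrightarrow> x" by real_asymp
      show "(\<lambda>n. sgn (x + 1 / (real n + 1) - t)) \<longlonglongrightarrow> ?l t"
      proof (cases "x < t")
        case True
        from order_tendstoD(2)[OF lim this] show ?thesis
          by (intro tendsto_eventually, elim eventually_mono) (use True in simp)
      next
        case False
        have "sgn (x + 1 / (real n + 1) - t) = 1" for n
        proof -
          have "0 < 1 / (real n + 1)" by simp
          hence "0 < x + 1 / (real n + 1) - t" using False by linarith
          thus ?thesis by simp
        qed
        thus ?thesis using False by simp
      qed
    qed (auto simp: sgn_real_def)
    hence "(LINT t|M. h t * of_real (?l t)) = 0"
      by (simp add: sgn_zero LIMSEQ_const_iff)
    moreover have "(LINT t|M. h t * of_real (?l t))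
        = (LINT t|M. h t - 2 * (h t * of_real (indicator {x<..} t)))"
      by (intro Bochner_Integration.integral_cong) (auto simp: algebra_simps)
    moreover have "integrable M (\<lambda>t. h t * of_real (indicator {x<..} t))"
      by (rule intb[where B = 1]) (auto simp: indicator_def)
    ultimately show ?thesis using h total by simp
  qed
  have "AE t in M. Re (h t) = 0"
  proof (rule half_line_integrals_zero[OF sets])
    fix x
    have "(LINT t|M. Re (h t) * indicator {x<..} t) = Re (LINT t|M. h t * of_real (indicator {x<..} t))"
      using intb[of "indicator {x<..}" 1] by (subst integral_Re[symmetric]) (auto simp: indicator_def)
    thus "(LINT t|M. Re (h t) * indicator {x<..} t) = 0" by (simp add: half)
  qed (use h in simp)
  moreover have "AE t in M. Im (h t) = 0"
  proof (rule half_line_integrals_zero[OF sets])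
    fix x
    have "(LINT t|M. Im (h t) * indicator {x<..} t) = Im (LINT t|M. h t * of_real (indicator {x<..} t))"
      using intb[of "indicator {x<..}" 1] by (subst integral_Im[symmetric]) (auto simp: indicator_def)
    thus "(LINT t|M. Im (h t) * indicator {x<..} t) = 0" by (simp add: half)
  qed (use h in simp)
  ultimately show ?thesis by eventually_elim (simp add: complex_eq_iff)
qed

section \<open>The multiplication operator\<close>

definition cauchy_kernel :: "complex \<Rightarrow> real \<Rightarrow> complex" where
  "cauchy_kernel z t = 1 / (of_real t - z)"

lemma cauchy_kernel_measurable [measurable]: "cauchy_kernel z \<in> borel_measurable borel"
  unfolding cauchy_kernel_def by measurable

lemma of_real_minus_nonzero: "Im z \<noteq> 0 \<Longrightarrow> of_real t - z \<noteq> 0"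
  by (auto simp: complex_eq_iff)

lemma cauchy_kernel_le: "Im z \<noteq> 0 \<Longrightarrow> cmod (cauchy_kernel z t) \<le> 1 / \<bar>Im z\<bar>"
proof -
  assume z: "Im z \<noteq> 0"
  have "\<bar>Im z\<bar> \<le> cmod (of_real t - z)" using abs_Im_le_cmod[of "of_real t - z"] by simp
  thus ?thesis using z by (simp add: cauchy_kernel_def norm_divide frac_le)
qed

lemma cauchy_kernel_i_sq: "(cmod (cauchy_kernel \<i> t))\<^sup>2 = 1 / (1 + t\<^sup>2)"
  by (simp add: cauchy_kernel_def norm_divide power_divide cmod_power2 add.commute)

text \<open>The resolvent identity for multiplication by the variable.\<close>

lemma cauchy_kernel_diff:
  assumes "Im z \<noteq> 0" "Im w \<noteq> 0"
  shows "cauchy_kernel z t - cauchy_kernel w t = (z - w) * (cauchy_kernel z t * cauchy_kernel w t)"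
  using of_real_minus_nonzero[OF assms(1), of t] of_real_minus_nonzero[OF assms(2), of t]
  by (simp add: cauchy_kernel_def field_simps)

locale multiplication_model =
  fixes M :: "real measure" and Q a :: real
  assumes sets_M: "sets M = sets borel"
    and infinite_M: "emeasure M UNIV = \<infinity>"
    and integrable_M: "integrable M (\<lambda>t. 1 / (1 + t\<^sup>2))"
    and a_def: "(LINT t|M. 1 / (1 + t\<^sup>2)) = a"
begin

lemma [measurable_cong]: "sets M = sets borel"
  by (rule sets_M)

lemma space_M [simp]: "space M = UNIV"
  using sets_eq_imp_space_eq[OF sets_M] by simp

sublocale H: chilbert_space "l2_space M"
  by (rule l2_chilbert)

abbreviation cls :: "(real \<Rightarrow> complex) \<Rightarrow> (real \<Rightarrow> complex) set" where "cls \<equiv> l2_class M"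
abbreviation L where "L \<equiv> L2 M"

text \<open>Both functions are square integrable and p + t q = 1. So the integral of
  \<open>f\<close> can be written through inner products of \<open>f\<close> with \<open>p\<close>
  and of t f with \<open>q\<close>.\<close>

definition p :: "real \<Rightarrow> complex" where "p t = of_real (1 / (1 + t\<^sup>2))"
definition q :: "real \<Rightarrow> complex" where "q t = of_real (t / (1 + t\<^sup>2))"

lemma one_plus_sq_pos: "0 < 1 + t\<^sup>2" for t :: real
  by (simp add: add_pos_nonneg)

lemma pq_identities: "q t = of_real t * p t" "p t + of_real t * q t = 1"
proof -
  have "of_real (1 / (1 + t\<^sup>2) + t * (t / (1 + t\<^sup>2))) = (1 :: complex)"
    using one_plus_sq_pos[of t]
    by (simp add: power2_eq_square add_divide_distrib[symmetric] del: of_real_add of_real_divide)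
  thus "p t + of_real t * q t = 1" by (simp add: p_def q_def)
qed (simp add: p_def q_def)

lemma p_L2: "p \<in> L" and q_L2: "q \<in> L"
proof -
  show "p \<in> L"
  proof (rule L2_bound[OF _ integrable_M])
    fix t :: real
    have "1 / (1 + t\<^sup>2) \<le> 1" using one_plus_sq_pos[of t] by simp
    hence "(1 / (1 + t\<^sup>2)) * (1 / (1 + t\<^sup>2)) \<le> 1 / (1 + t\<^sup>2)"
      by (intro mult_left_le) simp_all
    thus "(cmod (p t))\<^sup>2 \<le> 1 / (1 + t\<^sup>2)"
      by (simp only: p_def norm_of_real power2_abs) (simp only: power2_eq_square)
  qed (simp add: p_def[abs_def])
  show "q \<in> L"
  proof (rule L2_bound[OF _ integrable_M])
    fix t :: real
    have "t\<^sup>2 / (1 + t\<^sup>2) \<le> 1" using one_plus_sq_pos[of t] by simp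
    hence "(t\<^sup>2 / (1 + t\<^sup>2)) * (1 / (1 + t\<^sup>2)) \<le> 1 * (1 / (1 + t\<^sup>2))"
      by (intro mult_right_mono) simp_all
    thus "(cmod (q t))\<^sup>2 \<le> 1 / (1 + t\<^sup>2)"
      by (simp only: q_def norm_of_real power2_abs power_divide) (simp add: power2_eq_square)
  qed (simp add: q_def[abs_def])
qed

lemma a_pos: "0 < a"
proof -
  have "\<not> (AE t in M. 1 / (1 + t\<^sup>2) = 0)"
  proof
    assume "AE t in M. 1 / (1 + t\<^sup>2) = 0"
    hence "AE t in M. False"
      by eventually_elim (use one_plus_sq_pos in \<open>simp add: add_nonneg_eq_0_iff\<close>)
    hence "emeasure M UNIV = 0"
      by (subst (asm) AE_iff_measurable[of UNIV]) auto
    thus False using infinite_M by simp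
  qed
  hence "a \<noteq> 0"
    using integral_nonneg_eq_0_iff_AE[OF integrable_M] a_def by simp
  moreover have "0 \<le> a" unfolding a_def[symmetric] by (intro Bochner_Integration.integral_nonneg) simp
  ultimately show ?thesis by simp
qed

text \<open>Here the infinite mass enters: it makes the constant of a \<open>mult_pair\<close>
  unique and thereby \<open>S\<close> single valued.\<close>

lemma const_L2: "(\<lambda>t. c) \<in> L \<Longrightarrow> c = 0"
  using infinite_M integrable_iff_bounded[of M "\<lambda>t. (cmod c)\<^sup>2"]
  by (auto simp: L2_def ennreal_mult_less_top top_unique ennreal_mult_top split: if_splits)

text \<open>Calculations are done with functions and an explicit constant;
  \<open>\<gamma>_cls\<close> later identifies \<open>c\<close> as a boundary value of the
  class.\<close>

definition mult_pair :: "(real \<Rightarrow> complex) \<Rightarrow> (real \<Rightarrow> complex) \<Rightarrow> complex \<Rightarrow> bool" where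
  "mult_pair f f' c \<longleftrightarrow> f \<in> L \<and> f' \<in> L \<and> (AE t in M. f' t = of_real t * f t - c)"

text \<open>\<open>\<phi>0 f f'\<close> is the integral of \<open>f - c q\<close>, the regularized integral of \<open>f\<close>, written with square
  integrable factors; likewise \<open>\<gamma>\<close> recovers the constant \<open>c\<close> from \<open>f q - f' p = c p\<close>.\<close>

definition \<phi>0 :: "(real \<Rightarrow> complex) \<Rightarrow> (real \<Rightarrow> complex) \<Rightarrow> complex" where
  "\<phi>0 f f' = (LINT t|M. f t * p t + f' t * q t)"

definition S :: "((real \<Rightarrow> complex) set \<times> (real \<Rightarrow> complex) set) set" where
  "S = {(cls f, cls f') | f f' c. mult_pair f f' c}"

definition \<gamma> :: "(real \<Rightarrow> complex) set \<Rightarrow> complex" where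
  "\<gamma> F = (ip (l2_space M) F (cls q) - ip (l2_space M) (op_apply S F) (cls p)) / of_real a"

definition \<phi> :: "(real \<Rightarrow> complex) set \<Rightarrow> complex" where
  "\<phi> F = ip (l2_space M) F (cls p) + ip (l2_space M) (op_apply S F) (cls q) + of_real Q * \<gamma> F"

lemma mult_pair_unique:
  assumes "mult_pair f f' c" "mult_pair g g' d" "AE t in M. f t = g t"
  shows "AE t in M. f' t = g' t"
proof -
  have L: "f \<in> L" "f' \<in> L" "g \<in> L" "g' \<in> L" using assms by (auto simp: mult_pair_def)
  have "AE t in M. f' t = of_real t * f t - c" "AE t in M. g' t = of_real t * g t - d"
    using assms by (auto simp: mult_pair_def)
  with assms(3) have ae: "AE t in M. f' t - g' t = d - c"
    by eventually_elim simp
  have "integrable M (\<lambda>t. (cmod (f' t - g' t))\<^sup>2)"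
    using L2_diff[OF L(2,4)] by (simp add: L2_def)
  moreover have "AE t in M. (cmod (f' t - g' t))\<^sup>2 = (cmod (d - c))\<^sup>2"
    using ae by eventually_elim simp
  ultimately have "integrable M (\<lambda>t. (cmod (d - c))\<^sup>2)"
    using L by (subst (asm) integrable_cong_AE) (auto simp: L2_def)
  hence "d - c = 0" by (intro const_L2) (simp add: L2_def)
  thus ?thesis using ae by simp
qed

lemma mult_pair_add:
  assumes "mult_pair f f' c" "mult_pair g g' d"
  shows "mult_pair (\<lambda>t. f t + g t) (\<lambda>t. f' t + g' t) (c + d)"
proof -
  have "AE t in M. f' t = of_real t * f t - c" "AE t in M. g' t = of_real t * g t - d"
    using assms by (auto simp: mult_pair_def)
  hence "AE t in M. f' t + g' t = of_real t * (f t + g t) - (c + d)"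
  proof eventually_elim
    case (elim t)
    show ?case unfolding elim by (simp add: algebra_simps)
  qed
  thus ?thesis using assms by (simp add: mult_pair_def L2_add)
qed

lemma mult_pair_smult:
  assumes "mult_pair f f' c"
  shows "mult_pair (\<lambda>t. d * f t) (\<lambda>t. d * f' t) (d * c)"
proof -
  have "AE t in M. f' t = of_real t * f t - c"
    using assms by (auto simp: mult_pair_def)
  hence "AE t in M. d * f' t = of_real t * (d * f t) - d * c"
  proof eventually_elim
    case (elim t)
    show ?case unfolding elim by (simp add: algebra_simps)
  qed
  thus ?thesis using assms by (simp add: mult_pair_def L2_smult)
qed

section \<open>The maximal operator and its boundary maps\<close>

lemma S_cases:
  assumes "(F, F') \<in> S"
  obtains f f' c where "mult_pair f f' c" "F = cls f" "F' = cls f'"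
  using assms by (auto simp: S_def)

lemma S_intro: "mult_pair f f' c \<Longrightarrow> (cls f, cls f') \<in> S"
  by (auto simp: S_def)

lemma linear_S: "linear_operator (l2_space M) S"
  unfolding linear_operator_def
proof (intro conjI)
  show "S \<subseteq> carrier (l2_space M) \<times> carrier (l2_space M)"
    by (auto simp: mult_pair_def elim!: S_cases)
  show "single_valued S"
  proof (rule single_valuedI)
    fix F F' F'' assume 1: "(F, F') \<in> S" and 2: "(F, F'') \<in> S"
    obtain f f' c where f: "mult_pair f f' c" "F = cls f" "F' = cls f'" using 1 by (rule S_cases)
    obtain g g' d where g: "mult_pair g g' d" "F = cls g" "F'' = cls g'" using 2 by (rule S_cases)
    have "AE t in M. f t = g t" using f g l2_class_eq[of f M g] by (simp add: mult_pair_def)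
    from mult_pair_unique[OF f(1) g(1) this] show "F' = F''"
      using f g by (simp add: l2_class_eq mult_pair_def)
  qed
  have "mult_pair (\<lambda>t. 0) (\<lambda>t. 0) 0" by (simp add: mult_pair_def L2_zero)
  thus "(\<zero>\<^bsub>l2_space M\<^esub>, \<zero>\<^bsub>l2_space M\<^esub>) \<in> S"
    unfolding l2_zero by (rule S_intro)
  show "\<forall>(f, f')\<in>S. \<forall>(g, g')\<in>S. (f \<oplus>\<^bsub>l2_space M\<^esub> g, f' \<oplus>\<^bsub>l2_space M\<^esub> g') \<in> S"
  proof (clarify elim!: S_cases)
    fix f f' c g g' d assume *: "mult_pair f f' c" "mult_pair g g' d"
    thus "(cls f \<oplus>\<^bsub>l2_space M\<^esub> cls g, cls f' \<oplus>\<^bsub>l2_space M\<^esub> cls g') \<in> S"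
      using S_intro[OF mult_pair_add[OF *]] by (simp add: l2_add mult_pair_def)
  qed
  show "\<forall>d. \<forall>(f, f')\<in>S. (d \<odot>\<^bsub>l2_space M\<^esub> f, d \<odot>\<^bsub>l2_space M\<^esub> f') \<in> S"
  proof (clarify elim!: S_cases)
    fix f f' c d assume *: "mult_pair f f' c"
    thus "(d \<odot>\<^bsub>l2_space M\<^esub> cls f, d \<odot>\<^bsub>l2_space M\<^esub> cls f') \<in> S"
      using S_intro[OF mult_pair_smult[OF *]] by (simp add: l2_smult mult_pair_def)
  qed
qed

lemma op_apply_S: "mult_pair f f' c \<Longrightarrow> op_apply S (cls f) = cls f'"
  unfolding op_apply_def
  using linear_S S_intro by (intro the_equality) (auto simp: linear_operator_def single_valued_def)

lemma cnj_pq [simp]: "cnj (p t) = p t" "cnj (q t) = q t"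
  by (simp_all add: p_def q_def)

lemma mult_pair_boundary:
  assumes f: "mult_pair f f' c"
  shows \<gamma>_cls: "\<gamma> (cls f) = c" and \<phi>_cls: "\<phi> (cls f) = \<phi>0 f f' + of_real Q * c"
proof -
  have L: "f \<in> L" "f' \<in> L" and ae: "AE t in M. f' t = of_real t * f t - c"
    using f by (auto simp: mult_pair_def)
  note [measurable] = L2_measurable[OF L(1)] L2_measurable[OF L(2)] L2_measurable[OF p_L2] L2_measurable[OF q_L2]
  note int = L2_integrable_mult[OF L(1) p_L2] L2_integrable_mult[OF L(1) q_L2]
    L2_integrable_mult[OF L(2) p_L2] L2_integrable_mult[OF L(2) q_L2]
  have "ip (l2_space M) (cls f) (cls q) - ip (l2_space M) (op_apply S (cls f)) (cls p)
      = (LINT t|M. f t * q t - f' t * p t)"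
    using L int by (simp add: op_apply_S[OF f] l2_ip p_L2 q_L2)
  also have "\<dots> = (LINT t|M. c * p t)"
  proof (rule integral_cong_AE)
    show "AE t in M. f t * q t - f' t * p t = c * p t"
      using ae
    proof eventually_elim
      case (elim t)
      show ?case unfolding elim by (simp add: pq_identities(1) algebra_simps)
    qed
  qed simp_all
  also have "\<dots> = c * of_real a"
    using a_def by (simp add: p_def del: of_real_divide)
  finally show \<gamma>: "\<gamma> (cls f) = c" using a_pos by (simp add: \<gamma>_def)
  show "\<phi> (cls f) = \<phi>0 f f' + of_real Q * c"
    using L int by (simp add: \<phi>_def \<gamma> op_apply_S[OF f] l2_ip p_L2 q_L2 \<phi>0_def)
qed

lemma DomainE:
  assumes "F \<in> Domain S"
  obtains f f' c where "mult_pair f f' c" "F = cls f"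
  using assms by (auto elim!: S_cases)

lemma boundary_add:
  assumes "F \<in> Domain S" "G \<in> Domain S"
  shows "\<gamma> (F \<oplus>\<^bsub>l2_space M\<^esub> G) = \<gamma> F + \<gamma> G" "\<phi> (F \<oplus>\<^bsub>l2_space M\<^esub> G) = \<phi> F + \<phi> G"
proof -
  obtain f f' c where f: "mult_pair f f' c" "F = cls f" using assms(1) by (rule DomainE)
  obtain g g' d where g: "mult_pair g g' d" "G = cls g" using assms(2) by (rule DomainE)
  have L: "f \<in> L" "f' \<in> L" "g \<in> L" "g' \<in> L" using f g by (auto simp: mult_pair_def)
  note fg = mult_pair_add[OF f(1) g(1)]
  note int = L2_integrable_mult[OF L(1) p_L2] L2_integrable_mult[OF L(2) q_L2]
    L2_integrable_mult[OF L(3) p_L2] L2_integrable_mult[OF L(4) q_L2]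
  have "\<phi>0 (\<lambda>t. f t + g t) (\<lambda>t. f' t + g' t) = \<phi>0 f f' + \<phi>0 g g'"
    using int by (simp add: \<phi>0_def distrib_right)
  thus "\<gamma> (F \<oplus>\<^bsub>l2_space M\<^esub> G) = \<gamma> F + \<gamma> G" "\<phi> (F \<oplus>\<^bsub>l2_space M\<^esub> G) = \<phi> F + \<phi> G"
    using L by (simp_all add: f(2) g(2) l2_add mult_pair_boundary[OF fg]
        mult_pair_boundary[OF f(1)] mult_pair_boundary[OF g(1)] distrib_left)
qed

lemma boundary_smult:
  assumes "F \<in> Domain S"
  shows "\<gamma> (d \<odot>\<^bsub>l2_space M\<^esub> F) = d * \<gamma> F" "\<phi> (d \<odot>\<^bsub>l2_space M\<^esub> F) = d * \<phi> F"
proof -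
  obtain f f' c where f: "mult_pair f f' c" "F = cls f" using assms(1) by (rule DomainE)
  have L: "f \<in> L" "f' \<in> L" using f by (auto simp: mult_pair_def)
  note df = mult_pair_smult[OF f(1), of d]
  have "\<phi>0 (\<lambda>t. d * f t) (\<lambda>t. d * f' t) = (LINT t|M. d * (f t * p t + f' t * q t))"
    by (simp add: \<phi>0_def algebra_simps)
  also have "\<dots> = d * \<phi>0 f f'" by (simp add: \<phi>0_def)
  finally show "\<gamma> (d \<odot>\<^bsub>l2_space M\<^esub> F) = d * \<gamma> F" "\<phi> (d \<odot>\<^bsub>l2_space M\<^esub> F) = d * \<phi> F"
    using L by (simp_all add: f(2) l2_smult mult_pair_boundary[OF df] mult_pair_boundary[OF f(1)] algebra_simps)
qed

text \<open>This is what the form of \<open>\<gamma>\<close> and \<open>\<phi>\<close> is made for: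
  they are combinations of inner products with \<open>p\<close> and \<open>q\<close>, so the
  Cauchy-Schwarz inequality suffices.\<close>

lemma boundary_bounded:
  "\<exists>C. \<forall>(F, F')\<in>S. cmod (\<gamma> F) \<le> C * (hnorm (l2_space M) F + hnorm (l2_space M) F')"
  "\<exists>C. \<forall>(F, F')\<in>S. cmod (\<phi> F) \<le> C * (hnorm (l2_space M) F + hnorm (l2_space M) F')"
proof -
  define N where "N = hnorm (l2_space M)"
  define C where "C = N (cls p) + N (cls q)"
  have pq: "cls p \<in> carrier (l2_space M)" "cls q \<in> carrier (l2_space M)" using p_L2 q_L2 by simp_all
  have bd: "cmod (ip (l2_space M) F (cls r)) \<le> C * N F" if "F \<in> carrier (l2_space M)" "r = p \<or> r = q" for F r
  proof -
    have "cmod (ip (l2_space M) F (cls r)) \<le> N F * N (cls r)"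
      unfolding N_def using that pq by (intro H.cauchy_schwarz) auto
    also have "\<dots> \<le> N F * C"
      using that pq by (intro mult_left_mono) (auto simp: N_def C_def)
    finally show ?thesis by (simp add: mult.commute)
  qed
  have g: "cmod (\<gamma> F) \<le> (C / a) * (N F + N F')" if FS: "(F, F') \<in> S" for F F'
  proof -
    obtain f f' c where f: "mult_pair f f' c" "F = cls f" "F' = cls f'" using FS by (rule S_cases)
    hence c: "F \<in> carrier (l2_space M)" "F' \<in> carrier (l2_space M)" by (auto simp: mult_pair_def)
    have "cmod (\<gamma> F) = cmod (ip (l2_space M) F (cls q) - ip (l2_space M) F' (cls p)) / a"
      using a_pos by (simp add: \<gamma>_def f(2,3) op_apply_S[OF f(1)] norm_divide)
    also have "\<dots> \<le> (C * N F + C * N F') / a"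
      using a_pos bd[OF c(1), of q] bd[OF c(2), of p]
        norm_triangle_ineq4[of "ip (l2_space M) F (cls q)" "ip (l2_space M) F' (cls p)"]
      by (intro divide_right_mono) auto
    finally show ?thesis by (simp add: algebra_simps add_divide_distrib)
  qed
  have "cmod (\<phi> F) \<le> (C + \<bar>Q\<bar> * (C / a)) * (N F + N F')" if FS: "(F, F') \<in> S" for F F'
  proof -
    obtain f f' c where f: "mult_pair f f' c" "F = cls f" "F' = cls f'" using FS by (rule S_cases)
    hence c: "F \<in> carrier (l2_space M)" "F' \<in> carrier (l2_space M)" by (auto simp: mult_pair_def)
    have "cmod (\<phi> F) \<le> cmod (ip (l2_space M) F (cls p) + ip (l2_space M) F' (cls q)) + cmod (of_real Q * \<gamma> F)"
      unfolding \<phi>_def f(2,3) op_apply_S[OF f(1)] by (rule norm_triangle_ineq)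
    also have "cmod (ip (l2_space M) F (cls p) + ip (l2_space M) F' (cls q)) \<le> C * N F + C * N F'"
      using bd[OF c(1), of p] bd[OF c(2), of q]
        norm_triangle_ineq[of "ip (l2_space M) F (cls p)" "ip (l2_space M) F' (cls q)"] by simp
    also have "cmod (of_real Q * \<gamma> F) \<le> \<bar>Q\<bar> * ((C / a) * (N F + N F'))"
      using mult_left_mono[OF g[OF FS], of "\<bar>Q\<bar>"] by (simp add: norm_mult)
    finally show ?thesis by (simp add: algebra_simps add_divide_distrib)
  qed
  thus "\<exists>C. \<forall>(F, F')\<in>S. cmod (\<phi> F) \<le> C * (hnorm (l2_space M) F + hnorm (l2_space M) F')"
    "\<exists>C. \<forall>(F, F')\<in>S. cmod (\<gamma> F) \<le> C * (hnorm (l2_space M) F + hnorm (l2_space M) F')"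
    using g unfolding N_def by blast+
qed

text \<open>The products with the variable \<open>t\<close> cancel pointwise and leave f cnj(d) - c
  cnj(g), whose two terms need not be integrable separately. Replacing \<open>f\<close> by f - c q
  and \<open>g\<close> by g - d q makes them so and changes nothing, as \<open>q\<close> is real.
  The terms with \<open>Q\<close> cancel because \<open>Q\<close> is real.\<close>

lemma green_S:
  assumes "(F, F') \<in> S" "(G, G') \<in> S"
  shows "ip (l2_space M) F' G - ip (l2_space M) F G' = \<phi> F * cnj (\<gamma> G) - \<gamma> F * cnj (\<phi> G)"
proof -
  obtain f f' c where f: "mult_pair f f' c" "F = cls f" "F' = cls f'" using assms(1) by (rule S_cases)
  obtain g g' d where g: "mult_pair g g' d" "G = cls g" "G' = cls g'" using assms(2) by (rule S_cases)
  have L: "f \<in> L" "f' \<in> L" "g \<in> L" "g' \<in> L" using f g by (auto simp: mult_pair_def)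
  note [measurable] = L2_measurable[OF L(1)] L2_measurable[OF L(2)] L2_measurable[OF L(3)]
    L2_measurable[OF L(4)] L2_measurable[OF p_L2] L2_measurable[OF q_L2]
  let ?u = "\<lambda>t. f t * p t + f' t * q t" and ?v = "\<lambda>t. g t * p t + g' t * q t"
  have int: "integrable M ?u" "integrable M ?v"
    using L p_L2 q_L2 by (auto intro!: Bochner_Integration.integrable_add L2_integrable_mult)
  have "ip (l2_space M) F' G - ip (l2_space M) F G' = (LINT t|M. f' t * cnj (g t) - f t * cnj (g' t))"
    using L2_integrable_mult[OF L(2) L2_cnj[OF L(3)]] L2_integrable_mult[OF L(1) L2_cnj[OF L(4)]] L
    by (simp add: f(2,3) g(2,3) l2_ip)
  also have "\<dots> = (LINT t|M. cnj d * ?u t - c * cnj (?v t))"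
  proof (rule integral_cong_AE)
    have "AE t in M. f' t = of_real t * f t - c" "AE t in M. g' t = of_real t * g t - d"
      using f g by (auto simp: mult_pair_def)
    thus "AE t in M. f' t * cnj (g t) - f t * cnj (g' t) = cnj d * ?u t - c * cnj (?v t)"
    proof eventually_elim
      case (elim t)
      have u: "?u t = f t - c * q t"
      proof -
        have "?u t = f t * (p t + of_real t * q t) - c * q t" by (simp add: elim algebra_simps)
        thus ?thesis by (simp add: pq_identities(2))
      qed
      have v: "?v t = g t - d * q t"
      proof -
        have "?v t = g t * (p t + of_real t * q t) - d * q t" by (simp add: elim algebra_simps)
        thus ?thesis by (simp add: pq_identities(2))
      qed
      show ?case unfolding u v by (simp add: elim algebra_simps)
    qed
  qed simp_all
  also have "\<dots> = cnj d * \<phi>0 f f' - c * cnj (\<phi>0 g g')"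
  proof -
    have "integrable M (\<lambda>t. cnj (?v t))" using int(2) by (rule integrable_cnj)
    hence "(LINT t|M. cnj d * ?u t - c * cnj (?v t))
        = (LINT t|M. cnj d * ?u t) - (LINT t|M. c * cnj (?v t))"
      using int by (intro Bochner_Integration.integral_diff) auto
    also have "(LINT t|M. c * cnj (?v t)) = c * cnj (LINT t|M. ?v t)"
      by (simp only: integral_mult_right_zero Bochner_Integration.integral_cnj)
    also have "(LINT t|M. cnj d * ?u t) = cnj d * (LINT t|M. ?u t)"
      by (simp only: integral_mult_right_zero)
    finally show ?thesis by (simp only: \<phi>0_def)
  qed
  finally show ?thesis
    using mult_pair_boundary[OF f(1)] mult_pair_boundary[OF g(1)] by (simp add: f(2) g(2) algebra_simps)
qed

section \<open>Cauchy kernels\<close>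

lemma cauchy_kernel_L2: "Im z \<noteq> 0 \<Longrightarrow> cauchy_kernel z \<in> L"
proof -
  assume z: "Im z \<noteq> 0"
  \<comment> \<open>By the resolvent identity the kernel at \<open>z\<close> is the kernel at i
    times a factor of modulus at most \<open>B\<close>, and the square modulus of the kernel at i is
    the integrable weight.\<close>
  define B where "B = 1 + cmod (z - \<i>) / \<bar>Im z\<bar>"
  show ?thesis
  proof (rule L2_bound)
    show "integrable M (\<lambda>t. B\<^sup>2 * (1 / (1 + t\<^sup>2)))"
      by (rule integrable_mult_right[OF integrable_M])
    fix t
    have "cauchy_kernel z t = cauchy_kernel \<i> t * (1 + (z - \<i>) * cauchy_kernel z t)"
      using cauchy_kernel_diff[OF z, of \<i> t] by (simp add: algebra_simps)
    hence "cmod (cauchy_kernel z t) = cmod (cauchy_kernel \<i> t) * cmod (1 + (z - \<i>) * cauchy_kernel z t)"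
      by (metis norm_mult)
    also have "cmod (1 + (z - \<i>) * cauchy_kernel z t) \<le> 1 + cmod (z - \<i>) * cmod (cauchy_kernel z t)"
      using norm_triangle_ineq[of 1 "(z - \<i>) * cauchy_kernel z t"] by (simp add: norm_mult)
    also have "\<dots> \<le> B"
      using mult_left_mono[OF cauchy_kernel_le[OF z, of t], of "cmod (z - \<i>)"] by (simp add: B_def)
    finally have "cmod (cauchy_kernel z t) \<le> cmod (cauchy_kernel \<i> t) * B"
      by (simp add: mult_left_mono)
    hence "(cmod (cauchy_kernel z t))\<^sup>2 \<le> (cmod (cauchy_kernel \<i> t) * B)\<^sup>2"
      by (intro power_mono) auto
    thus "(cmod (cauchy_kernel z t))\<^sup>2 \<le> B\<^sup>2 * (1 / (1 + t\<^sup>2))"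
      by (simp only: power_mult_distrib cauchy_kernel_i_sq mult.commute)
  qed simp
qed

lemma cauchy_kernel_pair: "Im z \<noteq> 0 \<Longrightarrow> mult_pair (cauchy_kernel z) (\<lambda>t. z * cauchy_kernel z t) 1"
  unfolding mult_pair_def
proof (intro conjI AE_I2 L2_smult cauchy_kernel_L2)
  fix t assume "Im z \<noteq> 0"
  thus "z * cauchy_kernel z t = of_real t * cauchy_kernel z t - 1"
    using of_real_minus_nonzero[of z t] by (simp add: cauchy_kernel_def field_simps)
qed

text \<open>Since z times the kernel equals t times the kernel minus 1, the identity p + t q = 1
  collapses the integrand of \<open>\<phi>0\<close> to the kernel minus \<open>q\<close>.\<close>

lemma \<phi>_cauchy_kernel:
  assumes z: "Im z \<noteq> 0"
  shows "\<phi> (cls (cauchy_kernel z)) = of_real Q + (LINT t|M. 1 / (of_real t - z) - of_real (t / (1 + t\<^sup>2)))"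
proof -
  have "\<phi>0 (cauchy_kernel z) (\<lambda>t. z * cauchy_kernel z t) = (LINT t|M. 1 / (of_real t - z) - of_real (t / (1 + t\<^sup>2)))"
    unfolding \<phi>0_def
  proof (rule Bochner_Integration.integral_cong[OF refl])
    fix t
    have "z * cauchy_kernel z t = of_real t * cauchy_kernel z t - 1"
      using of_real_minus_nonzero[OF z, of t] by (simp add: cauchy_kernel_def field_simps)
    hence "cauchy_kernel z t * p t + z * cauchy_kernel z t * q t
        = cauchy_kernel z t * (p t + of_real t * q t) - q t"
      by (simp only:) (simp add: algebra_simps)
    also have "\<dots> = 1 / (of_real t - z) - of_real (t / (1 + t\<^sup>2))"
      by (simp only: pq_identities(2) mult_1_right cauchy_kernel_def) (simp only: q_def)
    finally show "cauchy_kernel z t * p t + z * cauchy_kernel z t * q t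
        = 1 / (of_real t - z) - of_real (t / (1 + t\<^sup>2))" .
  qed
  thus ?thesis using \<phi>_cls[OF cauchy_kernel_pair[OF z]] by simp
qed

lemma resolvent_S:
  assumes z: "Im z \<noteq> 0" and K: "K \<in> carrier (l2_space M)"
  shows "\<exists>F. (F, K \<oplus>\<^bsub>l2_space M\<^esub> z \<odot>\<^bsub>l2_space M\<^esub> F) \<in> S \<and> \<gamma> F = 0"
proof -
  obtain k where k: "k \<in> L" "K = cls k" using K by (rule l2_carrierE)
  define f where "f t = cauchy_kernel z t * k t" for t
  have f: "f \<in> L"
  proof (rule L2_bound)
    show "integrable M (\<lambda>t. (1 / \<bar>Im z\<bar>)\<^sup>2 * (cmod (k t))\<^sup>2)"
      using k by (simp add: L2_def)
    show "(cmod (f t))\<^sup>2 \<le> (1 / \<bar>Im z\<bar>)\<^sup>2 * (cmod (k t))\<^sup>2" for t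
      unfolding f_def norm_mult power_mult_distrib
      using cauchy_kernel_le[OF z, of t] by (intro mult_right_mono power_mono) auto
    show "f \<in> borel_measurable M" using L2_measurable[OF k(1)] unfolding f_def by measurable
  qed
  \<comment> \<open>The subtracted 0 is the constant of the pair, so \<open>\<gamma>\<close>
    vanishes.\<close>
  have "k t + z * f t = of_real t * f t - 0" for t
    using of_real_minus_nonzero[OF z, of t] by (simp add: f_def cauchy_kernel_def field_simps)
  hence mp: "mult_pair f (\<lambda>t. k t + z * f t) 0"
    using f k L2_add[OF k(1) L2_smult[OF f, of z]] by (simp add: mult_pair_def)
  have "K \<oplus>\<^bsub>l2_space M\<^esub> z \<odot>\<^bsub>l2_space M\<^esub> cls f = cls (\<lambda>t. k t + z * f t)"
    using f k by (simp add: l2_smult l2_add L2_smult)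
  thus ?thesis using S_intro[OF mp] \<gamma>_cls[OF mp] by (intro exI[of _ "cls f"]) simp
qed

text \<open>Over an infinite measure \<open>f\<close> need not be integrable, so Poisson integrals
  are taken of \<open>f\<close> times the kernel at i. Partial fractions reduce the products of
  kernels that arise to single kernels, against which \<open>f\<close> integrates to zero.\<close>

lemma cauchy_kernel_total:
  assumes F: "F \<in> carrier (l2_space M)"
    and orth: "\<And>z. Im z \<noteq> 0 \<Longrightarrow> ip (l2_space M) F (cls (cauchy_kernel z)) = 0"
  shows "F = \<zero>\<^bsub>l2_space M\<^esub>"
proof -
  obtain f where f: "f \<in> L" "F = cls f" using F by (rule l2_carrierE)
  have int: "integrable M (\<lambda>t. f t * cauchy_kernel z t)" if "Im z \<noteq> 0" for z
    by (rule L2_integrable_mult[OF f(1) cauchy_kernel_L2[OF that]])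
  \<comment> \<open>Orthogonality is used at \<open>cnj z\<close> because the inner product
    conjugates its second argument.\<close>
  have zero: "(LINT t|M. f t * cauchy_kernel z t) = 0" if "Im z \<noteq> 0" for z
    using orth[of "cnj z"] that f cauchy_kernel_L2[of "cnj z"] by (simp add: l2_ip cauchy_kernel_def)
  have "AE t in M. f t * cauchy_kernel \<i> t = 0"
  proof (rule poisson_integral_zero[OF sets_M int zero])
    fix x y :: real assume y: "0 < y" "y < 1"
    define z where "z = Complex x y"
    have z: "Im z \<noteq> 0" "Im (cnj z) \<noteq> 0" "z \<noteq> \<i>" "cnj z \<noteq> \<i>" using y by (auto simp: z_def complex_eq_iff)
    have "f t * cauchy_kernel \<i> t * of_real (y / ((t - x)\<^sup>2 + y\<^sup>2))
      = ((f t * cauchy_kernel z t - f t * cauchy_kernel \<i> t) / (z - \<i>)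
        - (f t * cauchy_kernel (cnj z) t - f t * cauchy_kernel \<i> t) / (cnj z - \<i>)) / (2 * \<i>)" for t
    proof -
      define r where "r = 1 / ((t - x)\<^sup>2 + y\<^sup>2)"
      have "(of_real t - z) * (of_real t - cnj z) = of_real ((t - x)\<^sup>2 + y\<^sup>2)"
        by (simp add: z_def complex_eq_iff power2_eq_square algebra_simps)
      hence kk: "cauchy_kernel z t * cauchy_kernel (cnj z) t = of_real r"
        by (simp add: cauchy_kernel_def r_def)
      have "z - cnj z = 2 * \<i> * of_real y" by (simp add: z_def complex_eq_iff)
      hence "cauchy_kernel z t - cauchy_kernel (cnj z) t = 2 * \<i> * of_real y * of_real r"
        using cauchy_kernel_diff[OF z(1,2), of t] by (simp only: kk)
      moreover have "y / ((t - x)\<^sup>2 + y\<^sup>2) = y * r" by (simp add: r_def)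
      ultimately have fact1: "of_real (y / ((t - x)\<^sup>2 + y\<^sup>2)) = (cauchy_kernel z t - cauchy_kernel (cnj z) t) / (2 * \<i>)"
        by (simp only:) simp
      have fact2: "(f t * cauchy_kernel w t - f t * cauchy_kernel \<i> t) / (w - \<i>) = f t * (cauchy_kernel w t * cauchy_kernel \<i> t)"
        if "Im w \<noteq> 0" "w \<noteq> \<i>" for w
        using cauchy_kernel_diff[OF that(1), of \<i> t] that(2) by (simp add: right_diff_distrib[symmetric])
      show ?thesis
        unfolding fact1 fact2[OF z(1,3)] fact2[OF z(2,4)] by (simp add: algebra_simps diff_divide_distrib)
    qed
    hence "(LINT t|M. f t * cauchy_kernel \<i> t * of_real (y / ((t - x)\<^sup>2 + y\<^sup>2)))
      = (LINT t|M. ((f t * cauchy_kernel z t - f t * cauchy_kernel \<i> t) / (z - \<i>)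
        - (f t * cauchy_kernel (cnj z) t - f t * cauchy_kernel \<i> t) / (cnj z - \<i>)) / (2 * \<i>))"
      by simp
    also have "\<dots> = 0"
      using int zero z by simp
    finally show "(LINT t|M. f t * cauchy_kernel \<i> t * of_real (y / ((t - x)\<^sup>2 + y\<^sup>2))) = 0" .
  qed simp_all
  hence "AE t in M. f t = 0"
    by eventually_elim (use of_real_minus_nonzero[of \<i>] in \<open>simp add: cauchy_kernel_def\<close>)
  thus ?thesis using f L2_zero[of M] by (simp add: l2_zero l2_class_eq)
qed

section \<open>Density of the minimal domain\<close>

lemma hnorm_cls_diff:
  assumes "f \<in> L" "g \<in> L"
  shows "(hnorm (l2_space M) (cls f \<ominus>\<^bsub>l2_space M\<^esub> cls g))\<^sup>2 = (LINT t|M. (cmod (f t - g t))\<^sup>2)"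
  using l2_hdist[OF assms] assms by (simp add: hdist_def)

lemma emeasure_interval_finite: "emeasure M {-real n..real n} < \<infinity>"
proof -
  have "integrable M (indicator {-real n..real n} :: real \<Rightarrow> real)"
  proof (rule Bochner_Integration.integrable_bound)
    show "integrable M (\<lambda>t. (1 + (real n)\<^sup>2) * (1 / (1 + t\<^sup>2)))"
      by (rule integrable_mult_right[OF integrable_M])
    show "AE t in M. norm (indicator {-real n..real n} t :: real) \<le> norm ((1 + (real n)\<^sup>2) * (1 / (1 + t\<^sup>2)))"
    proof (rule AE_I2)
      fix t
      show "norm (indicator {-real n..real n} t :: real) \<le> norm ((1 + (real n)\<^sup>2) * (1 / (1 + t\<^sup>2)))"
      proof (cases "t \<in> {-real n..real n}")
        case True
        hence "t\<^sup>2 \<le> (real n)\<^sup>2" by (intro power2_le_iff_abs_le[THEN iffD2]) auto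
        thus ?thesis using True one_plus_sq_pos[of t] by (simp add: add_nonneg_pos)
      qed simp
    qed
  qed measurable
  thus ?thesis by (simp add: integrable_indicator_iff)
qed

lemma measure_interval_unbounded: "\<exists>n. K < measure M {-real n..real n}"
proof -
  have "(\<lambda>n. emeasure M {-real n..real n}) \<longlonglongrightarrow> emeasure M (\<Union>n. {-real n..real n})"
    by (rule Lim_emeasure_incseq) (auto simp: incseq_def sets_M)
  also have "(\<Union>n. {-real n..real n}) = UNIV"
  proof -
    have "t \<in> (\<Union>n. {-real n..real n})" for t
    proof -
      obtain n where "\<bar>t\<bar> \<le> real n" using real_arch_simple by blast
      thus ?thesis by (auto intro!: exI[of _ n])
    qed
    thus ?thesis by blast
  qed
  finally have "\<forall>\<^sub>F n in sequentially. ennreal K < emeasure M {-real n..real n}"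
    unfolding infinite_M by (rule order_tendstoD(1)) simp
  then obtain n where "ennreal K < emeasure M {-real n..real n}"
    using eventually_happens'[OF sequentially_bot] by blast
  also have "emeasure M {-real n..real n} = ennreal (measure M {-real n..real n})"
    using emeasure_interval_finite[of n] by (intro emeasure_eq_ennreal_measure) auto
  finally show ?thesis by (auto simp: ennreal_less_iff not_le dest: ennreal_leI intro!: exI[of _ n])
      (metis ennreal_leI not_le)
qed

text \<open>Cutting off outside a bounded interval makes t g square integrable, with constant 0; the
  error tends to zero by dominated convergence.\<close>

lemma truncation_approx:
  assumes f: "f \<in> L" and \<epsilon>: "0 < \<epsilon>"
  obtains g where "mult_pair g (\<lambda>t. of_real t * g t) 0"
    "hnorm (l2_space M) (cls f \<ominus>\<^bsub>l2_space M\<^esub> cls g) < \<epsilon>"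
proof -
  note [measurable] = L2_measurable[OF f]
  have intf: "integrable M (\<lambda>t. (cmod (f t))\<^sup>2)" using f by (simp add: L2_def)
  define g where "g n t = (if t \<in> {-real n..real n} then f t else 0)" for n t
  have gm [measurable]: "g n \<in> borel_measurable M" for n unfolding g_def by measurable
  have gL: "g n \<in> L" for n by (rule L2_bound[OF gm intf]) (simp add: g_def)
  have mp: "mult_pair (g n) (\<lambda>t. of_real t * g n t) 0" for n
  proof -
    have "(\<lambda>t. of_real t * g n t) \<in> L"
    proof (rule L2_bound)
      show "integrable M (\<lambda>t. (real n)\<^sup>2 * (cmod (f t))\<^sup>2)" using intf by simp
      show "(cmod (of_real t * g n t))\<^sup>2 \<le> (real n)\<^sup>2 * (cmod (f t))\<^sup>2" for t
      proof (cases "t \<in> {-real n..real n}")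
        case True
        hence "t\<^sup>2 \<le> (real n)\<^sup>2" by (intro power2_le_iff_abs_le[THEN iffD2]) auto
        hence "t\<^sup>2 * (cmod (f t))\<^sup>2 \<le> (real n)\<^sup>2 * (cmod (f t))\<^sup>2" by (intro mult_right_mono) auto
        thus ?thesis using True by (simp add: g_def norm_mult power_mult_distrib)
      qed (auto simp: g_def)
    qed measurable
    thus ?thesis using gL by (simp add: mult_pair_def)
  qed
  have "(\<lambda>n. LINT t|M. (cmod (f t - g n t))\<^sup>2) \<longlonglongrightarrow> (LINT t|M. 0)"
  proof (rule integral_dominated_convergence[where w = "\<lambda>t. (cmod (f t))\<^sup>2"])
    show "AE t in M. (\<lambda>n. (cmod (f t - g n t))\<^sup>2) \<longlonglongrightarrow> 0"
    proof (rule AE_I2)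
      fix t
      obtain N where N: "\<bar>t\<bar> \<le> real N" using real_arch_simple by blast
      have "\<forall>\<^sub>F n in sequentially. (cmod (f t - g n t))\<^sup>2 = 0"
        using eventually_ge_at_top[of N]
      proof eventually_elim
        case (elim n)
        hence "\<bar>t\<bar> \<le> real n" using N by linarith
        thus ?case by (auto simp: g_def)
      qed
      thus "(\<lambda>n. (cmod (f t - g n t))\<^sup>2) \<longlonglongrightarrow> 0" by (rule tendsto_eventually)
    qed
  qed (auto simp: intf g_def)
  hence "\<forall>\<^sub>F n in sequentially. (LINT t|M. (cmod (f t - g n t))\<^sup>2) < \<epsilon>\<^sup>2"
    using \<epsilon> by (intro order_tendstoD(2)[where y = 0]) auto
  hence "\<exists>n. (LINT t|M. (cmod (f t - g n t))\<^sup>2) < \<epsilon>\<^sup>2"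
    by (rule eventually_happens'[OF sequentially_bot])
  then obtain n where n: "(LINT t|M. (cmod (f t - g n t))\<^sup>2) < \<epsilon>\<^sup>2" ..
  have "(hnorm (l2_space M) (cls f \<ominus>\<^bsub>l2_space M\<^esub> cls (g n)))\<^sup>2 < \<epsilon>\<^sup>2"
    using n hnorm_cls_diff[OF f gL[of n]] by simp
  hence "hnorm (l2_space M) (cls f \<ominus>\<^bsub>l2_space M\<^esub> cls (g n)) < \<epsilon>"
    by (rule power_less_imp_less_base) (use \<epsilon> in simp)
  thus ?thesis by (rule that[OF mp])
qed

text \<open>Here \<open>u\<close> is the normalized indicator function of a large interval: \<open>M\<close> being infinite
  makes its norm small.\<close>

lemma \<phi>_unbounded:
  assumes \<epsilon>: "0 < \<epsilon>"
  obtains u where "mult_pair u (\<lambda>t. of_real t * u t) 0" "\<phi> (cls u) = 1" "hnorm (l2_space M) (cls u) < \<epsilon>"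
proof -
  \<comment> \<open>The square norm of \<open>u\<close> will be the reciprocal of this
    measure.\<close>
  obtain n where n: "1 / \<epsilon>\<^sup>2 < measure M {-real n..real n}" using measure_interval_unbounded by blast
  define m where "m = measure M {-real n..real n}"
  have m: "0 < m" "1 / m < \<epsilon>\<^sup>2"
  proof -
    have "0 < 1 / \<epsilon>\<^sup>2" using \<epsilon> by simp
    thus "0 < m" using n unfolding m_def by linarith
    thus "1 / m < \<epsilon>\<^sup>2" using n \<epsilon> by (simp add: m_def field_simps)
  qed
  let ?I = "indicator {-real n..real n} :: real \<Rightarrow> real"
  have intI: "integrable M ?I"
    using emeasure_interval_finite by (simp add: integrable_indicator_iff sets_M)
  define u where "u t = complex_of_real (?I t / m)" for t
  have usq: "(cmod (u t))\<^sup>2 = ?I t / m\<^sup>2" for t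
    by (simp add: u_def norm_divide power_divide indicator_def)
  have um [measurable]: "u \<in> borel_measurable M" unfolding u_def by measurable
  have uL: "u \<in> L" using intI by (simp add: L2_def usq um)
  have "(\<lambda>t. of_real t * u t) \<in> L"
  proof (rule L2_bound)
    show "integrable M (\<lambda>t. (real n)\<^sup>2 / m\<^sup>2 * ?I t)" using intI by simp
    show "(cmod (of_real t * u t))\<^sup>2 \<le> (real n)\<^sup>2 / m\<^sup>2 * ?I t" for t
    proof (cases "t \<in> {-real n..real n}")
      case True
      hence "t\<^sup>2 \<le> (real n)\<^sup>2" by (intro power2_le_iff_abs_le[THEN iffD2]) auto
      thus ?thesis using True by (simp add: norm_mult power_mult_distrib usq divide_right_mono)
    qed (simp add: norm_mult power_mult_distrib usq)
  qed measurable
  hence mp: "mult_pair u (\<lambda>t. of_real t * u t) 0" using uL by (simp add: mult_pair_def)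
  have "\<phi>0 u (\<lambda>t. of_real t * u t) = (LINT t|M. u t)"
    unfolding \<phi>0_def
  proof (rule Bochner_Integration.integral_cong[OF refl])
    fix t
    have "u t * p t + of_real t * u t * q t = u t * (p t + of_real t * q t)" by (simp add: algebra_simps)
    thus "u t * p t + of_real t * u t * q t = u t" by (simp only: pq_identities(2) mult_1_right)
  qed
  also have "\<dots> = of_real (LINT t|M. ?I t / m)" unfolding u_def by (rule integral_complex_of_real)
  also have "\<dots> = 1" using m by (simp add: m_def)
  finally have "\<phi> (cls u) = 1" using \<phi>_cls[OF mp] by simp
  moreover have "(hnorm (l2_space M) (cls u))\<^sup>2 < \<epsilon>\<^sup>2"
  proof -
    have "(hnorm (l2_space M) (cls u))\<^sup>2 = (LINT t|M. ?I t / m\<^sup>2)"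
      using uL l2_ip_self[OF uL] by (simp add: H.hnorm_sq usq)
    also have "\<dots> = 1 / m" using m by (simp add: m_def[symmetric] power2_eq_square)
    finally show ?thesis using m by simp
  qed
  hence "hnorm (l2_space M) (cls u) < \<epsilon>" by (rule power_less_imp_less_base) (use \<epsilon> in simp)
  ultimately show ?thesis using that mp by blast
qed

text \<open>The kernel of an unbounded functional is dense: the boundary value of an approximating
  truncation \<open>g\<close> is removed by a multiple of a vector \<open>u\<close> that has
  \<open>\<phi> = 1\<close> but arbitrarily small norm.\<close>

lemma minimal_domain_dense: "H.dense_in {F \<in> Domain S. \<gamma> F = 0 \<and> \<phi> F = 0}"
  unfolding H.dense_in_def
proof (intro conjI ballI allI impI)
  show "{F \<in> Domain S. \<gamma> F = 0 \<and> \<phi> F = 0} \<subseteq> carrier (l2_space M)"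
    by (auto simp: mult_pair_def elim!: S_cases)
  fix F and \<epsilon> :: real assume F: "F \<in> carrier (l2_space M)" and \<epsilon>: "0 < \<epsilon>"
  obtain f where f: "f \<in> L" "F = cls f" using F by (rule l2_carrierE)
  have "0 < \<epsilon> / 2" using \<epsilon> by simp
  then obtain g where g: "mult_pair g (\<lambda>t. of_real t * g t) 0"
    "hnorm (l2_space M) (F \<ominus>\<^bsub>l2_space M\<^esub> cls g) < \<epsilon> / 2"
    using truncation_approx[OF f(1)] f(2) by metis
  define \<beta> where "\<beta> = \<phi> (cls g)"
  have "0 < \<epsilon> / (2 * (cmod \<beta> + 1))" using \<epsilon> by (simp add: add_nonneg_pos)
  then obtain u where u: "mult_pair u (\<lambda>t. of_real t * u t) 0" "\<phi> (cls u) = 1"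
    "hnorm (l2_space M) (cls u) < \<epsilon> / (2 * (cmod \<beta> + 1))"
    using \<phi>_unbounded by metis
  have c: "cls g \<in> carrier (l2_space M)" "cls u \<in> carrier (l2_space M)"
    using g u by (auto simp: mult_pair_def)
  have D: "cls g \<in> Domain S" "cls u \<in> Domain S" "(-\<beta>) \<odot>\<^bsub>l2_space M\<^esub> cls u \<in> Domain S"
    using S_intro[OF g(1)] S_intro[OF u(1)] S_intro[OF mult_pair_smult[OF u(1), of "-\<beta>"]] u(1)
    by (auto simp: l2_smult mult_pair_def)
  define G where "G = cls g \<oplus>\<^bsub>l2_space M\<^esub> (-\<beta>) \<odot>\<^bsub>l2_space M\<^esub> cls u"
  have "G \<in> Domain S"
    using D linear_S unfolding G_def linear_operator_def by fast
  moreover have "\<gamma> G = 0 \<and> \<phi> G = 0"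
    using D \<gamma>_cls[OF g(1)] \<gamma>_cls[OF u(1)] u(2) by (simp add: G_def boundary_add boundary_smult \<beta>_def)
  moreover have "hnorm (l2_space M) (F \<ominus>\<^bsub>l2_space M\<^esub> G) < \<epsilon>"
  proof -
    have "F \<ominus>\<^bsub>l2_space M\<^esub> G = (F \<ominus>\<^bsub>l2_space M\<^esub> cls g) \<oplus>\<^bsub>l2_space M\<^esub> \<beta> \<odot>\<^bsub>l2_space M\<^esub> cls u"
      by (rule H.eq_by_ip) (use F c in \<open>auto simp: G_def H.ip_simps\<close>)
    hence "hnorm (l2_space M) (F \<ominus>\<^bsub>l2_space M\<^esub> G)
        \<le> hnorm (l2_space M) (F \<ominus>\<^bsub>l2_space M\<^esub> cls g) + cmod \<beta> * hnorm (l2_space M) (cls u)"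
      using H.hnorm_triangle[of "F \<ominus>\<^bsub>l2_space M\<^esub> cls g" "\<beta> \<odot>\<^bsub>l2_space M\<^esub> cls u"] F c
      by (simp add: H.hnorm_smult)
    also have "cmod \<beta> * hnorm (l2_space M) (cls u) \<le> (cmod \<beta> + 1) * hnorm (l2_space M) (cls u)"
      using c by (intro mult_right_mono) auto
    also have "\<dots> < \<epsilon> / 2"
    proof -
      have "0 < cmod \<beta> + 1" by (simp add: add_nonneg_pos)
      thus ?thesis using u(3) by (simp add: field_simps)
    qed
    finally show ?thesis using g(2) by simp
  qed
  ultimately show "\<exists>G\<in>{F \<in> Domain S. \<gamma> F = 0 \<and> \<phi> F = 0}. hnorm (l2_space M) (F \<ominus>\<^bsub>l2_space M\<^esub> G) < \<epsilon>"
    by blast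
qed

lemma boundary_triple:
  assumes "\<And>z. Im z \<noteq> 0 \<Longrightarrow> V z = of_real Q + (LINT t|M. 1 / (of_real t - z) - of_real (t / (1 + t\<^sup>2)))"
  shows "boundary_triple (l2_space M) S \<gamma> \<phi> (\<lambda>z. cls (cauchy_kernel z)) V"
proof (intro boundary_triple.intro boundary_triple_axioms.intro H.chilbert_space_axioms linear_S
    boundary_bounded minimal_domain_dense)
  fix z assume z: "Im z \<noteq> 0"
  show "(cls (cauchy_kernel z), z \<odot>\<^bsub>l2_space M\<^esub> cls (cauchy_kernel z)) \<in> S"
    using S_intro[OF cauchy_kernel_pair[OF z]] cauchy_kernel_L2[OF z] by (simp add: l2_smult)
  show "\<gamma> (cls (cauchy_kernel z)) = 1" by (rule \<gamma>_cls[OF cauchy_kernel_pair[OF z]])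
  show "\<phi> (cls (cauchy_kernel z)) = V z" using assms[OF z] \<phi>_cauchy_kernel[OF z] by simp
qed (use boundary_add boundary_smult green_S resolvent_S cauchy_kernel_total in blast)+

end

section \<open>The parameters\<close>

text \<open>Both fractions hold for every positive \<open>a\<close>. The second comes from the first
  by changing the sign of \<open>s\<close> and of the numerator, which matches the oddness of the
  left side in \<open>s\<close>.\<close>

lemma kappa_formulas:
  fixes a b s Q :: real
  assumes s: "s\<^sup>2 = b\<^sup>2 + 4 * Q\<^sup>2" and b: "b = Q\<^sup>2 + a\<^sup>2 - 1" and a: "0 < a" and Q: "Q \<noteq> 0"
  shows "s / ((1 + a)\<^sup>2 + Q\<^sup>2) =
      ((b - 2 * Q\<^sup>2 - s)\<^sup>2 - a * (b - s)\<^sup>2 + 4 * Q\<^sup>2 * a * (a - 1))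
      / ((b - 2 * Q\<^sup>2 - s)\<^sup>2 + a * (b - s)\<^sup>2 + 4 * Q\<^sup>2 * a * (a + 1))" (is "?k = ?N1 / ?D1")
    and "s / ((1 + a)\<^sup>2 + Q\<^sup>2) =
      (a * (b + s)\<^sup>2 - (b - 2 * Q\<^sup>2 + s)\<^sup>2 - 4 * Q\<^sup>2 * a * (a - 1))
      / ((b - 2 * Q\<^sup>2 + s)\<^sup>2 + a * (b + s)\<^sup>2 + 4 * Q\<^sup>2 * a * (a + 1))" (is "?k = ?N2 / ?D2")
proof -
  have n: "(1 + a)\<^sup>2 + Q\<^sup>2 > 0" using a by (simp add: add_pos_nonneg)
  have "4 * Q\<^sup>2 * a * (a + 1) > 0" using a Q by simp
  hence D: "?D1 > 0" "?D2 > 0" using a by (simp_all add: add_nonneg_pos)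
  \<comment> \<open>The first factor on the right is the quotient of polynomial division in \<open>s\<close>.\<close>
  have "s * ?D1 - ?N1 * ((1 + a)\<^sup>2 + Q\<^sup>2) =
      ((1 + a) * s + Q\<^sup>2 - a\<^sup>2 + 1 - a * Q\<^sup>2 - a ^ 3 + a) * (s\<^sup>2 - (b\<^sup>2 + 4 * Q\<^sup>2))"
    unfolding b by (simp add: power2_eq_square power3_eq_cube algebra_simps)
  hence "s * ?D1 = ?N1 * ((1 + a)\<^sup>2 + Q\<^sup>2)" using s by simp
  thus "?k = ?N1 / ?D1" using n D by (subst frac_eq_eq) auto
  have "s * ?D2 - ?N2 * ((1 + a)\<^sup>2 + Q\<^sup>2) =
      ((1 + a) * s - Q\<^sup>2 + a\<^sup>2 - 1 + a * Q\<^sup>2 + a ^ 3 - a) * (s\<^sup>2 - (b\<^sup>2 + 4 * Q\<^sup>2))"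
    unfolding b by (simp add: power2_eq_square power3_eq_cube algebra_simps)
  hence "s * ?D2 = ?N2 * ((1 + a)\<^sup>2 + Q\<^sup>2)" using s by simp
  thus "?k = ?N2 / ?D2" using n D by (subst frac_eq_eq) auto
qed

text \<open>With N = (1 + a)^2 + Q^2, the numerator on the right multiplied by N is -2 (1 - (a + i
  Q)^2). It factors, and one factor cancels against N = (1 + a + i Q) (1 + a - i Q).\<close>

lemma U_formula:
  fixes a Q \<kappa> :: real
  assumes a: "0 < a" and \<kappa>: "0 < \<kappa>" "\<kappa>\<^sup>2 = ((1 - a)\<^sup>2 + Q\<^sup>2) / ((1 + a)\<^sup>2 + Q\<^sup>2)"
  shows "- cnj (Complex (1 - a) Q / (of_real \<kappa> * Complex (1 + a) Q))
    = ((of_real a + of_real Q * \<i>) * (1 - of_real (\<kappa>\<^sup>2)) - 1 - of_real (\<kappa>\<^sup>2)) / (2 * of_real \<kappa>)"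
proof -
  define N where "N = (1 + a)\<^sup>2 + Q\<^sup>2"
  have N: "N > 0" using a by (simp add: N_def add_pos_nonneg)
  have nz: "Complex (1 + a) (- Q) \<noteq> 0" "Complex (1 + a) Q \<noteq> 0" using a by (simp_all add: complex_eq_iff)
  have k1: "1 - \<kappa>\<^sup>2 = 4 * a / N" and k2: "1 + \<kappa>\<^sup>2 = (2 + 2 * a\<^sup>2 + 2 * Q\<^sup>2) / N"
    using N unfolding \<kappa>(2) N_def[symmetric]
    by (simp_all add: field_simps) (simp_all add: N_def power2_eq_square algebra_simps)
  have NC: "of_real N = Complex (1 + a) Q * Complex (1 + a) (- Q)"
    by (simp add: N_def complex_eq_iff power2_eq_square)
  have "(of_real a + of_real Q * \<i>) * of_real (4 * a) - of_real (2 + 2 * a\<^sup>2 + 2 * Q\<^sup>2)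
      = - (2 * Complex (1 - a) (- Q) * Complex (1 + a) Q)"
    by (simp add: complex_eq_iff power2_eq_square algebra_simps)
  moreover have "(of_real a + of_real Q * \<i>) * (1 - of_real (\<kappa>\<^sup>2)) - 1 - of_real (\<kappa>\<^sup>2)
      = (of_real a + of_real Q * \<i>) * of_real (1 - \<kappa>\<^sup>2) - of_real (1 + \<kappa>\<^sup>2)"
    by (simp add: algebra_simps)
  ultimately have "(of_real a + of_real Q * \<i>) * (1 - of_real (\<kappa>\<^sup>2)) - 1 - of_real (\<kappa>\<^sup>2)
      = - (2 * Complex (1 - a) (- Q) * Complex (1 + a) Q) / of_real N"
    unfolding k1 k2 by (simp only: of_real_divide times_divide_eq_right diff_divide_distrib[symmetric])
  also have "\<dots> = - (2 * Complex (1 - a) (- Q)) / Complex (1 + a) (- Q)"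
    using N nz by (simp add: NC)
  finally show ?thesis
    using \<kappa>(1) nz by (simp add: complex_cnj_divide complex_cnj field_simps)
qed

theorem theorem29:
  fixes Q a b :: real and V :: "complex \<Rightarrow> complex"
  assumes "Q \<noteq> 0"
    and "class_N Q a V"
    and "b = Q\<^sup>2 + a\<^sup>2 - 1"
  shows "\<exists>(\<Theta> :: (real \<Rightarrow> complex) set l_system) gp gm (\<kappa> :: real) (U :: complex).
    minimal_l_system \<Theta> \<and> realized_by V \<Theta> \<and>
    normalized_deficiency_pair \<Theta> gp gm \<and>
    0 \<le> \<kappa> \<and> main_parameter \<Theta> gp gm (of_real \<kappa>) \<and>
    quasi_kernel_parameter \<Theta> gp gm U \<and>
    exactly_one
      (a = 1 \<and>
       \<kappa> = \<bar>Q\<bar> / sqrt (Q\<^sup>2 + 4) \<and>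
       U = of_real (Q / \<bar>Q\<bar>) * ((- of_real Q + 2 * \<i>) / of_real (sqrt (Q\<^sup>2 + 4))))
      (0 < a \<and> a < 1 \<and>
       \<kappa> = ((b - 2 * Q\<^sup>2 - sqrt (b\<^sup>2 + 4 * Q\<^sup>2))\<^sup>2 - a * (b - sqrt (b\<^sup>2 + 4 * Q\<^sup>2))\<^sup>2
              + 4 * Q\<^sup>2 * a * (a - 1))
         / ((b - 2 * Q\<^sup>2 - sqrt (b\<^sup>2 + 4 * Q\<^sup>2))\<^sup>2 + a * (b - sqrt (b\<^sup>2 + 4 * Q\<^sup>2))\<^sup>2
              + 4 * Q\<^sup>2 * a * (a + 1)) \<and>
       U = ((of_real a + of_real Q * \<i>) * (1 - of_real (\<kappa>\<^sup>2)) - 1 - of_real (\<kappa>\<^sup>2))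
             / (2 * of_real \<kappa>))
      (1 < a \<and>
       \<kappa> = (a * (b + sqrt (b\<^sup>2 + 4 * Q\<^sup>2))\<^sup>2 - (b - 2 * Q\<^sup>2 + sqrt (b\<^sup>2 + 4 * Q\<^sup>2))\<^sup>2
              - 4 * Q\<^sup>2 * a * (a - 1))
         / ((b - 2 * Q\<^sup>2 + sqrt (b\<^sup>2 + 4 * Q\<^sup>2))\<^sup>2 + a * (b + sqrt (b\<^sup>2 + 4 * Q\<^sup>2))\<^sup>2
              + 4 * Q\<^sup>2 * a * (a + 1)) \<and>
       U = ((of_real a + of_real Q * \<i>) * (1 - of_real (\<kappa>\<^sup>2)) - 1 - of_real (\<kappa>\<^sup>2))
             / (2 * of_real \<kappa>))"
proof -
  obtain \<mu> :: "real measure" where \<mu>: "sets \<mu> = sets borel" "emeasure \<mu> UNIV = \<infinity>"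
    "integrable \<mu> (\<lambda>t. 1 / (1 + t\<^sup>2))" "(LINT t|\<mu>. 1 / (1 + t\<^sup>2)) = a"
    and V: "\<And>z. Im z \<noteq> 0 \<Longrightarrow>
        V z = of_real Q + (LINT t|\<mu>. 1 / (of_real t - z) - of_real (t / (1 + t\<^sup>2)))"
    using assms(2) unfolding class_N_def by blast
  interpret multiplication_model \<mu> Q a
    by unfold_locales (fact \<mu>)+
  interpret B: boundary_triple "l2_space \<mu>" S \<gamma> \<phi> "\<lambda>z. cls (cauchy_kernel z)" V
    by (rule boundary_triple) (fact V)
  have a: "0 < a" by (rule a_pos)
  \<comment> \<open>At i the real part of the kernel is exactly the subtracted regularization, so
    only i / (1 + t^2) remains under the integral.\<close>
  have Vi: "V \<i> = Complex Q a"
  proof -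
    have "1 / (of_real t - \<i>) - of_real (t / (1 + t\<^sup>2)) = \<i> * of_real (1 / (1 + t\<^sup>2))" for t
    proof -
      have "(of_real t - \<i>) * (of_real t + \<i>) = of_real (1 + t\<^sup>2)"
        by (simp add: complex_eq_iff power2_eq_square)
      moreover have "of_real t + \<i> \<noteq> 0" using of_real_minus_nonzero[of "-\<i>" t] by simp
      hence "1 / (of_real t - \<i>) = (of_real t + \<i>) / ((of_real t - \<i>) * (of_real t + \<i>))" by simp
      ultimately have "1 / (of_real t - \<i>) = (of_real t + \<i>) / of_real (1 + t\<^sup>2)" by (simp only:)
      thus ?thesis by (simp add: add_divide_distrib)
    qed
    hence "V \<i> = of_real Q + (LINT t|\<mu>. \<i> * of_real (1 / (1 + t\<^sup>2)))"
      using V[of \<i>] by simp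
    also have "(LINT t|\<mu>. \<i> * of_real (1 / (1 + t\<^sup>2))) = \<i> * of_real a"
      by (simp only: integral_mult_right_zero integral_complex_of_real \<mu>(4))
    finally show ?thesis by (simp add: complex_eq_iff)
  qed
  define s where "s = sqrt (b\<^sup>2 + 4 * Q\<^sup>2)"
  define N where "N = (1 + a)\<^sup>2 + Q\<^sup>2"
  \<comment> \<open>The modulus of (1 + i V(i)) / (1 + i V(-i)).\<close>
  define \<kappa> where "\<kappa> = s / N"
  have s2: "s\<^sup>2 = b\<^sup>2 + 4 * Q\<^sup>2" by (simp add: s_def)
  have s: "s > 0" using \<open>Q \<noteq> 0\<close> by (simp add: s_def add_nonneg_pos)
  have N: "N > 0" using a by (simp add: N_def add_pos_nonneg)
  have \<kappa>: "0 < \<kappa>" using s N by (simp add: \<kappa>_def)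
  have "s\<^sup>2 = ((1 - a)\<^sup>2 + Q\<^sup>2) * N"
    unfolding s2 assms(3) N_def by (simp add: power2_eq_square algebra_simps)
  hence \<kappa>2: "\<kappa>\<^sup>2 = ((1 - a)\<^sup>2 + Q\<^sup>2) / N"
    using N by (simp add: \<kappa>_def power_divide power2_eq_square)
  have "(1 - a)\<^sup>2 + Q\<^sup>2 < N" using a by (simp add: N_def power2_eq_square algebra_simps)
  hence "\<kappa>\<^sup>2 < 1\<^sup>2" using N by (simp add: \<kappa>2)
  hence \<kappa>1: "\<kappa> < 1" by (rule power_less_imp_less_base) simp
  \<comment> \<open>The phase of that quotient; giving it to \<open>gm\<close> makes the von Neumann
    parameter the positive number \<open>\<kappa>\<close>.\<close>
  define w where "w = Complex (1 - a) Q / (of_real \<kappa> * Complex (1 + a) Q)"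
  define U where "U = - cnj w"
  have nz: "Complex (1 + a) Q \<noteq> 0" using a by (simp add: complex_eq_iff)
  have "(cmod w)\<^sup>2 = 1"
    using \<kappa> N by (simp add: w_def norm_divide norm_mult power_divide power_mult_distrib cmod_power2
        \<kappa>2 N_def[symmetric]) (use \<kappa>2 \<kappa> in auto)
  hence w: "cmod w = 1" using power2_eq_1_iff[of "cmod w"] norm_ge_zero[of w] by linarith
  have "of_real \<kappa> * w * (1 + \<i> * V (-\<i>)) = 1 + \<i> * V \<i>"
  proof -
    have "1 + \<i> * V (-\<i>) = Complex (1 + a) Q" "1 + \<i> * V \<i> = Complex (1 - a) Q"
      by (simp_all add: B.V_cnj Vi complex_eq_iff)
    thus ?thesis using \<kappa> nz by (simp add: w_def)
  qed
  then obtain gp gm where params: "normalized_deficiency_pair B.system gp gm"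
    "main_parameter B.system gp gm (of_real \<kappa>)" "quasi_kernel_parameter B.system gp gm U"
    using B.von_Neumann_parameters[of w "of_real \<kappa>" U] w \<kappa> \<kappa>1 U_def by auto
  have U: "U = ((of_real a + of_real Q * \<i>) * (1 - of_real (\<kappa>\<^sup>2)) - 1 - of_real (\<kappa>\<^sup>2)) / (2 * of_real \<kappa>)"
    unfolding U_def w_def by (rule U_formula[OF a \<kappa>]) (simp add: \<kappa>2 N_def)
  note formulas = kappa_formulas[OF s2 assms(3) a assms(1), folded N_def, folded \<kappa>_def, unfolded s_def]
  have case1: "\<kappa> = \<bar>Q\<bar> / sqrt (Q\<^sup>2 + 4) \<and>
       U = of_real (Q / \<bar>Q\<bar>) * ((- of_real Q + 2 * \<i>) / of_real (sqrt (Q\<^sup>2 + 4)))" if "a = 1"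
  proof -
    \<comment> \<open>For \<open>a = 1\<close> one has b = Q^2, so s^2 = Q^2 (Q^2 + 4) and N = Q^2 +
      4 become expressions in \<open>r\<close>.\<close>
    define r where "r = sqrt (Q\<^sup>2 + 4)"
    have r: "0 < r" "r\<^sup>2 = Q\<^sup>2 + 4" by (simp_all add: r_def add_nonneg_pos)
    have Nr: "N = r\<^sup>2" using that by (simp add: N_def r)
    have "s\<^sup>2 = (\<bar>Q\<bar> * r)\<^sup>2"
      using that by (simp add: s2 assms(3) power_mult_distrib r) (simp add: power2_eq_square power4_eq_xxxx algebra_simps)
    hence "s = \<bar>Q\<bar> * r" using s r by (simp add: power2_eq_iff_nonneg)
    hence k: "\<kappa> = \<bar>Q\<bar> / r" using r(1) by (simp add: \<kappa>_def Nr power2_eq_square)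
    have "U = of_real (Q / \<bar>Q\<bar>) * ((- of_real Q + 2 * \<i>) / of_real r)"
    proof -
      have k2: "\<kappa>\<^sup>2 = Q\<^sup>2 / r\<^sup>2" by (simp add: k power_divide)
      have "1 - Q\<^sup>2 / r\<^sup>2 = 4 / r\<^sup>2" "1 + Q\<^sup>2 / r\<^sup>2 = (4 + 2 * Q\<^sup>2) / r\<^sup>2"
      proof -
        have "1 - Q\<^sup>2 / r\<^sup>2 = (r\<^sup>2 - Q\<^sup>2) / r\<^sup>2" "1 + Q\<^sup>2 / r\<^sup>2 = (r\<^sup>2 + Q\<^sup>2) / r\<^sup>2"
          using r(1) by (simp_all add: diff_divide_distrib add_divide_distrib)
        thus "1 - Q\<^sup>2 / r\<^sup>2 = 4 / r\<^sup>2" "1 + Q\<^sup>2 / r\<^sup>2 = (4 + 2 * Q\<^sup>2) / r\<^sup>2"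
          by (simp_all only: r(2)) simp_all
      qed
      moreover have "(1 + of_real Q * \<i>) * (1 - of_real (\<kappa>\<^sup>2)) - 1 - of_real (\<kappa>\<^sup>2)
          = (1 + of_real Q * \<i>) * of_real (1 - \<kappa>\<^sup>2) - of_real (1 + \<kappa>\<^sup>2)" by (simp add: algebra_simps)
      ultimately have "U = ((1 + of_real Q * \<i>) * of_real (4 / r\<^sup>2) - of_real ((4 + 2 * Q\<^sup>2) / r\<^sup>2)) / (2 * of_real \<kappa>)"
        unfolding U k2[symmetric] using that by (simp only: of_real_1 k2)
      also have "\<dots> = of_real (Q / \<bar>Q\<bar>) * ((- of_real Q + 2 * \<i>) / of_real r)"
        using r(1) \<open>Q \<noteq> 0\<close> unfolding k
        by (cases "Q > 0") (auto simp: complex_eq_iff field_simps power2_eq_square)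
      finally show ?thesis .
    qed
    thus ?thesis using k by (simp only: r_def)
  qed
  show ?thesis
  proof (intro exI conjI)
    show "minimal_l_system B.system" by (rule B.minimal)
    show "realized_by V B.system" by (rule B.realized)
    show "normalized_deficiency_pair B.system gp gm" "main_parameter B.system gp gm (of_real \<kappa>)"
      "quasi_kernel_parameter B.system gp gm U" by (fact params)+
    show "0 \<le> \<kappa>" using \<kappa> by simp
    \<comment> \<open>The position of \<open>a\<close> relative to 1 alone makes the alternatives
      exclusive.\<close>
    consider "a = 1" | "a < 1" | "1 < a" by linarith
    thus "exactly_one
      (a = 1 \<and>
       \<kappa> = \<bar>Q\<bar> / sqrt (Q\<^sup>2 + 4) \<and>
       U = of_real (Q / \<bar>Q\<bar>) * ((- of_real Q + 2 * \<i>) / of_real (sqrt (Q\<^sup>2 + 4))))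
      (0 < a \<and> a < 1 \<and>
       \<kappa> = ((b - 2 * Q\<^sup>2 - sqrt (b\<^sup>2 + 4 * Q\<^sup>2))\<^sup>2 - a * (b - sqrt (b\<^sup>2 + 4 * Q\<^sup>2))\<^sup>2
              + 4 * Q\<^sup>2 * a * (a - 1))
         / ((b - 2 * Q\<^sup>2 - sqrt (b\<^sup>2 + 4 * Q\<^sup>2))\<^sup>2 + a * (b - sqrt (b\<^sup>2 + 4 * Q\<^sup>2))\<^sup>2
              + 4 * Q\<^sup>2 * a * (a + 1)) \<and>
       U = ((of_real a + of_real Q * \<i>) * (1 - of_real (\<kappa>\<^sup>2)) - 1 - of_real (\<kappa>\<^sup>2))
             / (2 * of_real \<kappa>))
      (1 < a \<and>
       \<kappa> = (a * (b + sqrt (b\<^sup>2 + 4 * Q\<^sup>2))\<^sup>2 - (b - 2 * Q\<^sup>2 + sqrt (b\<^sup>2 + 4 * Q\<^sup>2))\<^sup>2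
              - 4 * Q\<^sup>2 * a * (a - 1))
         / ((b - 2 * Q\<^sup>2 + sqrt (b\<^sup>2 + 4 * Q\<^sup>2))\<^sup>2 + a * (b + sqrt (b\<^sup>2 + 4 * Q\<^sup>2))\<^sup>2
              + 4 * Q\<^sup>2 * a * (a + 1)) \<and>
       U = ((of_real a + of_real Q * \<i>) * (1 - of_real (\<kappa>\<^sup>2)) - 1 - of_real (\<kappa>\<^sup>2))
             / (2 * of_real \<kappa>))"
    proof cases
      case 1
      thus ?thesis using case1 unfolding exactly_one_def by simp
    next
      case 2
      thus ?thesis using a formulas(1) U unfolding exactly_one_def by simp
    next
      case 3
      thus ?thesis using formulas(2) U unfolding exactly_one_def by simp
    qed
  qed
qed

end
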